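(* For every $\varepsilon>0$ the following holds. For positive integers $n$ and $e\le\binom{n}{2}$, write $m=\binom{n}{2}-e$. Then $$f(n,e) = \begin{cases} \binom{n}{2}-\Theta\left(\frac{m^2}{\log^2 m}\right) & \text{ if } m \leq n \log n, \\[4pt] \Theta\left(\frac{n^3 \log n}{m}\right) & \text{ if } n \log n < m < n^{3/2-\varepsilon}. \end{cases}$$
   Context: A graph $H$ is called $(n,e)$-unavoidable if every graph on $n$ vertices with $e$ edges contains a copy of $H$ as a (not necessarily induced) subgraph. $f(n,e)$ denotes the maximum number of edges of an $(n,e)$-unavoidable graph. $\log$ denotes the natural logarithm. $\Theta$ is the usual asymptotic notation: $a=\Theta(b)$ means there are positive constants $c,C$ with $cb\le a\le Cb$ (the constants may depend on $\varepsilon$, and the statement is asymptotic in $n$). Floors and ceilings are omitted where not essential. *)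

theory Defs
  imports Complex_Main
begin

text \<open>A finite simple graph is a pair of a vertex set and a set of two-element subsets of it.\<close>

type_synonym 'a graph = "'a set \<times> 'a set set"

abbreviation verts :: "'a graph \<Rightarrow> 'a set" where "verts \<equiv> fst"

abbreviation edges :: "'a graph \<Rightarrow> 'a set set" where "edges \<equiv> snd"

definition simple_graph :: "'a graph \<Rightarrow> bool" where
  "simple_graph G \<longleftrightarrow> finite (verts G) \<and> edges G \<subseteq> {d. d \<subseteq> verts G \<and> card d = 2}"

definition contains_copy :: "'b graph \<Rightarrow> 'a graph \<Rightarrow> bool" where
  "contains_copy G H \<longleftrightarrow>
     (\<exists>\<phi>. inj_on \<phi> (verts H) \<and> \<phi> ` verts H \<subseteq> verts G \<and> (\<forall>d\<in>edges H. \<phi> ` d \<in> edges G))"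

text \<open>Up to isomorphism every finite graph has its vertices in \<^typ>\<open>nat\<close>, so it is enough to let
  the host graphs here, and the graphs \<open>H\<close> in the definition of \<open>max_unavoidable\<close>, range over graphs
  with natural numbers as vertices.\<close>

definition unavoidable :: "nat \<Rightarrow> nat \<Rightarrow> 'a graph \<Rightarrow> bool" where
  "unavoidable n e H \<longleftrightarrow> simple_graph H \<and>
     (\<forall>G :: nat graph. simple_graph G \<and> card (verts G) = n \<and> card (edges G) = e
        \<longrightarrow> contains_copy G H)"

text \<open>This is \<open>f(n,e)\<close>. The maximum exists whenever \<open>e\<close> is at most \<open>n choose 2\<close>; see
  \<open>max_unavoidable_well_defined\<close> below.\<close>

definition max_unavoidable :: "nat \<Rightarrow> nat \<Rightarrow> nat" where
  "max_unavoidable n e = Max {card (edges H) | H :: nat graph. unavoidable n e H}"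

lemma simple_graph_finite_edges: "simple_graph G \<Longrightarrow> finite (edges G)"
  by (rule finite_subset[of _ "Pow (verts G)"]) (auto simp: simple_graph_def)

lemma contains_copy_card_edges_le:
  assumes "simple_graph G" "simple_graph H" "contains_copy G H"
  shows "card (edges H) \<le> card (edges G)"
proof -
  obtain \<phi> where inj: "inj_on \<phi> (verts H)" and sub: "\<forall>d\<in>edges H. \<phi> ` d \<in> edges G"
    using assms(3) by (auto simp: contains_copy_def)
  have "edges H \<subseteq> Pow (verts H)" using assms(2) by (auto simp: simple_graph_def)
  hence "inj_on ((`) \<phi>) (edges H)"
    by (rule inj_on_subset[OF inj_on_image_Pow[OF inj]])
  moreover have "((`) \<phi>) ` edges H \<subseteq> edges G" using sub by blast
  ultimately show ?thesis
    using simple_graph_finite_edges[OF assms(1)] by (rule card_inj_on_le)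
qed

lemma max_unavoidable_well_defined:
  assumes "e \<le> n choose 2"
  shows "finite {card (edges H) | H :: nat graph. unavoidable n e H}"
    and "{card (edges H) | H :: nat graph. unavoidable n e H} \<noteq> {}"
proof -
  have card_pairs: "card {d. d \<subseteq> {..<n} \<and> card d = 2} = n choose 2"
    by (simp add: n_subsets)
  obtain E where "E \<subseteq> {d. d \<subseteq> {..<n} \<and> card d = 2}" "card E = e"
    by (rule obtain_subset_with_card_n[OF assms[folded card_pairs]])
  hence G: "simple_graph ({..<n}, E)" "card (edges ({..<n}, E)) = e" "card (verts ({..<n}, E)) = n"
    by (simp_all add: simple_graph_def)
  have "{card (edges H) | H :: nat graph. unavoidable n e H} \<subseteq> {..e}"
  proof
    fix k
    assume "k \<in> {card (edges H) | H :: nat graph. unavoidable n e H}"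
    then obtain H :: "nat graph" where k: "k = card (edges H)" and H: "unavoidable n e H"
      by blast
    have "simple_graph H" "contains_copy ({..<n}, E) H"
      using H G by (simp_all add: unavoidable_def)
    from contains_copy_card_edges_le[OF G(1) this] show "k \<in> {..e}"
      using G(2) k by simp
  qed
  thus "finite {card (edges H) | H :: nat graph. unavoidable n e H}"
    by (rule finite_subset) simp
  have "unavoidable n e ({} :: nat set, {})"
    by (simp add: unavoidable_def simple_graph_def contains_copy_def)
  thus "{card (edges H) | H :: nat graph. unavoidable n e H} \<noteq> {}" by blast
qed

end

(*
  Passing to complements, H is unavoidable for (n, e) iff the complement F of H on n vertices
  contains every graph with n vertices and m = (n choose 2) - e edges.

  Sparse universal F for m <= n ln n (the heart of the matter). The j-th largest degree of a graph M
  with m edges is at most 2m/j. Spots of F are arranged accordingly: a set T of about m/ln^2 m spots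
  joined to everything, a clique on about 20m/ln m spots, and a sequence of small parts of about sqrt m
  spots, the part at position p being joined at random with density about 2^(-p ln m/(20m)) to everything
  before it; this gives O(m^2/ln^2 m) edges. To embed M, put into T the vertices of degree above ln^2 m
  together with all neighbours of a small independent set I. Order the rest by degree and colour it
  greedily with bounded class size so that vertices of one class are at distance at least three.
  The classes are placed into the parts one after another by Hall's theorem, which needs a little slack.
  Finally I, whose neighbours all sit in T, fills the spots left over.

  For m > n ln n take disjoint copies of the complement of such an F on n0 ~ n^2 ln n/m vertices:
  by averaging, any graph with m edges has about n/n0 disjoint n0-subsets with O(m (n0/n)^2) edges each.

  The matching upper bounds on f count pairs (graph, embedding).
*)
theory Submission
  imports Defs "HOL-Library.Disjoint_Sets" "HOL-Library.FuncSet" "HOL-Real_Asymp.Real_Asymp"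
begin

section \<open>Matchings and colourings\<close>

text \<open>The density of the random joins is dictated by the degree bound: a vertex at position p
  has at most 2m/p neighbours, so with density 2^(-p/b) and b = 20m/ln m a spot suits it with
  probability about 2^(-2m/b), which is at least m^(-1/10) wherever p lies. A slack of m^(1/4) spots
  per part is therefore enough for Hall's condition, while the edge count decays geometrically on
  the scale b. The obstacle is that F has exactly n spots, so all of them must be used, whereas each
  of up to about 2 sqrt m parts leaves about m^(1/4) spots empty. These m^(3/4+o(1)) holes are what
  I, of size about m^(4/5), has to absorb; its neighbours number only m^(4/5+o(1)), so T can afford
  them. Distance three within a class makes the prescribed neighbourhoods disjoint, hence the
  corresponding events independent. For the upper bound on f in the first range only graphs on k =
  m/ln m vertices are counted: the k^k choices then cost at most e^m, a constant factor per edge,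
  whereas n^n would be too much.\<close>

lemma hall_marriage:
  assumes "finite I" "\<And>i. i \<in> I \<Longrightarrow> finite (C i)"
    and "\<And>J. J \<subseteq> I \<Longrightarrow> card J \<le> card (\<Union>(C ` J))"
  shows "\<exists>h. inj_on h I \<and> (\<forall>i\<in>I. h i \<in> C i)"
  using assms
proof (induction "card I" arbitrary: I C rule: less_induct)
  case less
  show ?case
  proof (cases "I = {}")
    case True
    then show ?thesis by simp
  next
    case False
    show ?thesis
    proof (cases "\<exists>J. J \<subset> I \<and> J \<noteq> {} \<and> card (\<Union>(C ` J)) \<le> card J")
      \<comment> \<open>A tight set is matched inside its own neighbourhood \<open>U\<close>. Hall's
        condition survives outside \<open>U\<close>, because for \<open>K\<close> disjoint from
        \<open>J\<close> the inequality for \<open>K \<union> J\<close> loses at most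
        \<open>card J\<close>.\<close>
      case True
      then obtain J where J: "J \<subset> I" "J \<noteq> {}" "card (\<Union>(C ` J)) \<le> card J" by blast
      define U where "U = \<Union>(C ` J)"
      have finJ: "finite J" using J(1) less.prems(1) by (meson finite_subset psubset_imp_subset)
      have "\<exists>h. inj_on h J \<and> (\<forall>i\<in>J. h i \<in> C i)"
      proof (rule less.hyps)
        show "card J < card I" using J(1) less.prems(1) by (simp add: psubset_card_mono)
        show "finite J" by (rule finJ)
        show "finite (C i)" if "i \<in> J" for i by (rule less.prems(2)) (use that J(1) in blast)
        show "card K \<le> card (\<Union>(C ` K))" if "K \<subseteq> J" for K
          by (rule less.prems(3)) (use that J(1) in blast)
      qed
      then obtain h where h: "inj_on h J" "\<forall>i\<in>J. h i \<in> C i" by blast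
      have "\<exists>g. inj_on g (I - J) \<and> (\<forall>i\<in>I - J. g i \<in> C i - U)"
      proof (rule less.hyps)
        show "card (I - J) < card I" using J less.prems(1) by (intro psubset_card_mono) auto
        show "finite (I - J)" using less.prems(1) by simp
        show "finite (C i - U)" if "i \<in> I - J" for i using less.prems(2) that by simp
        fix K assume K: "K \<subseteq> I - J"
        have finK: "finite K" using K less.prems(1) by (meson finite_Diff finite_subset)
        have "card (K \<union> J) \<le> card (\<Union>(C ` (K \<union> J)))"
          by (rule less.prems(3)) (use K J(1) in blast)
        also have "\<Union>(C ` (K \<union> J)) = \<Union>((\<lambda>i. C i - U) ` K) \<union> U" unfolding U_def by auto
        also have "card \<dots> \<le> card (\<Union>((\<lambda>i. C i - U) ` K)) + card U" by (rule card_Un_le)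
        finally have "card (K \<union> J) \<le> card (\<Union>((\<lambda>i. C i - U) ` K)) + card J"
          using J(3) unfolding U_def[symmetric] by linarith
        moreover have "card (K \<union> J) = card K + card J"
          using K finK finJ by (intro card_Un_disjoint) auto
        ultimately show "card K \<le> card (\<Union>i\<in>K. C i - U)" by linarith
      qed
      then obtain g where g: "inj_on g (I - J)" "\<forall>i\<in>I - J. g i \<in> C i - U" by blast
      define f where "f i = (if i \<in> J then h i else g i)" for i
      have hU: "h i \<in> U" if "i \<in> J" for i using h(2) that unfolding U_def by blast
      have "inj_on f I"
      proof (rule inj_onI)
        fix x y assume xy: "x \<in> I" "y \<in> I" "f x = f y"
        show "x = y"
        proof (cases "x \<in> J"; cases "y \<in> J")
          assume "x \<in> J" "y \<in> J"
          thus ?thesis using xy h(1) unfolding f_def by (simp add: inj_on_eq_iff)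
        next
          assume "x \<in> J" "y \<notin> J"
          thus ?thesis using xy hU[of x] g(2) unfolding f_def by auto
        next
          assume "x \<notin> J" "y \<in> J"
          thus ?thesis using xy hU[of y] g(2) unfolding f_def by force
        next
          assume "x \<notin> J" "y \<notin> J"
          thus ?thesis using xy g(1) unfolding f_def by (simp add: inj_on_eq_iff)
        qed
      qed
      moreover have "\<forall>i\<in>I. f i \<in> C i" using h(2) g(2) unfolding f_def by simp
      ultimately show ?thesis by blast
    next
      \<comment> \<open>Without a tight set every nonempty proper subset has a neighbour to spare,
        so one point \<open>x\<close> may be given to \<open>a\<close>.\<close>
      case noJ: False
      obtain a where a: "a \<in> I" using False by blast
      have "card {a} \<le> card (\<Union>(C ` {a}))" by (rule less.prems(3)) (use a in blast)
      hence "C a \<noteq> {}" by auto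
      then obtain x where x: "x \<in> C a" by blast
      have "\<exists>h. inj_on h (I - {a}) \<and> (\<forall>i\<in>I - {a}. h i \<in> C i - {x})"
      proof (rule less.hyps)
        show "card (I - {a}) < card I" using a less.prems(1) by (intro psubset_card_mono) auto
        show "finite (I - {a})" using less.prems(1) by simp
        show "finite (C i - {x})" if "i \<in> I - {a}" for i using less.prems(2) that by simp
        fix J assume J: "J \<subseteq> I - {a}"
        show "card J \<le> card (\<Union>i\<in>J. C i - {x})"
        proof (cases "J = {}")
          case False
          have "J \<subset> I" using J a by blast
          hence "card J < card (\<Union>(C ` J))" using noJ False by (meson not_less)
          moreover have "(\<Union>i\<in>J. C i - {x}) = \<Union>(C ` J) - {x}" by auto
          ultimately show ?thesis by (auto simp: card_Diff_singleton_if)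
        qed simp
      qed
      then obtain h where h: "inj_on h (I - {a})" "\<forall>i\<in>I - {a}. h i \<in> C i - {x}" by blast
      have "inj_on (h(a := x)) (insert a (I - {a}))"
        using h by (subst inj_on_insert) (auto simp: inj_on_def)
      hence "inj_on (h(a := x)) I" using a by (simp add: insert_absorb)
      moreover have "\<forall>i\<in>I. (h(a := x)) i \<in> C i" using h(2) x by simp
      ultimately show ?thesis by blast
    qed
  qed
qed

text \<open>The bound on \<open>\<kappa> j\<close> ensures that a vertex of high degree, which comes early, gets an early colour.\<close>

lemma capped_colouring:
  fixes conf :: "nat \<Rightarrow> nat \<Rightarrow> bool"
  assumes "c > 0" "\<And>j. j < r \<Longrightarrow> card {i. i < j \<and> conf i j} \<le> D"
  shows "\<exists>\<kappa>. (\<forall>j<r. \<kappa> j \<le> D + j div c) \<and> (\<forall>j<r. \<forall>i<j. conf i j \<longrightarrow> \<kappa> i \<noteq> \<kappa> j) \<and>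
    (\<forall>k. card {j. j < r \<and> \<kappa> j = k} \<le> c)"
  using assms
proof (induction r)
  case (Suc r)
  then obtain \<kappa> where \<kappa>: "\<forall>j<r. \<kappa> j \<le> D + j div c"
      "\<forall>j<r. \<forall>i<j. conf i j \<longrightarrow> \<kappa> i \<noteq> \<kappa> j" "\<forall>k. card {j. j < r \<and> \<kappa> j = k} \<le> c"
    using less_Suc_eq by auto
  \<comment> \<open>A full colour accounts for \<open>c\<close> earlier vertices, so there are at
    most \<open>r div c\<close> of them.\<close>
  define Full where "Full = {k \<in> \<kappa> ` {..<r}. card {j. j < r \<and> \<kappa> j = k} = c}"
  define Bad where "Bad = \<kappa> ` {i. i < r \<and> conf i r} \<union> Full"
  have fin: "finite Full" unfolding Full_def by simp
  have "c * card Full = (\<Sum>k\<in>Full. card {j. j < r \<and> \<kappa> j = k})"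
    unfolding Full_def by simp
  also have "\<dots> = card (\<Union>k\<in>Full. {j. j < r \<and> \<kappa> j = k})"
    using fin by (intro card_UN_disjoint[symmetric]) auto
  also have "\<dots> \<le> card {..<r}" by (intro card_mono) auto
  finally have "card Full \<le> r div c"
    using Suc.prems(1) by (simp add: less_eq_div_iff_mult_less_eq mult.commute)
  moreover have "card (\<kappa> ` {i. i < r \<and> conf i r}) \<le> D"
    using card_image_le[of "{i. i < r \<and> conf i r}" \<kappa>] Suc.prems(2)[of r] by simp
  ultimately have "card Bad \<le> D + r div c"
    unfolding Bad_def using card_Un_le[of "\<kappa> ` {i. i < r \<and> conf i r}" Full] by linarith
  \<comment> \<open>The palette from 0 to \<open>D + r div c\<close> has one colour more than there
    can be bad ones.\<close>
  hence "\<not> {..D + r div c} \<subseteq> Bad"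
    using card_mono[of Bad "{..D + r div c}"] fin unfolding Bad_def by fastforce
  then obtain k where k: "k \<le> D + r div c" "k \<notin> Bad" by blast
  define \<kappa>' where "\<kappa>' = \<kappa>(r := k)"
  have "\<kappa>' j \<le> D + j div c" if "j < Suc r" for j
    using that k(1) \<kappa>(1) unfolding \<kappa>'_def by (auto simp: less_Suc_eq)
  moreover have "\<kappa>' i \<noteq> \<kappa>' j" if "j < Suc r" "i < j" "conf i j" for i j
  proof (cases "j = r")
    case True
    then show ?thesis using that k(2) unfolding \<kappa>'_def Bad_def by auto
  next
    case False
    then show ?thesis using that \<kappa>(2) unfolding \<kappa>'_def by auto
  qed
  moreover have "card {j. j < Suc r \<and> \<kappa>' j = l} \<le> c" for l
  proof (cases "l = k")
    case True
    have eq: "{j. j < Suc r \<and> \<kappa>' j = l} = insert r {j. j < r \<and> \<kappa> j = k}"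
      unfolding \<kappa>'_def using True by auto
    have "card {j. j < r \<and> \<kappa> j = k} \<noteq> c"
    proof
      assume *: "card {j. j < r \<and> \<kappa> j = k} = c"
      hence "{j. j < r \<and> \<kappa> j = k} \<noteq> {}" using Suc.prems(1) by force
      hence "k \<in> Full" unfolding Full_def using * by auto
      thus False using k(2) unfolding Bad_def by simp
    qed
    with \<kappa>(3) have "card {j. j < r \<and> \<kappa> j = k} < c" using le_neq_implies_less by blast
    then show ?thesis unfolding eq by simp
  next
    case False
    hence "{j. j < Suc r \<and> \<kappa>' j = l} = {j. j < r \<and> \<kappa> j = l}"
      unfolding \<kappa>'_def by (auto simp: less_Suc_eq)
    then show ?thesis using \<kappa>(3) by simp
  qed
  ultimately show ?case by blast
qed simp

section \<open>Degrees and sparse subsets\<close>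

abbreviation pairs :: "'a set \<Rightarrow> 'a set set" where
  "pairs V \<equiv> {d. d \<subseteq> V \<and> card d = 2}"

definition nbs :: "'a set set \<Rightarrow> 'a \<Rightarrow> 'a set" where
  "nbs E v = {u. {v, u} \<in> E}"

lemma finite_pairs: "finite V \<Longrightarrow> finite (pairs V)"
  by (rule finite_subset[of _ "Pow V"]) auto

lemma nbs_subset: "E \<subseteq> pairs V \<Longrightarrow> nbs E v \<subseteq> V - {v}"
  unfolding nbs_def by fastforce

lemma nbs_sym: "u \<in> nbs E v \<longleftrightarrow> v \<in> nbs E u"
  unfolding nbs_def by (simp add: insert_commute)

lemma card_nbs:
  assumes "E \<subseteq> pairs V"
  shows "card (nbs E v) = card {d \<in> E. v \<in> d}"
proof (rule bij_betw_same_card[of "\<lambda>u. {v, u}"])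
  have "d \<in> (\<lambda>u. {v, u}) ` nbs E v" if "d \<in> E" "v \<in> d" for d
  proof -
    have "card d = 2" using that assms by auto
    then obtain x y where "d = {x, y}" by (meson card_2_iff)
    then show ?thesis using that unfolding nbs_def by (auto simp: insert_commute)
  qed
  thus "bij_betw (\<lambda>u. {v, u}) (nbs E v) {d \<in> E. v \<in> d}"
    unfolding bij_betw_def by (auto simp: inj_on_def nbs_def doubleton_eq_iff)
qed

lemma sum_card_nbs:
  assumes "finite V" "E \<subseteq> pairs V"
  shows "(\<Sum>v\<in>V. card (nbs E v)) = 2 * card E"
proof -
  have finE: "finite E" using assms finite_pairs finite_subset by blast
  have "(\<Sum>v\<in>V. card (nbs E v)) = (\<Sum>v\<in>V. \<Sum>d\<in>E. if v \<in> d then 1 else 0)"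
    using finE card_nbs[OF assms(2)] by (simp add: sum.If_cases Int_def)
  also have "\<dots> = (\<Sum>d\<in>E. \<Sum>v\<in>V. if v \<in> d then 1 else 0)" by (rule sum.swap)
  also have "\<dots> = (\<Sum>d\<in>E. 2)"
  proof (rule sum.cong)
    fix d assume "d \<in> E"
    hence "d \<subseteq> V" "card d = 2" using assms(2) by auto
    thus "(\<Sum>v\<in>V. if v \<in> d then 1 else 0) = (2::nat)"
      using assms(1) by (simp add: sum.If_cases Int_absorb1 Int_commute)
  qed simp
  finally show ?thesis by simp
qed

text \<open>The value at position \<open>j\<close> is at most the average of the first
  \<open>j + 1\<close> values. With degrees for \<open>f\<close> this bounds the degree at position
  \<open>j\<close> by 2m/(j+1), written without division.\<close>

lemma decreasing_enumeration:
  fixes f :: "'a \<Rightarrow> nat"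
  assumes "finite R"
  shows "\<exists>e. bij_betw e {..<card R} R \<and> (\<forall>j<card R. f (e j) * (j + 1) \<le> sum f R)"
proof -
  have "\<exists>e. bij_betw e {..<card R} R \<and> (\<forall>j<card R. \<forall>i\<le>j. f (e j) \<le> f (e i))"
    using assms
  proof (induction "card R" arbitrary: R)
    case (Suc n)
    hence ne: "R \<noteq> {}" by auto
    obtain x where x: "x \<in> R" "\<And>y. y \<in> R \<Longrightarrow> f x \<le> f y"
      using arg_min_if_finite[OF Suc.prems ne, of f] by (metis not_less)
    have cR: "card (R - {x}) = n" using Suc x(1) by simp
    then obtain e where e: "bij_betw e {..<n} (R - {x})" "\<forall>j<n. \<forall>i\<le>j. f (e j) \<le> f (e i)"
      using Suc.hyps(1)[of "R - {x}"] Suc.prems by auto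
    have mem: "e i \<in> R" if "i < n" for i using e(1) that by (auto simp: bij_betw_def)
    have "bij_betw (e(n := x)) {..<Suc n} R"
    proof -
      have "bij_betw (e(n := x)) {..<n} (R - {x})"
        using e(1) by (subst bij_betw_cong[where g = e]) auto
      moreover have "bij_betw (e(n := x)) {n} {x}" by simp
      ultimately have "bij_betw (e(n := x)) ({..<n} \<union> {n}) ((R - {x}) \<union> {x})"
        by (intro bij_betw_combine) auto
      thus ?thesis using x(1) by (simp add: insert_absorb lessThan_Suc)
    qed
    moreover have "\<forall>j<Suc n. \<forall>i\<le>j. f ((e(n := x)) j) \<le> f ((e(n := x)) i)"
      using e(2) x mem by (auto simp: less_Suc_eq)
    ultimately show ?case using Suc.hyps(2) by metis
  qed (simp add: bij_betw_def)
  then obtain e where e: "bij_betw e {..<card R} R" "\<forall>j<card R. \<forall>i\<le>j. f (e j) \<le> f (e i)" by blast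
  have "f (e j) * (j + 1) \<le> sum f R" if "j < card R" for j
  proof -
    have "f (e j) * (j + 1) = (\<Sum>i\<le>j. f (e j))" by simp
    also have "\<dots> \<le> (\<Sum>i\<le>j. f (e i))" using e(2) that by (intro sum_mono) auto
    also have "\<dots> \<le> (\<Sum>i<card R. f (e i))" using that by (intro sum_mono2) auto
    also have "\<dots> = sum f R" using e(1) by (rule sum.reindex_bij_betw)
    finally show ?thesis .
  qed
  with e(1) show ?thesis by blast
qed

text \<open>Greedy choice: a chosen vertex rules out itself and at most \<open>l\<close> neighbours,
  so \<open>i\<close> chosen vertices rule out at most \<open>i * (l + 1)\<close> elements of
  \<open>X\<close>.\<close>

lemma independent_set:
  assumes "finite X" "E \<subseteq> pairs V" "finite V" "\<And>v. v \<in> X \<Longrightarrow> card (nbs E v) \<le> l" "i * (l + 1) \<le> card X"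
  shows "\<exists>I\<subseteq>X. card I = i \<and> (\<forall>u\<in>I. \<forall>v\<in>I. {u, v} \<notin> E)"
  using assms(5)
proof (induction i)
  case (Suc i)
  then obtain I where I: "I \<subseteq> X" "card I = i" "\<forall>u\<in>I. \<forall>v\<in>I. {u, v} \<notin> E" by auto
  have finI: "finite I" using I(1) assms(1) finite_subset by blast
  have "card (\<Union>v\<in>I. nbs E v) \<le> (\<Sum>v\<in>I. card (nbs E v))" using finI by (rule card_UN_le)
  also have "\<dots> \<le> (\<Sum>v\<in>I. l)" using assms(4) I(1) by (intro sum_mono) auto
  finally have "card (\<Union>v\<in>I. nbs E v) \<le> i * l" using I(2) by simp
  moreover have "card (I \<union> (\<Union>v\<in>I. nbs E v)) \<le> card I + card (\<Union>v\<in>I. nbs E v)" by (rule card_Un_le)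
  ultimately have "card (I \<union> (\<Union>v\<in>I. nbs E v)) < card X" using Suc.prems I(2) by simp
  moreover have "finite (I \<union> (\<Union>v\<in>I. nbs E v))"
    using finI nbs_subset[OF assms(2)] assms(3) by (auto intro: finite_subset)
  ultimately have "\<not> X \<subseteq> I \<union> (\<Union>v\<in>I. nbs E v)" using card_mono by (meson not_less)
  then obtain x where x: "x \<in> X" "x \<notin> I" "x \<notin> (\<Union>v\<in>I. nbs E v)" by blast
  have "{x, x} \<notin> E" using assms(2) by auto
  hence "\<forall>u\<in>insert x I. \<forall>v\<in>insert x I. {u, v} \<notin> E"
    using x(3) I(3) unfolding nbs_def by (auto simp: insert_commute)
  moreover have "card (insert x I) = Suc i" using x(2) finI I(2) by simp
  ultimately show ?case using x(1) I(1) by (intro exI[of _ "insert x I"]) auto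
qed auto

text \<open>Averaging over \<open>k\<close>-subsets, made deterministic: deleting a vertex of at
  least average degree does not raise the edge density, and this is repeated until \<open>k\<close>
  vertices remain. Densities are cross-multiplied to stay in the natural numbers.\<close>

lemma sparse_subset:
  assumes "finite V" "E \<subseteq> pairs V" "k \<le> card V"
  shows "\<exists>S\<subseteq>V. card S = k \<and>
    card (E \<inter> Pow S) * (card V * (card V - 1)) \<le> card E * (k * (k - 1))"
  using assms
proof (induction "card V" arbitrary: V E)
  case 0
  then show ?case by (intro exI[of _ "{}"]) auto
next
  case (Suc n)
  show ?case
  proof (cases "k = card V")
    case True
    have "card (E \<inter> Pow V) \<le> card E"
      using Suc.prems finite_subset[OF Suc.prems(2)] finite_pairs by (intro card_mono) auto
    with True show ?thesis by (intro exI[of _ V]) auto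
  next
    case False
    hence kn: "k \<le> n" using Suc by simp
    have finE: "finite E" using Suc.prems finite_pairs finite_subset by blast
    show ?thesis
    proof (cases "n \<ge> 2")
      case True
      have "\<exists>v\<in>V. 2 * card E \<le> card (nbs E v) * card V"
      proof (rule ccontr)
        assume "\<not> ?thesis"
        hence *: "\<And>v. v \<in> V \<Longrightarrow> card (nbs E v) * card V < 2 * card E" by force
        have "V \<noteq> {}" using Suc.hyps(2) by auto
        hence "(\<Sum>v\<in>V. card (nbs E v) * card V) < (\<Sum>v\<in>V. 2 * card E)"
          using * Suc.prems(1) by (intro sum_strict_mono) auto
        thus False using sum_card_nbs[OF Suc.prems(1,2)]
          by (simp add: sum_distrib_left[symmetric] mult.commute)
      qed
      then obtain v where v: "v \<in> V" "2 * card E \<le> card (nbs E v) * card V" by blast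
      define E' where "E' = E \<inter> Pow (V - {v})"
      have "E = E' \<union> {d \<in> E. v \<in> d}" unfolding E'_def using Suc.prems(2) by auto
      moreover have "card (E' \<union> {d \<in> E. v \<in> d}) = card E' + card {d \<in> E. v \<in> d}"
        using finE unfolding E'_def by (intro card_Un_disjoint) auto
      ultimately have cE: "card E = card E' + card (nbs E v)" using card_nbs[OF Suc.prems(2)] by simp
      have "n = card (V - {v})" using Suc v(1) by simp
      moreover have "E' \<subseteq> pairs (V - {v})" unfolding E'_def using Suc.prems(2) by auto
      ultimately obtain S where S: "S \<subseteq> V - {v}" "card S = k"
          "card (E' \<inter> Pow S) * (n * (n - 1)) \<le> card E' * (k * (k - 1))"
        using Suc.hyps(1)[of "V - {v}" E'] Suc.prems(1) kn by auto
      have eq: "E' \<inter> Pow S = E \<inter> Pow S" unfolding E'_def using S(1) by auto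
      \<comment> \<open>As \<open>card V = n + 1\<close>, the deleted degree is at least the
        fraction 2/(n+1) of all edges, which leaves at most (n-1)/(n+1).\<close>
      have "card E' * (n + 1) \<le> card E * (n - 1)"
      proof -
        have "card E' * (n + 1) + 2 * card E \<le> card E' * (n + 1) + card (nbs E v) * (n + 1)"
          using v(2) Suc.hyps(2) by simp
        also have "\<dots> = card E * (n + 1)" using cE by (simp add: algebra_simps)
        also have "\<dots> = card E * (n - 1) + 2 * card E" using True by (simp add: algebra_simps diff_mult_distrib2)
        finally show ?thesis by simp
      qed
      hence "card E' * (n + 1) * (k * (k - 1)) \<le> card E * (n - 1) * (k * (k - 1))" by (rule mult_right_mono) simp
      moreover have "card (E \<inter> Pow S) * (n * (n - 1)) * (n + 1) \<le> card E' * (k * (k - 1)) * (n + 1)"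
        using S(3) unfolding eq by (rule mult_right_mono) simp
      ultimately have "(n - 1) * (card (E \<inter> Pow S) * ((n + 1) * n)) \<le> (n - 1) * (card E * (k * (k - 1)))"
        by (simp only: ac_simps)
      hence "card (E \<inter> Pow S) * ((n + 1) * n) \<le> card E * (k * (k - 1))" using True by simp
      moreover have "card V * (card V - 1) = (n + 1) * n" using Suc.hyps(2)[symmetric] by simp
      ultimately have "card (E \<inter> Pow S) * (card V * (card V - 1)) \<le> card E * (k * (k - 1))" by (simp only:)
      moreover have "S \<subseteq> V" using S(1) by blast
      ultimately show ?thesis using S(2) by blast
    next
      \<comment> \<open>Here the factor \<open>n - 1\<close> is 0 and cannot be cancelled, but a set
        of at most one vertex spans no edge.\<close>
      case False
      hence "k \<le> 1" using kn by simp
      obtain S where S: "S \<subseteq> V" "card S = k" using Suc.prems(3) by (meson obtain_subset_with_card_n)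
      have "E \<inter> Pow S = {}"
      proof (rule equals0I)
        fix d assume d: "d \<in> E \<inter> Pow S"
        have "card d \<le> card S" using d finite_subset[OF S(1) Suc.prems(1)] by (intro card_mono) auto
        moreover have "card d = 2" using d Suc.prems(2) by blast
        ultimately show False using S(2) \<open>k \<le> 1\<close> by simp
      qed
      hence "card (E \<inter> Pow S) = 0" by simp
      with S show ?thesis by (metis le0 mult_0)
    qed
  qed
qed

section \<open>Random bipartite graphs\<close>

lemma card_nonzero_functions:
  assumes "finite Y" "g > 0"
  shows "card {f \<in> Y \<rightarrow>\<^sub>E {..<g}. \<exists>y\<in>Y. f y \<noteq> (0::nat)} = g ^ card Y - 1"
proof -
  have "{f \<in> Y \<rightarrow>\<^sub>E {..<g}. \<exists>y\<in>Y. f y \<noteq> 0} = (Y \<rightarrow>\<^sub>E {..<g}) - {\<lambda>y\<in>Y. 0}" (is "?L = ?R")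
  proof
    show "?R \<subseteq> ?L"
    proof
      fix f assume f: "f \<in> ?R"
      have "\<exists>y\<in>Y. f y \<noteq> 0"
      proof (rule ccontr)
        assume "\<not> ?thesis"
        hence "f = (\<lambda>y\<in>Y. 0)" using f by (auto simp: fun_eq_iff PiE_def extensional_def)
        thus False using f by simp
      qed
      thus "f \<in> ?L" using f by simp
    qed
  qed auto
  moreover have "(\<lambda>y\<in>Y. 0) \<in> Y \<rightarrow>\<^sub>E {..<g}" using assms(2) by auto
  ultimately show ?thesis using assms(1) by (simp add: card_PiE finite_PiE)
qed

text \<open>A uniformly random \<open>f\<close> vanishes on all of \<open>N j\<close> with
  probability at least \<open>1 / g ^ \<Delta>\<close>, and the events for different
  \<open>j\<close> are independent because the sets \<open>N j\<close> are disjoint. The bound is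
  the product of the failure probabilities times the number of functions.\<close>

lemma card_avoiding_functions:
  assumes "finite J" "finite Y" "g > 0" "disjoint_family_on N J"
    and "\<And>j. j \<in> J \<Longrightarrow> N j \<subseteq> Y \<and> card (N j) \<le> \<Delta>"
  shows "real (card {f \<in> Y \<rightarrow>\<^sub>E {..<g}. \<forall>j\<in>J. \<exists>y\<in>N j. f y \<noteq> (0::nat)})
    \<le> real g ^ card Y * (1 - 1 / real g ^ \<Delta>) ^ card J"
  using assms
proof (induction J arbitrary: Y rule: finite_induct)
  case empty
  thus ?case by (simp add: card_PiE)
next
  case (insert j J)
  define q where "q = 1 - 1 / real g ^ \<Delta>"
  define Y' where "Y' = Y - N j"
  have Nj: "N j \<subseteq> Y" "card (N j) \<le> \<Delta>" and disj: "disjoint_family_on N J"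
    and sub: "\<And>i. i \<in> J \<Longrightarrow> N i \<subseteq> Y' \<and> card (N i) \<le> \<Delta>"
    using insert.prems insert.hyps(2) unfolding Y'_def disjoint_family_on_def by auto
  have fin: "finite (N j)" "finite Y'"
    using Nj insert.prems(1) finite_subset unfolding Y'_def by auto
  have q0: "0 \<le> q" using insert.prems(2) unfolding q_def by simp
  let ?A = "{f \<in> Y \<rightarrow>\<^sub>E {..<g}. \<forall>i\<in>insert j J. \<exists>y\<in>N i. f y \<noteq> (0::nat)}"
  let ?B = "{f \<in> N j \<rightarrow>\<^sub>E {..<g}. \<exists>y\<in>N j. f y \<noteq> (0::nat)}"
  let ?C = "{f \<in> Y' \<rightarrow>\<^sub>E {..<g}. \<forall>i\<in>J. \<exists>y\<in>N i. f y \<noteq> (0::nat)}"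
  \<comment> \<open>Independence in counting form: \<open>f\<close> is determined by its
    restrictions to \<open>N j\<close> and to the rest of \<open>Y\<close>.\<close>
  have "inj_on (\<lambda>f. (restrict f (N j), restrict f Y')) ?A"
  proof (rule inj_onI)
    fix f f' assume f: "f \<in> ?A" "f' \<in> ?A"
      and eq: "(restrict f (N j), restrict f Y') = (restrict f' (N j), restrict f' Y')"
    show "f = f'"
    proof
      fix y
      show "f y = f' y"
      proof (cases "y \<in> Y")
        case True
        hence "y \<in> N j \<or> y \<in> Y'" unfolding Y'_def by simp
        thus ?thesis using eq by (metis prod.inject restrict_apply')
      next
        case False
        thus ?thesis using f by (simp add: PiE_def extensional_def)
      qed
    qed
  qed
  moreover have "(\<lambda>f. (restrict f (N j), restrict f Y')) ` ?A \<subseteq> ?B \<times> ?C"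
  proof -
    have "(restrict f (N j), restrict f Y') \<in> ?B \<times> ?C" if f: "f \<in> ?A" for f
    proof -
      have "\<exists>y\<in>N i. restrict f Y' y \<noteq> 0" if "i \<in> J" for i
        using f that sub[OF that] by auto (metis subsetD)
      moreover have "f y < g" if "y \<in> Y" for y using f that by (auto simp: PiE_def Pi_def)
      ultimately show ?thesis using f Nj(1) unfolding Y'_def by auto
    qed
    thus ?thesis by blast
  qed
  moreover have "finite (?B \<times> ?C)"
  proof -
    have "finite (N j \<rightarrow>\<^sub>E {..<g})" "finite (Y' \<rightarrow>\<^sub>E {..<g})"
      by (rule finite_PiE; use fin in simp)+
    thus ?thesis by simp
  qed
  ultimately have "card ?A \<le> card (?B \<times> ?C)" by (rule card_inj_on_le)
  also have "\<dots> = (g ^ card (N j) - 1) * card ?C"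
    using card_nonzero_functions[OF fin(1) insert.prems(2)] by (simp add: card_cartesian_product)
  finally have "real (card ?A) \<le> real ((g ^ card (N j) - 1) * card ?C)" by (rule of_nat_mono)
  hence "real (card ?A) \<le> real (g ^ card (N j) - 1) * real (card ?C)" by (simp only: of_nat_mult)
  also have "real (g ^ card (N j) - 1) * real (card ?C)
      \<le> (real g ^ card (N j) * q) * (real g ^ card Y' * q ^ card J)"
  proof (rule mult_mono)
    have "real g ^ card (N j) \<le> real g ^ \<Delta>" using insert.prems(2) Nj(2) by (intro power_increasing) auto
    hence "real g ^ card (N j) / real g ^ \<Delta> \<le> 1" using insert.prems(2) by (simp add: divide_le_eq)
    thus "real (g ^ card (N j) - 1) \<le> real g ^ card (N j) * q"
      unfolding q_def using insert.prems(2) by (simp add: of_nat_diff algebra_simps)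
    show "real (card ?C) \<le> real g ^ card Y' * q ^ card J"
      unfolding q_def using insert.IH[OF fin(2) insert.prems(2) disj sub] .
  qed (use q0 in auto)
  also have "\<dots> = real g ^ (card (N j) + card Y') * q ^ card (insert j J)"
    using insert.hyps by (simp add: power_add)
  also have "card (N j) + card Y' = card Y"
    unfolding Y'_def using Nj(1) insert.prems(1) fin(1) by (simp add: card_Diff_subset card_mono)
  finally show ?case unfolding q_def .
qed

text \<open>Such a subset is spelled by \<open>\<Delta>\<close> letters taken from \<open>Y\<close>
  together with one blank; each further letter multiplies the count by at most
  \<open>card Y + 1\<close>.\<close>

lemma card_small_subsets:
  assumes "finite Y"
  shows "card {X. X \<subseteq> Y \<and> card X \<le> \<Delta>} \<le> (card Y + 1) ^ \<Delta>"
proof (induction \<Delta>)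
  case 0
  have "{X. X \<subseteq> Y \<and> card X \<le> 0} = {{}}"
  proof -
    have "X = {}" if "X \<subseteq> Y" "card X = 0" for X
      using that finite_subset[OF that(1) assms] by simp
    thus ?thesis by auto
  qed
  thus ?case by simp
next
  case (Suc \<Delta>)
  let ?S = "\<lambda>k. {X. X \<subseteq> Y \<and> card X \<le> k}"
  have fin: "finite (?S k)" for k using assms by simp
  have "?S (Suc \<Delta>) \<subseteq> ?S \<Delta> \<union> (\<lambda>(y, X). insert y X) ` (Y \<times> ?S \<Delta>)"
  proof
    fix X assume X: "X \<in> ?S (Suc \<Delta>)"
    show "X \<in> ?S \<Delta> \<union> (\<lambda>(y, X). insert y X) ` (Y \<times> ?S \<Delta>)"
    proof (cases "card X \<le> \<Delta>")
      case False
      hence "X \<noteq> {}" by auto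
      then obtain y where y: "y \<in> X" by blast
      hence "X = insert y (X - {y})" "X - {y} \<subseteq> Y" "card (X - {y}) \<le> \<Delta>"
        using X assms by auto
      thus ?thesis using X y by (intro UnI2 image_eqI[of _ _ "(y, X - {y})"]) auto
    qed (use X in auto)
  qed
  hence "card (?S (Suc \<Delta>)) \<le> card (?S \<Delta> \<union> (\<lambda>(y, X). insert y X) ` (Y \<times> ?S \<Delta>))"
    using fin assms by (intro card_mono) auto
  also have "\<dots> \<le> card (?S \<Delta>) + card ((\<lambda>(y, X). insert y X) ` (Y \<times> ?S \<Delta>))" by (rule card_Un_le)
  also have "\<dots> \<le> card (?S \<Delta>) + card (Y \<times> ?S \<Delta>)"
    using fin assms by (intro add_left_mono card_image_le) auto
  also have "\<dots> = (card Y + 1) * card (?S \<Delta>)" by (simp add: card_cartesian_product)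
  also have "\<dots> \<le> (card Y + 1) * (card Y + 1) ^ \<Delta>" by (intro mult_left_mono Suc) simp
  finally show ?case by simp
qed

text \<open>Hall's condition, for arbitrary families of at most \<open>c\<close> disjoint prescribed neighbourhoods.
  Disjointness is what makes a random graph satisfy it even if \<open>c\<close> is only slightly below \<open>card P\<close>.\<close>

definition expanding :: "('a \<times> 'b) set \<Rightarrow> 'a set \<Rightarrow> 'b set \<Rightarrow> nat \<Rightarrow> nat \<Rightarrow> bool" where
  "expanding A P Y \<Delta> c \<longleftrightarrow> (\<forall>a\<le>c. \<forall>N. disjoint_family_on N {..<a} \<longrightarrow>
     (\<forall>j<a. N j \<subseteq> Y \<and> card (N j) \<le> \<Delta>) \<longrightarrow> a \<le> card {w \<in> P. \<exists>j<a. N j \<subseteq> A `` {w}})"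

text \<open>Hall's theorem for the candidate sets \<open>C v\<close>: expansion, applied to the
  subfamily indexed by \<open>J\<close>, is the Hall condition for \<open>J\<close>. The enumeration
  \<open>e\<close> translates \<open>J\<close> into an initial segment, the index set that
  \<open>expanding\<close> speaks of.\<close>

lemma expanding_transversal:
  assumes "expanding A P Y \<Delta> c" "finite P" "finite I" "card I \<le> c"
    and "disjoint_family_on N I" "\<And>v. v \<in> I \<Longrightarrow> N v \<subseteq> Y \<and> card (N v) \<le> \<Delta>"
  shows "\<exists>h. inj_on h I \<and> (\<forall>v\<in>I. h v \<in> P \<and> N v \<subseteq> A `` {h v})"
proof -
  define C where "C v = {w \<in> P. N v \<subseteq> A `` {w}}" for v
  have "\<exists>h. inj_on h I \<and> (\<forall>v\<in>I. h v \<in> C v)"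
  proof (rule hall_marriage)
    fix J assume J: "J \<subseteq> I"
    hence finJ: "finite J" using assms(3) finite_subset by blast
    then obtain e where e: "bij_betw e {..<card J} J"
      by (metis ex_bij_betw_nat_finite lessThan_atLeast0)
    have eI: "e j \<in> I" if "j < card J" for j using e that J by (auto simp: bij_betw_def)
    have "card J \<le> c" using assms(3,4) J card_mono le_trans by blast
    moreover have "disjoint_family_on (N \<circ> e) {..<card J}"
      unfolding disjoint_family_on_def
    proof (intro ballI impI)
      fix i j assume ij: "i \<in> {..<card J}" "j \<in> {..<card J}" "i \<noteq> j"
      hence "e i \<noteq> e j" using e by (metis bij_betw_def inj_on_eq_iff)
      thus "(N \<circ> e) i \<inter> (N \<circ> e) j = {}"
        using assms(5) eI ij unfolding disjoint_family_on_def by simp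
    qed
    moreover have "\<forall>j<card J. (N \<circ> e) j \<subseteq> Y \<and> card ((N \<circ> e) j) \<le> \<Delta>" using assms(6) eI by simp
    ultimately have "card J \<le> card {w \<in> P. \<exists>j<card J. (N \<circ> e) j \<subseteq> A `` {w}}"
      using assms(1) unfolding expanding_def by blast
    also have "{w \<in> P. \<exists>j<card J. (N \<circ> e) j \<subseteq> A `` {w}} = \<Union>(C ` J)"
      using e unfolding C_def bij_betw_def by force
    finally show "card J \<le> card (\<Union>(C ` J))" .
  qed (use assms(2,3) in \<open>auto simp: C_def\<close>)
  thus ?thesis unfolding C_def by auto
qed

text \<open>A uniformly random \<open>f\<close> from pairs to \<open>{..<g}\<close> joins \<open>w\<close> to \<open>y\<close> when \<open>f w y = 0\<close>. A violation of
  the expansion property has a witness of \<open>a\<close> neighbourhoods and \<open>a\<close> points covering all candidates;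
  the union bound over witnesses is dominated by a geometric series of ratio 1/4.\<close>

lemma exists_expanding:
  fixes P :: "'a set" and Y :: "'b set"
  assumes finP: "finite P" and finY: "finite Y" and g: "g > 0"
    and slack: "c + \<sigma> \<le> card P"
    and q: "ln (4 * real (card P) * (real (card Y) + 1) ^ \<Delta>) \<le> real \<sigma> / real g ^ \<Delta>"
  shows "\<exists>A\<subseteq>P \<times> Y. card A * g \<le> 2 * (card P * card Y) \<and> expanding A P Y \<Delta> c"
proof (cases "c = 0")
  case True
  thus ?thesis by (intro exI[of _ "{}"]) (simp add: expanding_def)
next
  case c0: False
  define s where "s = card P"
  define y where "y = card Y"
  have s0: "s > 0" using slack c0 unfolding s_def by simp
  define F where "F = Y \<rightarrow>\<^sub>E {..<g}"
  define \<Omega> where "\<Omega> = P \<rightarrow>\<^sub>E F"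
  have finF: "finite F" unfolding F_def using finY by (intro finite_PiE) auto
  have fin\<Omega>: "finite \<Omega>" unfolding \<Omega>_def using finP finF by (intro finite_PiE) auto
  have cardF: "card F = g ^ y" unfolding F_def y_def using finY by (simp add: card_PiE)
  have card\<Omega>: "card \<Omega> = card F ^ s" unfolding \<Omega>_def s_def using finP by (simp add: card_PiE)
  have \<Omega>0: "card \<Omega> > 0" unfolding card\<Omega> cardF using g by simp
  define A where "A f = {(w, y) \<in> P \<times> Y. f w y = (0::nat)}" for f
  define Sub where "Sub = {X. X \<subseteq> Y \<and> card X \<le> \<Delta>}"
  have finSub: "finite Sub" unfolding Sub_def using finY by simp
  define Conf where "Conf a = ({..<a} \<rightarrow>\<^sub>E Sub) \<times> ({..<a} \<rightarrow>\<^sub>E P)" for a :: nat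
  have finConf: "finite (Conf a)" for a unfolding Conf_def using finSub finP
    by (intro finite_cartesian_product finite_PiE) auto
  \<comment> \<open>A witness \<open>x\<close> consists of \<open>a\<close> neighbourhoods and
    \<open>a\<close> points; \<open>f\<close> realises it when no point of \<open>P\<close> off the
    list suits any of the neighbourhoods. Families that are not disjoint are never realised, as
    expansion says nothing about them.\<close>
  define Bad where "Bad a x = (if disjoint_family_on (fst x) {..<a} then
      {f \<in> \<Omega>. \<forall>w\<in>P - snd x ` {..<a}. \<forall>j\<in>{..<a}. \<exists>y\<in>fst x j. f w y \<noteq> 0} else {})"
    for a and x :: "(nat \<Rightarrow> 'b set) \<times> (nat \<Rightarrow> 'a)"
  define q where "q = 1 / real g ^ \<Delta>"
  have q01: "0 \<le> 1 - q" "1 - q \<le> 1" using g unfolding q_def by auto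
  \<comment> \<open>Chosen so that \<open>(s * (y + 1) ^ \<Delta>) ^ a\<close>, which bounds the
    number of witnesses of length \<open>a\<close>, times \<open>\<beta> ^ a\<close> is
    \<open>(1 / 4) ^ a\<close>.\<close>
  define \<beta> where "\<beta> = 1 / (4 * real s * (real y + 1) ^ \<Delta>)"
  have \<beta>: "(1 - q) ^ \<sigma> \<le> \<beta>"
  proof -
    have "(1 - q) ^ \<sigma> \<le> exp (- q) ^ \<sigma>"
      using q01(1) exp_ge_add_one_self[of "- q"] by (intro power_mono) auto
    also have "\<dots> = exp (- (real \<sigma> / real g ^ \<Delta>))" unfolding q_def by (simp add: exp_of_nat_mult[symmetric])
    also have "\<dots> \<le> exp (- ln (4 * real s * (real y + 1) ^ \<Delta>))"
      using q unfolding s_def y_def by simp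
    also have "\<dots> = \<beta>" unfolding \<beta>_def using s0 by (simp add: exp_minus inverse_eq_divide)
    finally show ?thesis .
  qed
  have cardBad: "real (card (Bad a x)) \<le> real (card \<Omega>) * \<beta> ^ a"
    if a: "a \<le> c" and x: "x \<in> Conf a" for a x
  proof (cases "disjoint_family_on (fst x) {..<a}")
    case True
    \<comment> \<open>Each point of \<open>W\<close> independently suits none of the neighbourhoods
      with probability at most \<open>(1 - q) ^ a\<close>. Since \<open>a \<le> c\<close>, at least
      \<open>\<sigma>\<close> points remain in \<open>W\<close>.\<close>
    define W where "W = P - snd x ` {..<a}"
    define Av where "Av = {f \<in> F. \<forall>j\<in>{..<a}. \<exists>y\<in>fst x j. f y \<noteq> 0}"
    have "real (card Av) \<le> real g ^ card Y * (1 - 1 / real g ^ \<Delta>) ^ card {..<a}"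
      unfolding Av_def F_def
    proof (rule card_avoiding_functions[OF _ finY g True])
      fix j assume j: "j \<in> {..<a}"
      have "fst x \<in> {..<a} \<rightarrow>\<^sub>E Sub" using x unfolding Conf_def by auto
      from PiE_mem[OF this j] show "fst x j \<subseteq> Y \<and> card (fst x j) \<le> \<Delta>" unfolding Sub_def by simp
    qed simp
    hence Av: "real (card Av) \<le> real (card F) * (1 - q) ^ a" unfolding cardF y_def q_def by simp
    have finW: "finite W" "W \<subseteq> P" unfolding W_def using finP by auto
    have "Bad a x \<subseteq> (\<Pi>\<^sub>E w\<in>P. if w \<in> W then Av else F)"
    proof
      fix f assume f: "f \<in> Bad a x"
      hence f\<Omega>: "f \<in> \<Omega>" and fW: "\<And>w j. w \<in> W \<Longrightarrow> j < a \<Longrightarrow> \<exists>y\<in>fst x j. f w y \<noteq> 0"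
        unfolding Bad_def W_def using True by auto
      show "f \<in> (\<Pi>\<^sub>E w\<in>P. if w \<in> W then Av else F)"
      proof (rule PiE_I)
        fix w assume "w \<in> P"
        thus "f w \<in> (if w \<in> W then Av else F)"
          using f\<Omega> fW[of w] unfolding Av_def \<Omega>_def by auto
      qed (use f\<Omega> in \<open>auto simp: \<Omega>_def PiE_def extensional_def\<close>)
    qed
    moreover have "finite (\<Pi>\<^sub>E w\<in>P. if w \<in> W then Av else F)"
      using finP finF unfolding Av_def by (intro finite_PiE) auto
    ultimately have "card (Bad a x) \<le> card (\<Pi>\<^sub>E w\<in>P. if w \<in> W then Av else F)" by (intro card_mono)
    also have "\<dots> = (\<Prod>w\<in>P. if w \<in> W then card Av else card F)"
      using finP by (simp add: card_PiE if_distrib)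
    also have "\<dots> = card Av ^ card W * card F ^ card (P - W)"
      using finP finW by (simp add: prod.If_cases Int_absorb1 Int_commute Diff_eq)
    finally have "real (card (Bad a x)) \<le> real (card Av) ^ card W * real (card F) ^ card (P - W)"
      by (metis of_nat_le_iff of_nat_mult of_nat_power)
    also have "\<dots> \<le> (real (card F) * (1 - q) ^ a) ^ card W * real (card F) ^ card (P - W)"
      using Av by (intro mult_right_mono power_mono) auto
    also have "\<dots> = real (card F) ^ (card W + card (P - W)) * ((1 - q) ^ a) ^ card W"
      by (simp add: power_add power_mult_distrib)
    also have "card W + card (P - W) = s"
      unfolding s_def using finP finW by (simp add: card_Diff_subset card_mono)
    also have "real (card F) ^ s = real (card \<Omega>)" unfolding card\<Omega> by simp
    also have "((1 - q) ^ a) ^ card W \<le> ((1 - q) ^ a) ^ \<sigma>"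
    proof (rule power_decreasing)
      have "card P - card (snd x ` {..<a}) \<le> card W" unfolding W_def by (rule diff_card_le_card_Diff) simp
      moreover have "card (snd x ` {..<a}) \<le> a" using card_image_le[of "{..<a}" "snd x"] by simp
      ultimately show "\<sigma> \<le> card W" using slack a by linarith
    qed (use q01 in \<open>auto intro: power_le_one\<close>)
    also have "((1 - q) ^ a) ^ \<sigma> = ((1 - q) ^ \<sigma>) ^ a" by (simp add: power_mult[symmetric] mult.commute)
    also have "\<dots> \<le> \<beta> ^ a" using \<beta> q01 by (intro power_mono) auto
    finally show ?thesis by (simp add: mult_left_mono)
  next
    case False
    thus ?thesis unfolding Bad_def \<beta>_def by simp
  qed
  define B where "B = (\<Union>a\<in>{1..c}. \<Union>x\<in>Conf a. Bad a x)"
  have "real (card B) \<le> (\<Sum>a\<in>{1..c}. \<Sum>x\<in>Conf a. real (card (Bad a x)))"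
  proof -
    have "card B \<le> (\<Sum>a\<in>{1..c}. card (\<Union>x\<in>Conf a. Bad a x))"
      unfolding B_def by (rule card_UN_le) simp
    also have "\<dots> \<le> (\<Sum>a\<in>{1..c}. \<Sum>x\<in>Conf a. card (Bad a x))"
      using finConf by (intro sum_mono card_UN_le)
    finally have "real (card B) \<le> real (\<Sum>a\<in>{1..c}. \<Sum>x\<in>Conf a. card (Bad a x))"
      by (rule of_nat_mono)
    thus ?thesis by simp
  qed
  also have "\<dots> \<le> (\<Sum>a\<in>{1..c}. real (card \<Omega>) * (1 / 4) ^ a)"
  proof (rule sum_mono)
    fix a assume "a \<in> {1..c}"
    hence "(\<Sum>x\<in>Conf a. real (card (Bad a x))) \<le> (\<Sum>x\<in>Conf a. real (card \<Omega>) * \<beta> ^ a)"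
      using cardBad by (intro sum_mono) auto
    also have "\<dots> = real (card \<Omega>) * (real (card (Conf a)) * \<beta> ^ a)" by simp
    also have "\<dots> \<le> real (card \<Omega>) * (1 / 4) ^ a"
    proof (rule mult_left_mono)
      have "card (Conf a) = (card Sub * s) ^ a"
        unfolding Conf_def s_def using finSub finP
        by (simp add: card_cartesian_product card_PiE power_mult_distrib)
      also have "\<dots> \<le> ((y + 1) ^ \<Delta> * s) ^ a"
        using card_small_subsets[OF finY] unfolding Sub_def y_def by (intro power_mono mult_right_mono) auto
      finally have "real (card (Conf a)) \<le> real (((y + 1) ^ \<Delta> * s) ^ a)" by (rule of_nat_mono)
      hence "real (card (Conf a)) \<le> ((real y + 1) ^ \<Delta> * real s) ^ a" by (simp add: add.commute)
      hence "real (card (Conf a)) * \<beta> ^ a \<le> ((real y + 1) ^ \<Delta> * real s) ^ a * \<beta> ^ a"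
        unfolding \<beta>_def by (intro mult_right_mono) auto
      also have "\<dots> = ((real y + 1) ^ \<Delta> * real s * \<beta>) ^ a" by (simp add: power_mult_distrib)
      also have "(real y + 1) ^ \<Delta> * real s * \<beta> = 1 / 4"
        unfolding \<beta>_def using s0 by (simp add: field_simps)
      finally show "real (card (Conf a)) * \<beta> ^ a \<le> (1 / 4) ^ a" .
    qed simp
    finally show "(\<Sum>x\<in>Conf a. real (card (Bad a x))) \<le> real (card \<Omega>) * (1 / 4) ^ a" .
  qed
  also have "\<dots> = real (card \<Omega>) * (\<Sum>a\<in>{1..c}. (1 / 4) ^ a)" by (simp add: sum_distrib_left)
  also have "\<dots> < real (card \<Omega>) * (1 / 2)"
  proof (rule mult_strict_left_mono)
    have "(\<Sum>a\<in>{1..c}. (1 / 4) ^ a) = (1 - (1 / 4) ^ c) / (3 :: real)"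
    proof (induction c)
      case (Suc c)
      have "(\<Sum>a\<in>{1..Suc c}. (1 / 4 :: real) ^ a) = (\<Sum>a\<in>{1..c}. (1 / 4) ^ a) + (1 / 4) ^ Suc c" by simp
      moreover have "(1 - x) / 3 + 1 / 4 * x = (1 - 1 / 4 * x) / 3" for x :: real by (simp add: field_simps)
      ultimately show ?case using Suc by (simp only: power_Suc)
    qed simp
    moreover have "(1 - x) / 3 < 1 / 2" if "x > 0" for x :: real using that by (simp add: field_simps)
    ultimately show "(\<Sum>a\<in>{1..c}. (1 / 4) ^ a) < (1 / 2 :: real)" by (simp only: zero_less_power zero_less_divide_1_iff zero_less_numeral)
  qed (use \<Omega>0 in simp)
  finally have cardB: "2 * card B < card \<Omega>" by linarith
  have "B \<subseteq> \<Omega>" unfolding B_def Bad_def by auto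
  \<comment> \<open>The average number of joined pairs is \<open>s * y / g\<close>, as each pair is
    joined in exactly one outcome out of \<open>g\<close>.\<close>
  have sumA: "(\<Sum>f\<in>\<Omega>. card (A f)) * g = s * y * card \<Omega>"
  proof -
    have one: "card {f \<in> \<Omega>. f w z = 0} * g = card \<Omega>" if wz: "w \<in> P" "z \<in> Y" for w z
    proof -
      have "{f \<in> \<Omega>. f w z = 0} = (\<Pi>\<^sub>E w'\<in>P. if w' = w then (\<Pi>\<^sub>E z'\<in>Y. if z' = z then {0} else {..<g}) else F)"
        (is "?L = ?R")
      proof
        show "?R \<subseteq> ?L"
        proof
          fix f assume f: "f \<in> ?R"
          have fw: "f w \<in> (\<Pi>\<^sub>E z'\<in>Y. if z' = z then {0} else {..<g})" using PiE_mem[OF f wz(1)] by simp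
          have "f \<in> P \<rightarrow>\<^sub>E F"
          proof (rule PiE_I)
            fix w' assume w': "w' \<in> P"
            show "f w' \<in> F"
            proof (cases "w' = w")
              case True
              have "(\<Pi>\<^sub>E z'\<in>Y. if z' = z then {0} else {..<g}) \<subseteq> F"
                unfolding F_def using g by (intro PiE_mono) simp
              thus ?thesis using fw True by blast
            qed (use PiE_mem[OF f w'] in simp)
          qed (use f in \<open>simp add: PiE_def extensional_def\<close>)
          moreover have "f w z = 0" using PiE_mem[OF fw wz(2)] by simp
          ultimately show "f \<in> ?L" unfolding \<Omega>_def by simp
        qed
        show "?L \<subseteq> ?R"
        proof
          fix f assume f: "f \<in> ?L"
          hence fP: "f \<in> P \<rightarrow>\<^sub>E F" and fz: "f w z = 0" unfolding \<Omega>_def by simp_all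
          have "f w \<in> (\<Pi>\<^sub>E z'\<in>Y. if z' = z then {0} else {..<g})"
            using PiE_mem[OF fP wz(1)] fz unfolding F_def by (auto simp: PiE_iff)
          thus "f \<in> ?R" using fP by (simp add: PiE_iff)
        qed
      qed
      hence "card {f \<in> \<Omega>. f w z = 0} = (\<Prod>w'\<in>P. if w' = w then card (\<Pi>\<^sub>E z'\<in>Y. if z' = z then {0::nat} else {..<g}) else card F)"
        using finP by (simp add: card_PiE if_distrib)
      also have "\<dots> = card (\<Pi>\<^sub>E z'\<in>Y. if z' = z then {0::nat} else {..<g}) * (\<Prod>w'\<in>P - {w}. card F)"
        using finP wz(1) by (subst prod.remove[of _ w]) auto
      also have "card (\<Pi>\<^sub>E z'\<in>Y. if z' = z then {0::nat} else {..<g}) = (\<Prod>z'\<in>Y. if z' = z then 1 else g)"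
        using finY by (simp add: card_PiE if_distrib cong: if_cong)
      also have "\<dots> = (\<Prod>z'\<in>Y - {z}. g)"
        using finY wz(2) by (subst prod.remove[of _ z]) auto
      finally have "card {f \<in> \<Omega>. f w z = 0} * g = (g ^ (y - 1) * g) * card F ^ (s - 1)"
        using finP finY wz unfolding s_def y_def by simp
      also have "g ^ (y - 1) * g = card F"
        using wz finY unfolding cardF y_def by (metis card_gt_0_iff empty_iff power_minus_mult)
      also have "card F * card F ^ (s - 1) = card \<Omega>" using s0 unfolding card\<Omega>
        by (metis power_minus_mult mult.commute)
      finally show ?thesis .
    qed
    have "card (A f) = (\<Sum>w\<in>P. \<Sum>z\<in>Y. if f w z = 0 then 1 else 0)" for f
    proof -
      have "card (A f) = (\<Sum>p\<in>P \<times> Y. if f (fst p) (snd p) = 0 then 1 else 0)"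
      proof -
        have "A f = {p \<in> P \<times> Y. f (fst p) (snd p) = 0}" unfolding A_def by auto
        thus ?thesis using finP finY by (simp add: sum.If_cases Int_def)
      qed
      also have "\<dots> = (\<Sum>w\<in>P. \<Sum>z\<in>Y. if f w z = 0 then 1 else 0)"
        by (simp add: sum.cartesian_product case_prod_beta)
      finally show ?thesis .
    qed
    hence "(\<Sum>f\<in>\<Omega>. card (A f)) = (\<Sum>f\<in>\<Omega>. \<Sum>w\<in>P. \<Sum>z\<in>Y. if f w z = 0 then 1 else 0)" by simp
    also have "\<dots> = (\<Sum>w\<in>P. \<Sum>z\<in>Y. \<Sum>f\<in>\<Omega>. if f w z = 0 then 1 else 0)"
      by (subst sum.swap) (intro sum.cong refl sum.swap)
    also have "\<dots> = (\<Sum>w\<in>P. \<Sum>z\<in>Y. card {f \<in> \<Omega>. f w z = 0})"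
      using fin\<Omega> by (simp add: sum.If_cases Int_def)
    finally have "(\<Sum>f\<in>\<Omega>. card (A f)) * g = (\<Sum>w\<in>P. \<Sum>z\<in>Y. card {f \<in> \<Omega>. f w z = 0} * g)"
      by (simp add: sum_distrib_right)
    also have "\<dots> = (\<Sum>w\<in>P. \<Sum>z\<in>Y. card \<Omega>)" using one by simp
    finally show ?thesis unfolding s_def y_def by simp
  qed
  \<comment> \<open>More than half of the outcomes lie outside \<open>B\<close>; if all of them had
    more than twice the average number of pairs, the total in \<open>sumA\<close> would be
    exceeded.\<close>
  have "\<exists>f\<in>\<Omega> - B. card (A f) * g \<le> 2 * (s * y)"
  proof (rule ccontr)
    assume "\<not> ?thesis"
    hence *: "\<And>f. f \<in> \<Omega> - B \<Longrightarrow> 2 * (s * y) + 1 \<le> card (A f) * g" by force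
    have cdiff: "card (\<Omega> - B) = card \<Omega> - card B"
      using \<open>B \<subseteq> \<Omega>\<close> fin\<Omega> by (meson card_Diff_subset finite_subset)
    have "card (\<Omega> - B) * (2 * (s * y) + 1) = (\<Sum>f\<in>\<Omega> - B. 2 * (s * y) + 1)" by simp
    also have "\<dots> \<le> (\<Sum>f\<in>\<Omega> - B. card (A f) * g)" using * by (intro sum_mono) auto
    also have "\<dots> \<le> (\<Sum>f\<in>\<Omega>. card (A f) * g)" using fin\<Omega> by (intro sum_mono2) auto
    also have "\<dots> = s * y * card \<Omega>" using sumA by (simp add: sum_distrib_right)
    finally have le: "card (\<Omega> - B) * (2 * (s * y) + 1) \<le> s * y * card \<Omega>" .
    have "card \<Omega> * (s * y) \<le> (2 * card (\<Omega> - B)) * (s * y)"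
      using cardB cdiff by (intro mult_right_mono) auto
    moreover have "card (\<Omega> - B) * (2 * (s * y) + 1) = 2 * card (\<Omega> - B) * (s * y) + card (\<Omega> - B)"
      by (simp add: algebra_simps)
    moreover have "s * y * card \<Omega> = card \<Omega> * (s * y)" by (rule mult.commute)
    ultimately have "card (\<Omega> - B) = 0" using le by linarith
    thus False using cdiff cardB by simp
  qed
  then obtain f where f: "f \<in> \<Omega>" "f \<notin> B" "card (A f) * g \<le> 2 * (s * y)" by blast
  have "expanding (A f) P Y \<Delta> c"
    unfolding expanding_def
  proof (intro allI impI, rule ccontr)
    fix a N
    assume a: "a \<le> c" and N: "disjoint_family_on N {..<a}" "\<forall>j<a. N j \<subseteq> Y \<and> card (N j) \<le> \<Delta>"
      and less: "\<not> a \<le> card {w \<in> P. \<exists>j<a. N j \<subseteq> A f `` {w}}" (is "\<not> a \<le> card ?S")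
    \<comment> \<open>Fewer than \<open>a\<close> points suit some neighbourhood; they are padded to
      exactly \<open>a\<close> points, the length that a witness requires.\<close>
    have "?S \<subseteq> P" "card ?S \<le> a" "a \<le> card P" using less slack a by auto
    then obtain S where S: "?S \<subseteq> S" "S \<subseteq> P" "card S = a"
      using exists_subset_between[of ?S a P] finP by auto
    have "finite S" using S(2) finP finite_subset by blast
    then obtain t where t: "bij_betw t {..<a} S"
      using S(3) by (metis ex_bij_betw_nat_finite lessThan_atLeast0)
    define x where "x = (restrict N {..<a}, restrict t {..<a})"
    have "t j \<in> P" if "j < a" for j using t S(2) that by (auto simp: bij_betw_def)
    hence x: "x \<in> Conf a" unfolding x_def Conf_def Sub_def using N(2) by auto
    have "disjoint_family_on (fst x) {..<a}" unfolding x_def using N(1) by (simp add: disjoint_family_on_def)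
    moreover have "snd x ` {..<a} = S" unfolding x_def using t by (auto simp: bij_betw_def)
    moreover have "\<exists>y\<in>N j. f w y \<noteq> 0" if "w \<in> P - S" "j < a" for w j
    proof -
      have "\<not> N j \<subseteq> A f `` {w}" using that S(1) by blast
      then obtain z where "z \<in> N j" "(w, z) \<notin> A f" by auto
      thus ?thesis using that N(2) unfolding A_def by blast
    qed
    ultimately have "f \<in> Bad a x" unfolding Bad_def using f(1) by (simp add: x_def)
    moreover have "1 \<le> a" using less by simp
    ultimately show False using f(2) x a unfolding B_def by auto
  qed
  moreover have "A f \<subseteq> P \<times> Y" unfolding A_def by auto
  ultimately show ?thesis using f(3) unfolding s_def y_def by blast
qed

section \<open>The host graph\<close>

definition part :: "nat \<Rightarrow> nat \<Rightarrow> nat \<Rightarrow> nat set" where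
  "part a s k = {a + k * s..<a + Suc k * s}"

text \<open>Spots below \<open>\<tau>\<close> are joined to everything, the next \<open>b\<close> spots form a clique, and \<open>A k\<close> joins
  the \<open>k\<close>-th part to the spots between \<open>\<tau>\<close> and that part.\<close>

definition host :: "nat \<Rightarrow> nat \<Rightarrow> nat \<Rightarrow> nat \<Rightarrow> (nat \<Rightarrow> (nat \<times> nat) set) \<Rightarrow> nat set set" where
  "host n \<tau> b K A = {{x, y} | x y. x < y \<and> y < n \<and> (x < \<tau> \<or> y < \<tau> + b \<or> (\<exists>k<K. (y, x) \<in> A k))}"

lemma host_subset: "host n \<tau> b K A \<subseteq> pairs {..<n}"
  unfolding host_def by (auto simp: card_insert_if)

lemma hostI:
  assumes "x \<noteq> y" "x < n" "y < n"
    and "x < \<tau> \<or> (x < \<tau> + b \<and> y < \<tau> + b)"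
  shows "{x, y} \<in> host n \<tau> b K A"
proof (cases "x < y")
  case True
  thus ?thesis using assms unfolding host_def by blast
next
  case False
  hence "{x, y} = {y, x}" "y < x" "y < \<tau> \<or> x < \<tau> + b" using assms by auto
  thus ?thesis using assms unfolding host_def by blast
qed

lemma card_host_le:
  assumes "\<And>k. k < K \<Longrightarrow> finite (A k)"
  shows "card (host n \<tau> b K A) \<le> \<tau> * n + b * b + (\<Sum>k<K. card (A k))"
proof -
  let ?S = "({..<\<tau>} \<times> {..<n}) \<union> ({\<tau>..<\<tau> + b} \<times> {\<tau>..<\<tau> + b}) \<union> (\<Union>k<K. A k)"
  have "host n \<tau> b K A \<subseteq> (\<lambda>(x, y). {x, y}) ` ?S"
  proof
    fix d assume "d \<in> host n \<tau> b K A"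
    then obtain x y where d: "d = {x, y}" "x < y" "y < n"
      "x < \<tau> \<or> y < \<tau> + b \<or> (\<exists>k<K. (y, x) \<in> A k)" unfolding host_def by blast
    have "(x, y) \<in> ?S \<or> (y, x) \<in> ?S" using d by auto
    moreover have "d = (\<lambda>(x, y). {x, y}) (x, y)" "d = (\<lambda>(x, y). {x, y}) (y, x)" using d(1) by auto
    ultimately show "d \<in> (\<lambda>(x, y). {x, y}) ` ?S" by (metis imageI)
  qed
  moreover have fin: "finite ?S" using assms by auto
  ultimately have "card (host n \<tau> b K A) \<le> card ?S"
    by (meson surj_card_le)
  also have "\<dots> \<le> card (({..<\<tau>} \<times> {..<n}) \<union> ({\<tau>..<\<tau> + b} \<times> {\<tau>..<\<tau> + b})) + card (\<Union>k<K. A k)"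
    by (rule card_Un_le)
  also have "\<dots> \<le> card ({..<\<tau>} \<times> {..<n}) + card ({\<tau>..<\<tau> + b} \<times> {\<tau>..<\<tau> + b}) + (\<Sum>k<K. card (A k))"
    by (intro add_mono card_Un_le card_UN_le) auto
  finally show ?thesis by (simp add: card_cartesian_product)
qed

section \<open>Embedding a sparse graph into the host\<close>

lemma staged_embedding:
  fixes e :: "nat \<Rightarrow> 'a" and \<tau> b s c r K n :: nat and A :: "nat \<Rightarrow> (nat \<times> nat) set"
  assumes E: "E \<subseteq> pairs V"
    and e: "inj_on e {..<b + r}"
    and colour: "\<And>j. j < r \<Longrightarrow> \<kappa> j < K"
    and capped: "\<And>k. card {j. j < r \<and> \<kappa> j = k} \<le> c"
    and proper: "\<And>i j. i < r \<Longrightarrow> j < r \<Longrightarrow> i \<noteq> j \<Longrightarrow> \<kappa> i = \<kappa> j \<Longrightarrow> {e (b + i), e (b + j)} \<notin> E \<and>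
      nbs E (e (b + i)) \<inter> nbs E (e (b + j)) \<inter> e ` {..<b + r} = {}"
    and deg: "\<And>j. j < r \<Longrightarrow> card (nbs E (e (b + j))) \<le> \<Delta> (\<kappa> j)"
    and finV: "finite V"
    and exp: "\<And>k. k < K \<Longrightarrow> A k \<subseteq> part (\<tau> + b) s k \<times> {\<tau>..<\<tau> + b + k * s} \<and>
      expanding (A k) (part (\<tau> + b) s k) {\<tau>..<\<tau> + b + k * s} (\<Delta> k) c"
    and fits: "\<tau> + b + K * s \<le> n"
  shows "\<exists>\<phi>. inj_on \<phi> (e ` {..<b + r}) \<and> \<phi> ` e ` {..<b + r} \<subseteq> {\<tau>..<n} \<and>
    (\<forall>x\<in>e ` {..<b + r}. \<forall>y\<in>e ` {..<b + r}. {x, y} \<in> E \<longrightarrow> {\<phi> x, \<phi> y} \<in> host n \<tau> b K A)"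
proof -
  define v where "v j = e (b + j)" for j
  \<comment> \<open>The vertices placed before stage \<open>k\<close>; the invariant in
    \<open>stage\<close> keeps their images below part \<open>k\<close>.\<close>
  define S where "S k = e ` {..<b} \<union> v ` {j. j < r \<and> \<kappa> j < k}" for k
  have v_inj: "v i = v j \<longleftrightarrow> i = j" if "i < r" "j < r" for i j
    unfolding v_def using inj_on_eq_iff[OF e] that by simp
  have v_notin: "v j \<notin> e ` {..<b}" if "j < r" for j
    unfolding v_def using inj_on_eq_iff[OF e] that by force
  have SR: "S k \<subseteq> e ` {..<b + r}" for k unfolding S_def v_def by auto
  have loop: "{x, x} \<notin> E" for x using E by auto
  have stage: "\<exists>\<phi>. inj_on \<phi> (S k) \<and> \<phi> ` S k \<subseteq> {\<tau>..<\<tau> + b + k * s} \<and>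
    (\<forall>x\<in>S k. \<forall>y\<in>S k. {x, y} \<in> E \<longrightarrow> {\<phi> x, \<phi> y} \<in> host n \<tau> b K A)" if "k \<le> K" for k
    using that
  proof (induction k)
    case 0
    have S0: "S 0 = e ` {..<b}" unfolding S_def by simp
    have eb: "inj_on e {..<b}" using e by (rule inj_on_subset) auto
    define \<phi> where "\<phi> x = \<tau> + inv_into {..<b} e x" for x
    have \<phi>e: "\<phi> (e i) = \<tau> + i" if "i < b" for i unfolding \<phi>_def using eb that by simp
    have "inj_on \<phi> (S 0)" unfolding S0 using \<phi>e by (auto simp: inj_on_def)
    moreover have "\<phi> ` S 0 \<subseteq> {\<tau>..<\<tau> + b + 0 * s}" unfolding S0 using \<phi>e by auto
    moreover have "{\<phi> x, \<phi> y} \<in> host n \<tau> b K A" if xy: "x \<in> S 0" "y \<in> S 0" "{x, y} \<in> E" for x y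
    proof -
      obtain i j where ij: "x = e i" "y = e j" "i < b" "j < b" using xy(1,2) unfolding S0 by blast
      have "x \<noteq> y" using xy(3) loop by metis
      hence "i \<noteq> j" using ij by blast
      thus ?thesis using ij \<phi>e fits by (intro hostI) auto
    qed
    ultimately show ?case by blast
  next
    case (Suc k)
    then obtain \<phi> where \<phi>: "inj_on \<phi> (S k)" "\<phi> ` S k \<subseteq> {\<tau>..<\<tau> + b + k * s}"
      "\<And>x y. x \<in> S k \<Longrightarrow> y \<in> S k \<Longrightarrow> {x, y} \<in> E \<Longrightarrow> {\<phi> x, \<phi> y} \<in> host n \<tau> b K A"
      by (metis Suc_leD)
    have kK: "k < K" using Suc.prems by simp
    define J where "J = {j. j < r \<and> \<kappa> j = k}"
    \<comment> \<open>Only neighbours that already have a spot constrain \<open>v j\<close>; an edge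
      to a later vertex is taken care of when that vertex is placed.\<close>
    define N where "N j = \<phi> ` (nbs E (v j) \<inter> S k)" for j
    have finnbs: "finite (nbs E x)" for x using nbs_subset[OF E] finV by (meson finite_Diff finite_subset)
    have "\<exists>h. inj_on h J \<and> (\<forall>j\<in>J. h j \<in> part (\<tau> + b) s k \<and> N j \<subseteq> A k `` {h j})"
    proof (rule expanding_transversal)
      show "expanding (A k) (part (\<tau> + b) s k) {\<tau>..<\<tau> + b + k * s} (\<Delta> k) c" using exp[OF kK] by blast
      show "disjoint_family_on N J"
        unfolding disjoint_family_on_def
      proof (intro ballI impI)
        fix i j assume ij: "i \<in> J" "j \<in> J" "i \<noteq> j"
        hence "nbs E (v i) \<inter> nbs E (v j) \<inter> e ` {..<b + r} = {}"
          using proper[of i j] unfolding J_def v_def by auto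
        hence "(nbs E (v i) \<inter> S k) \<inter> (nbs E (v j) \<inter> S k) = {}" using SR[of k] by blast
        thus "N i \<inter> N j = {}"
          unfolding N_def using inj_on_image_Int[OF \<phi>(1), of "nbs E (v i) \<inter> S k" "nbs E (v j) \<inter> S k"] by auto
      qed
      show "N j \<subseteq> {\<tau>..<\<tau> + b + k * s} \<and> card (N j) \<le> \<Delta> k" if "j \<in> J" for j
      proof
        show "N j \<subseteq> {\<tau>..<\<tau> + b + k * s}" using \<phi>(2) unfolding N_def by blast
        have "card (N j) \<le> card (nbs E (v j) \<inter> S k)"
          unfolding N_def using finnbs by (intro card_image_le) auto
        also have "\<dots> \<le> card (nbs E (v j))" using finnbs by (intro card_mono) auto
        also have "\<dots> \<le> \<Delta> k" using deg[of j] that unfolding J_def v_def by auto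
        finally show "card (N j) \<le> \<Delta> k" .
      qed
    qed (use capped[of k] in \<open>auto simp: J_def part_def\<close>)
    then obtain h where h: "inj_on h J" "\<And>j. j \<in> J \<Longrightarrow> h j \<in> part (\<tau> + b) s k"
      "\<And>j. j \<in> J \<Longrightarrow> N j \<subseteq> A k `` {h j}" by blast
    have Jr: "j < r" if "j \<in> J" for j using that unfolding J_def by simp
    have vJ: "inj_on v J" using v_inj Jr by (auto simp: inj_on_def)
    define \<phi>' where "\<phi>' x = (if x \<in> v ` J then h (inv_into J v x) else \<phi> x)" for x
    have \<phi>'v: "\<phi>' (v j) = h j" if "j \<in> J" for j unfolding \<phi>'_def using that vJ by simp
    have SJ: "S k \<inter> v ` J = {}"
    proof (rule equals0I)
      fix x assume "x \<in> S k \<inter> v ` J"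
      then obtain j where j: "j \<in> J" "x = v j" "x \<in> S k" by blast
      then obtain i where i: "i < r" "\<kappa> i < k" "v j = v i"
        unfolding S_def using v_notin[OF Jr[OF j(1)]] by auto
      hence "i = j" using v_inj[OF Jr[OF j(1)] i(1)] by simp
      thus False using i(2) j(1) unfolding J_def by simp
    qed
    have \<phi>'S: "\<phi>' x = \<phi> x" if "x \<in> S k" for x unfolding \<phi>'_def using SJ that by auto
    have SSuc: "S (Suc k) = S k \<union> v ` J" unfolding S_def J_def by (auto simp: less_Suc_eq)
    have hgt: "\<tau> + b + k * s \<le> h j" "h j < \<tau> + b + Suc k * s" if "j \<in> J" for j
      using h(2)[OF that] unfolding part_def by auto
    have \<phi>lt: "\<tau> \<le> \<phi> x" "\<phi> x < \<tau> + b + k * s" if "x \<in> S k" for x using \<phi>(2) that by auto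
    have "Suc k * s \<le> K * s" using kK by (intro mult_right_mono) auto
    hence hn: "h j < n" if "j \<in> J" for j using hgt(2)[OF that] fits by linarith
    have "inj_on \<phi>' (S k \<union> v ` J)"
    proof (rule inj_onI)
      fix x y assume xy: "x \<in> S k \<union> v ` J" "y \<in> S k \<union> v ` J" "\<phi>' x = \<phi>' y"
      consider "x \<in> S k" "y \<in> S k" | i where "x \<in> S k" "i \<in> J" "y = v i"
        | i where "y \<in> S k" "i \<in> J" "x = v i" | i j where "i \<in> J" "j \<in> J" "x = v i" "y = v j"
        using xy by blast
      thus "x = y"
      proof cases
        case 1
        thus ?thesis using xy(3) \<phi>'S \<phi>(1) by (simp add: inj_on_eq_iff)
      next
        case 2
        thus ?thesis using xy(3) \<phi>'S \<phi>'v \<phi>lt(2)[of x] hgt(1)[of i] by simp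
      next
        case 3
        thus ?thesis using xy(3) \<phi>'S \<phi>'v \<phi>lt(2)[of y] hgt(1)[of i] by simp
      next
        case 4
        thus ?thesis using xy(3) \<phi>'v h(1) by (simp add: inj_on_eq_iff)
      qed
    qed
    moreover have "\<phi>' ` (S k \<union> v ` J) \<subseteq> {\<tau>..<\<tau> + b + Suc k * s}"
    proof
      fix z assume "z \<in> \<phi>' ` (S k \<union> v ` J)"
      then consider x where "x \<in> S k" "z = \<phi> x" | j where "j \<in> J" "z = h j" using \<phi>'S \<phi>'v by auto
      thus "z \<in> {\<tau>..<\<tau> + b + Suc k * s}"
      proof cases
        case 1
        thus ?thesis using \<phi>lt[of x] by auto
      next
        case 2
        thus ?thesis using hgt[of j] by auto
      qed
    qed
    moreover have cross: "{\<phi> x, h j} \<in> host n \<tau> b K A" if "x \<in> S k" "j \<in> J" "{x, v j} \<in> E" for x j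
    proof -
      have "x \<in> nbs E (v j)" unfolding nbs_def using that(3) by (simp add: insert_commute)
      hence "(h j, \<phi> x) \<in> A k" using h(3)[OF that(2)] that(1) unfolding N_def by blast
      moreover have "\<phi> x < h j" using \<phi>lt(2)[OF that(1)] hgt(1)[OF that(2)] by simp
      ultimately show ?thesis unfolding host_def using kK hn[OF that(2)] by blast
    qed
    have "{\<phi>' x, \<phi>' y} \<in> host n \<tau> b K A" if xy: "x \<in> S k \<union> v ` J" "y \<in> S k \<union> v ` J" "{x, y} \<in> E" for x y
    proof -
      consider "x \<in> S k" "y \<in> S k" | i where "x \<in> S k" "i \<in> J" "y = v i"
        | i where "y \<in> S k" "i \<in> J" "x = v i" | i j where "i \<in> J" "j \<in> J" "x = v i" "y = v j"
        using xy by blast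
      thus ?thesis
      proof cases
        case 1
        thus ?thesis using xy(3) \<phi>'S \<phi>(3) by simp
      next
        case 2
        thus ?thesis using xy(3) \<phi>'S \<phi>'v cross by simp
      next
        case 3
        thus ?thesis using xy(3) \<phi>'S \<phi>'v cross[of y i] by (simp add: insert_commute)
      next
        case 4
        have "i \<noteq> j" using 4 xy(3) loop by metis
        hence "{x, y} \<notin> E" using proper[of i j] 4 unfolding J_def v_def by auto
        thus ?thesis using xy(3) by simp
      qed
    qed
    ultimately show ?case unfolding SSuc by blast
  qed
  have SK: "S K = e ` {..<b + r}"
  proof
    show "e ` {..<b + r} \<subseteq> S K"
    proof
      fix x assume "x \<in> e ` {..<b + r}"
      then obtain i where i: "x = e i" "i < b + r" by auto
      show "x \<in> S K"
      proof (cases "i < b")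
        case False
        hence "x = v (i - b)" "i - b < r" using i unfolding v_def by auto
        thus ?thesis unfolding S_def using colour by blast
      qed (use i in \<open>auto simp: S_def\<close>)
    qed
  qed (rule SR)
  obtain \<phi> where \<phi>: "inj_on \<phi> (S K)" "\<phi> ` S K \<subseteq> {\<tau>..<\<tau> + b + K * s}"
    "\<forall>x\<in>S K. \<forall>y\<in>S K. {x, y} \<in> E \<longrightarrow> {\<phi> x, \<phi> y} \<in> host n \<tau> b K A"
    using stage[of K] by blast
  have "{\<tau>..<\<tau> + b + K * s} \<subseteq> {\<tau>..<n}" using fits by auto
  with \<phi> show ?thesis unfolding SK by blast
qed

lemma card_high_degree:
  assumes "finite V" "E \<subseteq> pairs V" "2 * card E < (l + 1) * (t + 1)"
  shows "card {v \<in> V. card (nbs E v) > l} \<le> t"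
proof -
  let ?H = "{v \<in> V. card (nbs E v) > l}"
  have "card ?H * (l + 1) = (\<Sum>v\<in>?H. l + 1)" by simp
  also have "\<dots> \<le> (\<Sum>v\<in>?H. card (nbs E v))" by (intro sum_mono) auto
  also have "\<dots> \<le> (\<Sum>v\<in>V. card (nbs E v))" using assms(1) by (intro sum_mono2) auto
  also have "\<dots> = 2 * card E" using assms by (intro sum_card_nbs)
  also have "\<dots> < (l + 1) * (t + 1)" by (rule assms(3))
  also have "\<dots> = (t + 1) * (l + 1)" by (rule mult.commute)
  finally have "card ?H < t + 1" unfolding mult_less_cancel2 by blast
  thus ?thesis by simp
qed

text \<open>Here \<open>t\<close> bounds the number of vertices of degree above \<open>l\<close>, \<open>i\<close> is the size of the independent set
  kept for the end, and \<open>D\<close> bounds the number of vertices at distance at most two from a vertex of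
  degree at most \<open>l\<close>. The truncated subtraction \<open>k - D\<close> is intended: the greedy colouring uses colour
  \<open>k\<close> only after \<open>(k - D) * c\<close> vertices.\<close>

lemma host_universal:
  fixes n m t l i \<tau> b r c s K D :: nat and A :: "nat \<Rightarrow> (nat \<times> nat) set"
  defines "lev \<equiv> \<lambda>k. 1 + (k - D) * c div b"
  assumes V: "finite V" "card V = n" and E: "E \<subseteq> pairs V" "card E \<le> m"
    and t: "2 * m < (l + 1) * (t + 1)" and i: "i * (l + 1) + t \<le> n" "t + i * l \<le> \<tau>"
    and n: "n = \<tau> + i + b + r" and b: "b > 0" and c: "c > 0"
    and D: "D = l + l * l" and K: "D + r div c < K" and fits: "\<tau> + b + K * s \<le> n"
    and A: "\<And>k. k < K \<Longrightarrow> A k \<subseteq> part (\<tau> + b) s k \<times> {\<tau>..<\<tau> + b + k * s} \<and>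
      expanding (A k) (part (\<tau> + b) s k) {\<tau>..<\<tau> + b + k * s} (2 * m div (b * lev k)) c"
  shows "\<exists>\<psi>. bij_betw \<psi> V {..<n} \<and> (\<forall>d\<in>E. \<psi> ` d \<in> host n \<tau> b K A)"
proof -
  have sub: "nbs E v \<subseteq> V" for v using nbs_subset[OF E(1)] by blast
  have finnbs: "finite (nbs E v)" for v using sub V(1) finite_subset by blast
  define H where "H = {v \<in> V. card (nbs E v) > l}"
  have "2 * card E < (l + 1) * (t + 1)" using t E(2) by linarith
  hence cardH: "card H \<le> t" unfolding H_def by (rule card_high_degree[OF V(1) E(1)])
  have HV: "H \<subseteq> V" unfolding H_def by blast
  have low: "card (nbs E v) \<le> l" if "v \<in> V - H" for v using that unfolding H_def by auto
  have "i * (l + 1) \<le> card (V - H)"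
    using i(1) cardH V HV by (simp add: card_Diff_subset finite_subset)
  then obtain I where I: "I \<subseteq> V - H" "card I = i" "\<forall>u\<in>I. \<forall>v\<in>I. {u, v} \<notin> E"
    using independent_set[of "V - H" E V l i] V(1) E(1) low by auto
  have finI: "finite I" using I(1) V(1) by (meson finite_Diff finite_subset)
  define NI where "NI = (\<Union>v\<in>I. nbs E v)"
  have "card NI \<le> (\<Sum>v\<in>I. card (nbs E v))" unfolding NI_def using finI by (rule card_UN_le)
  also have "\<dots> \<le> (\<Sum>v\<in>I. l)" using low I(1) by (intro sum_mono) auto
  finally have "card NI \<le> i * l" using I(2) by simp
  hence "card (H \<union> NI) \<le> \<tau>" using card_Un_le[of H NI] cardH i(2) by linarith
  moreover have "H \<union> NI \<subseteq> V - I"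
    using HV I(1,3) sub unfolding NI_def nbs_def by blast
  moreover have cVI: "card (V - I) = n - i" using I V finI by (subst card_Diff_subset) auto
  \<comment> \<open>The \<open>\<tau>\<close> spots joined to everything must all be filled, so
    \<open>H \<union> NI\<close> is padded to exactly \<open>\<tau>\<close> vertices. This can be
    done outside \<open>I\<close>, which is independent and avoids \<open>H\<close>.\<close>
  ultimately obtain Z where Z: "H \<union> NI \<subseteq> Z" "Z \<subseteq> V - I" "card Z = \<tau>"
    using exists_subset_between[of "H \<union> NI" \<tau> "V - I"] V(1) n by auto
  have finZ: "finite Z" using Z(2) V(1) by (meson finite_Diff finite_subset)
  define R where "R = V - I - Z"
  have finR: "finite R" unfolding R_def using V(1) by simp
  have cardR: "card R = b + r"
    unfolding R_def using Z(2,3) finZ cVI n by (subst card_Diff_subset) auto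
  obtain e where e: "bij_betw e {..<b + r} R"
    and dege: "\<And>j. j < b + r \<Longrightarrow> card (nbs E (e j)) * (j + 1) \<le> (\<Sum>v\<in>R. card (nbs E v))"
    using decreasing_enumeration[OF finR, of "\<lambda>v. card (nbs E v)"] cardR by auto
  have eR: "e j \<in> R" if "j < b + r" for j using e that by (auto simp: bij_betw_def)
  have lowR: "card (nbs E v) \<le> l" if "v \<in> R" for v using that low Z(1) unfolding R_def by auto
  have "(\<Sum>v\<in>R. card (nbs E v)) \<le> (\<Sum>v\<in>V. card (nbs E v))"
    unfolding R_def using V(1) by (intro sum_mono2) auto
  also have "\<dots> \<le> 2 * m" using sum_card_nbs[OF V(1) E(1)] E(2) by simp
  finally have dege: "card (nbs E (e j)) * (j + 1) \<le> 2 * m" if "j < b + r" for j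
    using dege[OF that] by linarith
  define v where "v j = e (b + j)" for j
  have vR: "v j \<in> R" if "j < r" for j unfolding v_def using eR that by simp
  have v_inj: "inj_on v {..<r}"
  proof (rule inj_onI)
    fix x y assume "x \<in> {..<r}" "y \<in> {..<r}" "v x = v y"
    hence "b + x = b + y" using e unfolding v_def bij_betw_def by (intro inj_onD[of e "{..<b + r}"]) auto
    thus "x = y" by simp
  qed
  \<comment> \<open>Common neighbours in \<open>Z\<close> do no harm, as their spots are joined to
    everything. Only those in \<open>R\<close> create a conflict, and they have degree at most
    \<open>l\<close>, which gives \<open>D = l + l * l\<close>.\<close>
  define conf where "conf p j \<longleftrightarrow> v p \<in> nbs E (v j) \<or> (\<exists>w\<in>R. w \<in> nbs E (v p) \<and> w \<in> nbs E (v j))" for p j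
  have "card {p. p < j \<and> conf p j} \<le> D" if j: "j < r" for j
  proof -
    let ?W = "nbs E (v j) \<union> (\<Union>w\<in>nbs E (v j) \<inter> R. nbs E w)"
    have "v ` {p. p < j \<and> conf p j} \<subseteq> ?W" unfolding conf_def using nbs_sym by fastforce
    moreover have "finite ?W" using finnbs by auto
    ultimately have "card (v ` {p. p < j \<and> conf p j}) \<le> card ?W" by (intro card_mono)
    moreover have "inj_on v {p. p < j \<and> conf p j}" using v_inj by (rule inj_on_subset) (use j in auto)
    ultimately have "card {p. p < j \<and> conf p j} \<le> card ?W" by (simp add: card_image)
    also have "\<dots> \<le> card (nbs E (v j)) + card (\<Union>w\<in>nbs E (v j) \<inter> R. nbs E w)" by (rule card_Un_le)
    also have "card (\<Union>w\<in>nbs E (v j) \<inter> R. nbs E w) \<le> (\<Sum>w\<in>nbs E (v j) \<inter> R. card (nbs E w))"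
      using finnbs by (intro card_UN_le) auto
    also have "\<dots> \<le> (\<Sum>w\<in>nbs E (v j) \<inter> R. l)" using lowR by (intro sum_mono) auto
    also have "\<dots> \<le> card (nbs E (v j)) * l" using finnbs by (simp add: card_mono)
    also have "\<dots> \<le> l * l" using lowR[OF vR[OF j]] by (intro mult_right_mono) auto
    finally show ?thesis using lowR[OF vR[OF j]] D by linarith
  qed
  then obtain \<kappa> where \<kappa>: "\<And>j. j < r \<Longrightarrow> \<kappa> j \<le> D + j div c"
      "\<And>j p. j < r \<Longrightarrow> p < j \<Longrightarrow> conf p j \<Longrightarrow> \<kappa> p \<noteq> \<kappa> j" "\<And>k. card {j. j < r \<and> \<kappa> j = k} \<le> c"
    using capped_colouring[of c r conf D] c by blast
  have emb: "\<exists>\<phi>. inj_on \<phi> (e ` {..<b + r}) \<and> \<phi> ` e ` {..<b + r} \<subseteq> {\<tau>..<n} \<and>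
    (\<forall>x\<in>e ` {..<b + r}. \<forall>y\<in>e ` {..<b + r}. {x, y} \<in> E \<longrightarrow> {\<phi> x, \<phi> y} \<in> host n \<tau> b K A)"
  proof (rule staged_embedding[OF E(1), where \<kappa> = \<kappa> and \<Delta> = "\<lambda>k. 2 * m div (b * lev k)"])
    show "inj_on e {..<b + r}" using e by (simp add: bij_betw_def)
    show "\<kappa> j < K" if "j < r" for j
    proof -
      have "j div c \<le> r div c" using that by (intro div_le_mono) simp
      thus ?thesis using \<kappa>(1)[OF that] K by linarith
    qed
    fix p j assume pj: "p < r" "j < r" "p \<noteq> j" "\<kappa> p = \<kappa> j"
    have "conf p j = conf j p" unfolding conf_def using nbs_sym by fast
    hence "\<not> conf p j" using \<kappa>(2)[of j p] \<kappa>(2)[of p j] pj by (metis linorder_neqE_nat)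
    thus "{e (b + p), e (b + j)} \<notin> E \<and> nbs E (e (b + p)) \<inter> nbs E (e (b + j)) \<inter> e ` {..<b + r} = {}"
      using e unfolding conf_def v_def[symmetric] nbs_def bij_betw_def by (auto simp: insert_commute)
  next
    fix j assume j: "j < r"
    \<comment> \<open>The cap on colours in terms of position gives
      \<open>b * lev (\<kappa> j) \<le> b + j\<close>, so the degree bound at position
      \<open>b + j\<close> implies the one required at that level.\<close>
    have "(\<kappa> j - D) * c \<le> j div c * c" using \<kappa>(1)[OF j] by (intro mult_right_mono) auto
    also have "\<dots> \<le> j" by (rule div_times_less_eq_dividend)
    finally have "(\<kappa> j - D) * c \<le> j" .
    moreover have "b * ((\<kappa> j - D) * c div b) \<le> (\<kappa> j - D) * c" by (rule times_div_less_eq_dividend)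
    moreover have "b * lev (\<kappa> j) = b + b * ((\<kappa> j - D) * c div b)"
      unfolding lev_def by (simp only: distrib_left mult_1_right)
    ultimately have "b * lev (\<kappa> j) \<le> b + j" by linarith
    hence "card (nbs E (e (b + j))) * (b * lev (\<kappa> j)) \<le> card (nbs E (e (b + j))) * (b + j + 1)"
      by (intro mult_left_mono) auto
    also have "\<dots> \<le> 2 * m" using dege[of "b + j"] j by simp
    finally show "card (nbs E (e (b + j))) \<le> 2 * m div (b * lev (\<kappa> j))"
      using b by (simp add: less_eq_div_iff_mult_less_eq lev_def)
  qed (use \<kappa>(3) V(1) A fits in auto)
  have "e ` {..<b + r} = R" using e by (simp add: bij_betw_def)
  from emb[unfolded this] obtain \<phi> where \<phi>: "inj_on \<phi> R" "\<phi> ` R \<subseteq> {\<tau>..<n}"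
    "\<And>x y. x \<in> R \<Longrightarrow> y \<in> R \<Longrightarrow> {x, y} \<in> E \<Longrightarrow> {\<phi> x, \<phi> y} \<in> host n \<tau> b K A" by blast
  \<comment> \<open>The spots left over. There are exactly \<open>i\<close> of them, since the
    vertices outside \<open>I\<close> occupy \<open>n - i\<close> spots.\<close>
  define Q where "Q = {\<tau>..<n} - \<phi> ` R"
  have "card Q = card {\<tau>..<n} - card (\<phi> ` R)"
    unfolding Q_def using \<phi>(2) finR by (intro card_Diff_subset) auto
  hence "card Q = i" using card_image[OF \<phi>(1)] cardR n by simp
  moreover have "finite Q" unfolding Q_def by simp
  ultimately obtain w where w: "bij_betw w I Q"
    using finite_same_card_bij[OF finI] I(2) by auto
  obtain z where z: "bij_betw z Z {..<\<tau>}"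
    using finite_same_card_bij[OF finZ, of "{..<\<tau>}"] Z(3) by auto
  define \<psi> where "\<psi> x = (if x \<in> Z then z x else if x \<in> I then w x else \<phi> x)" for x
  have "bij_betw \<psi> Z {..<\<tau>}" using z by (subst bij_betw_cong[where g = z]) (auto simp: \<psi>_def)
  moreover have "bij_betw \<psi> I Q"
    using w Z(2) by (subst bij_betw_cong[where g = w]) (auto simp: \<psi>_def)
  moreover have "bij_betw \<psi> R (\<phi> ` R)"
    using inj_on_imp_bij_betw[OF \<phi>(1)] by (subst bij_betw_cong[where g = \<phi>]) (auto simp: \<psi>_def R_def)
  ultimately have "bij_betw \<psi> ((Z \<union> I) \<union> R) (({..<\<tau>} \<union> Q) \<union> \<phi> ` R)"
    using \<phi>(2) by (intro bij_betw_combine) (auto simp: Q_def)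
  moreover have "(Z \<union> I) \<union> R = V" unfolding R_def using Z(2) I(1) by auto
  moreover have "({..<\<tau>} \<union> Q) \<union> \<phi> ` R = {..<n}" unfolding Q_def using \<phi>(2) n by auto
  ultimately have bij: "bij_betw \<psi> V {..<n}" by simp
  have \<psi>Z: "\<psi> x < \<tau>" if "x \<in> Z" for x using that z unfolding \<psi>_def by (auto simp: bij_betw_def)
  have \<psi>R: "\<psi> x = \<phi> x" if "x \<in> R" for x using that unfolding \<psi>_def R_def by simp
  have "\<psi> ` d \<in> host n \<tau> b K A" if d: "d \<in> E" for d
  proof -
    have "card d = 2" "d \<subseteq> V" using d E(1) by auto
    then obtain x y where xy: "d = {x, y}" "x \<noteq> y" "x \<in> V" "y \<in> V" by (auto simp: card_2_iff)
    have \<psi>xy: "\<psi> x \<noteq> \<psi> y" "\<psi> x < n" "\<psi> y < n"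
      using bij xy by (auto simp: bij_betw_def inj_on_def)
    have nbxy: "y \<in> nbs E x" "x \<in> nbs E y" using d xy(1) unfolding nbs_def by (auto simp: insert_commute)
    \<comment> \<open>A vertex of \<open>I\<close> has all its neighbours in \<open>NI\<close> and
      hence in \<open>Z\<close>, so its own spot may be arbitrary.\<close>
    have "x \<in> Z \<or> y \<in> Z \<or> (x \<in> R \<and> y \<in> R)"
    proof -
      have "y \<in> Z" if "x \<in> I" using that nbxy(1) Z(1) unfolding NI_def by blast
      moreover have "x \<in> Z" if "y \<in> I" using that nbxy(2) Z(1) unfolding NI_def by blast
      ultimately show ?thesis using xy unfolding R_def by blast
    qed
    moreover have "{\<psi> x, \<psi> y} \<in> host n \<tau> b K A" if "x \<in> Z" using \<psi>xy \<psi>Z[OF that] by (intro hostI) auto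
    moreover have "{\<psi> y, \<psi> x} \<in> host n \<tau> b K A" if "y \<in> Z" using \<psi>xy \<psi>Z[OF that] by (intro hostI) auto
    moreover have "{\<psi> x, \<psi> y} \<in> host n \<tau> b K A" if "x \<in> R" "y \<in> R"
      using \<phi>(3)[OF that] \<psi>R that d xy(1) by simp
    ultimately show ?thesis unfolding xy(1) by (auto simp: insert_commute)
  qed
  with bij show ?thesis by blast
qed

section \<open>Sparse universal graphs\<close>

text \<open>The indices below \<open>D\<close> all fall into level 1 through the truncated
  subtraction; the other indices of a level form an interval of length about b/c. After
  multiplication by \<open>c\<close> the former contribute at most b/2, the interval at most b plus
  two rounding errors of c.\<close>

lemma card_level_le:
  fixes b c D i :: nat
  assumes c: "c > 0" "2 * c \<le> b" "2 * (D * c) \<le> b"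
  shows "card {k. k < K \<and> 1 + (k - D) * c div b = i} * c \<le> 3 * b"
proof -
  have b: "b > 0" using c by simp
  define lo hi where "lo = (i - 1) * b div c" and "hi = i * b div c"
  have "{k. k < K \<and> 1 + (k - D) * c div b = i} \<subseteq> {..<D} \<union> {D + lo..D + hi}"
  proof
    fix k assume k: "k \<in> {k. k < K \<and> 1 + (k - D) * c div b = i}"
    show "k \<in> {..<D} \<union> {D + lo..D + hi}"
    proof (cases "k < D")
      case False
      have q: "(k - D) * c div b = i - 1" "i \<ge> 1" using k by auto
      have "(i - 1) * b \<le> (k - D) * c" unfolding q(1)[symmetric] by (rule div_times_less_eq_dividend)
      hence "lo \<le> (k - D) * c div c" unfolding lo_def by (rule div_le_mono)
      moreover have "(k - D) * c < ((k - D) * c div b + 1) * b"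
        using dividend_less_div_times[OF b, of "(k - D) * c"] by (simp add: distrib_right)
      hence "(k - D) * c \<le> i * b" using q by simp
      hence "(k - D) * c div c \<le> hi" unfolding hi_def by (rule div_le_mono)
      ultimately show ?thesis using False c(1) by auto
    qed simp
  qed
  hence "card {k. k < K \<and> 1 + (k - D) * c div b = i} \<le> card ({..<D} \<union> {D + lo..D + hi})"
    by (intro card_mono) auto
  also have "\<dots> \<le> D + (Suc hi - lo)" using card_Un_le[of "{..<D}" "{D + lo..D + hi}"] by simp
  finally have "card {k. k < K \<and> 1 + (k - D) * c div b = i} * c \<le> (D + (Suc hi - lo)) * c"
    by (rule mult_right_mono) simp
  also have "\<dots> = D * c + (hi * c + c - lo * c)" by (simp add: algebra_simps diff_mult_distrib)
  also have "\<dots> \<le> 3 * b"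
  proof -
    have "hi * c \<le> i * b" unfolding hi_def by (rule div_times_less_eq_dividend)
    moreover have "(i - 1) * b < lo * c + c" unfolding lo_def
      using dividend_less_div_times[OF c(1), of "(i - 1) * b"] by linarith
    moreover have "i * b \<le> (i - 1) * b + b" by (cases i) auto
    ultimately show ?thesis using c by linarith
  qed
  finally show ?thesis .
qed

text \<open>The constant 10 is the value of the infinite series: 2 * 2 from the linear term and 3 *
  2 from the constant one. The induction carries the exact remainder.\<close>

lemma sum_affine_geometric_le: "(\<Sum>i<M. (2 * real i + 3) / 2 ^ i) \<le> 10"
proof -
  have "(\<Sum>i<M. (2 * real i + 3) / 2 ^ i) = 10 - (4 * real M + 10) / 2 ^ M"
  proof (induction M)
    case (Suc M)
    have "10 - (4 * x + 10) / p + (2 * x + 3) / p = 10 - (4 * (x + 1) + 10) / (2 * p)" if "p > 0" for x p :: real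
      using that by (simp add: field_simps)
    from this[of "2 ^ M" "real M"] show ?case using Suc by (simp add: add.commute)
  qed simp
  thus ?thesis by simp
qed

text \<open>A part at level i is joined to at most (2i + 3)b spots at a density of order 2^(-i), and
  by \<open>card_level_le\<close> a level has at most 3b/c parts. Each level thus contributes at
  most 4b * 3b * (2i + 3)/2^i, and the series sums to at most 10.\<close>

lemma sum_part_edges_le:
  fixes b c s D K :: nat and N :: "nat \<Rightarrow> nat"
  assumes c: "c > 0" "2 * c \<le> b" "2 * (D * c) \<le> b" and s: "s \<le> 2 * c"
    and N: "\<And>k. k < K \<Longrightarrow> N k * 2 ^ (1 + (k - D) * c div b) \<le> 2 * (s * (b + k * s))"
  shows "real (\<Sum>k<K. N k) \<le> 120 * real b ^ 2"
proof -
  define lev where "lev k = 1 + (k - D) * c div b" for k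
  define a where "a i = (2 * real i + 3) / 2 ^ i" for i :: nat
  have b: "b > 0" using c by simp
  have a0: "0 \<le> a i" for i unfolding a_def by simp
  have Nk: "real (N k) \<le> 4 * real b * (real c * a (lev k))" if "k < K" for k
  proof -
    have "(k - D) * c < lev k * b"
      using dividend_less_div_times[OF b, of "(k - D) * c"] unfolding lev_def by (simp add: distrib_right)
    moreover have "k * c \<le> ((k - D) + D) * c" by (intro mult_right_mono) auto
    hence "k * c \<le> (k - D) * c + D * c" by (simp only: add_mult_distrib)
    moreover have "k * s \<le> k * (2 * c)" using s by (intro mult_left_mono) auto
    hence "k * s \<le> 2 * (k * c)" by simp
    ultimately have "b + k * s \<le> 2 * (lev k * b) + 3 * b" using c by linarith
    hence "s * (b + k * s) \<le> (2 * c) * (2 * (lev k * b) + 3 * b)" using s by (intro mult_mono) auto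
    hence "N k * 2 ^ lev k \<le> 2 * ((2 * c) * (2 * (lev k * b) + 3 * b))"
      using N[OF that] unfolding lev_def by linarith
    hence "real (N k * 2 ^ lev k) \<le> real (2 * ((2 * c) * (2 * (lev k * b) + 3 * b)))" by (rule of_nat_mono)
    hence "real (N k) * 2 ^ lev k \<le> 4 * real b * (real c * (2 * real (lev k) + 3))" by (simp add: algebra_simps)
    thus ?thesis unfolding a_def by (simp add: pos_le_divide_eq)
  qed
  define M where "M = Suc (lev K)"
  have "lev ` {..<K} \<subseteq> {..<M}"
    unfolding M_def lev_def by (auto simp: less_Suc_eq_le intro!: div_le_mono mult_right_mono diff_le_mono)
  hence "(\<Sum>k<K. real c * a (lev k)) = (\<Sum>i<M. \<Sum>k | k \<in> {..<K} \<and> lev k = i. real c * a (lev k))"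
    by (subst sum.group) auto
  also have "\<dots> = (\<Sum>i<M. real (card {k. k < K \<and> lev k = i} * c) * a i)" by (intro sum.cong) auto
  also have "\<dots> \<le> (\<Sum>i<M. real (3 * b) * a i)"
    using card_level_le[OF c] a0 unfolding lev_def by (intro sum_mono mult_right_mono of_nat_mono) auto
  also have "\<dots> = real (3 * b) * (\<Sum>i<M. a i)" by (simp add: sum_distrib_left)
  also have "\<dots> \<le> real (3 * b) * 10"
    using sum_affine_geometric_le unfolding a_def by (intro mult_left_mono) auto
  finally have *: "(\<Sum>k<K. real c * a (lev k)) \<le> 30 * real b" by simp
  have "real (\<Sum>k<K. N k) \<le> (\<Sum>k<K. 4 * real b * (real c * a (lev k)))"
    using Nk by (auto intro!: sum_mono)
  also have "\<dots> = 4 * real b * (\<Sum>k<K. real c * a (lev k))" by (simp add: sum_distrib_left)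
  also have "\<dots> \<le> 4 * real b * (30 * real b)" using * by (intro mult_left_mono) auto
  finally show ?thesis by (simp add: power2_eq_square)
qed

text \<open>The inequalities needed for the choice of parameters below, with \<open>x\<close> the number of edges.\<close>

definition admissible :: "real \<Rightarrow> bool" where
  "admissible x \<longleftrightarrow> ln x \<ge> 1 \<and>
    (x powr (4/5) + 1) * ((ln x)^2 + 2) + 2 * x / (ln x)^2 + 1 \<le> 20 * x / ln x \<and>
    (((ln x)^2 + 1) + ((ln x)^2 + 1) * ((ln x)^2 + 1) + 1) * (x powr (1/2) + x powr (1/4) + 2)
      + 2 * x powr (1/2) * (x powr (1/4) + 1) \<le> x powr (4/5) \<and>
    ln (4 * (x powr (1/2) + x powr (1/4) + 2)) + ln x / 10 * ln (2 * x + 1) \<le> x powr (1/4) / x powr (1/10) \<and>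
    x powr (1/4) + 1 \<le> x powr (1/2) \<and>
    2 * ((((ln x)^2 + 1) + ((ln x)^2 + 1) * ((ln x)^2 + 1) + 1) * (x powr (1/2) + 1)) \<le> 20 * x / ln x \<and>
    2 * x / (ln x)^2 + 1 + (x powr (4/5) + 1) * ((ln x)^2 + 1) \<le> 4 * x / (ln x)^2 \<and>
    20 * x / ln x + 1 \<le> 21 * x / ln x"

lemma eventually_admissible: "eventually admissible at_top"
  unfolding admissible_def by (intro eventually_conj; real_asymp)

section \<open>Universality and the choice of parameters\<close>

text \<open>Admitting every vertex set \<open>V\<close> and every number of edges up to
  \<open>m\<close> lets the property be applied to the graphs that a larger graph induces on
  subsets.\<close>

definition universal :: "nat set set \<Rightarrow> nat \<Rightarrow> nat \<Rightarrow> bool" where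
  "universal F n m \<longleftrightarrow> F \<subseteq> pairs {..<n} \<and>
     (\<forall>(V :: nat set) E. finite V \<longrightarrow> card V = n \<longrightarrow> E \<subseteq> pairs V \<longrightarrow> card E \<le> m \<longrightarrow>
        (\<exists>\<psi>. bij_betw \<psi> V {..<n} \<and> (\<forall>d\<in>E. \<psi> ` d \<in> F)))"

lemma image_pairs:
  assumes "inj_on \<psi> V" "\<psi> ` V \<subseteq> W" "d \<in> pairs V"
  shows "\<psi> ` d \<in> pairs W"
  using assms card_image[OF inj_on_subset[OF assms(1), of d]] by auto

lemma universal_complete: "universal (pairs {..<n}) n m"
  unfolding universal_def
proof (intro conjI allI impI)
  fix V :: "nat set" and E
  assume V: "finite V" "card V = n" "E \<subseteq> pairs V"
  obtain \<psi> where \<psi>: "bij_betw \<psi> V {..<n}" using finite_same_card_bij[of V "{..<n}"] V by auto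
  have "\<forall>d\<in>E. \<psi> ` d \<in> pairs {..<n}"
    using image_pairs[of \<psi> V "{..<n}"] \<psi> V(3) by (auto simp: bij_betw_def)
  with \<psi> show "\<exists>\<psi>. bij_betw \<psi> V {..<n} \<and> (\<forall>d\<in>E. \<psi> ` d \<in> pairs {..<n})" by blast
qed simp

text \<open>At most \<open>2 * m\<close> vertices meet an edge; the others are isolated and take the
  additional spots.\<close>

lemma universal_extend:
  assumes "universal F (2 * m) m" "2 * m \<le> n"
  shows "universal F n m"
  unfolding universal_def
proof (intro conjI allI impI)
  show "F \<subseteq> pairs {..<n}" using assms unfolding universal_def by fastforce
  fix V :: "nat set" and E
  assume V: "finite V" "card V = n" "E \<subseteq> pairs V" "card E \<le> m"
  have finE: "finite E" using V finite_pairs finite_subset by blast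
  have "card (\<Union>E) \<le> (\<Sum>d\<in>E. card d)" using card_UN_le[OF finE, of "\<lambda>d. d"] by simp
  also have "\<dots> = (\<Sum>d\<in>E. 2)" using V(3) by (intro sum.cong) auto
  finally have "card (\<Union>E) \<le> 2 * m" using V(4) by simp
  moreover have "\<Union>E \<subseteq> V" using V(3) by blast
  ultimately obtain U where U: "\<Union>E \<subseteq> U" "U \<subseteq> V" "card U = 2 * m"
    using exists_subset_between[of "\<Union>E" "2 * m" V] V(1,2) assms(2) by auto
  have finU: "finite U" using U V(1) finite_subset by blast
  have "E \<subseteq> pairs U" using V(3) U(1) by auto
  then obtain \<psi> where \<psi>: "bij_betw \<psi> U {..<2 * m}" "\<forall>d\<in>E. \<psi> ` d \<in> F"
    using assms(1) finU U(3) V(4) unfolding universal_def by blast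
  have "card (V - U) = card {2 * m..<n}" using U finU V by (simp add: card_Diff_subset)
  then obtain \<chi> where \<chi>: "bij_betw \<chi> (V - U) {2 * m..<n}"
    using finite_same_card_bij[of "V - U" "{2 * m..<n}"] V(1) by auto
  define \<psi>' where "\<psi>' x = (if x \<in> U then \<psi> x else \<chi> x)" for x
  have "bij_betw \<psi>' U {..<2 * m}" using \<psi>(1) by (subst bij_betw_cong[where g = \<psi>]) (auto simp: \<psi>'_def)
  moreover have "bij_betw \<psi>' (V - U) {2 * m..<n}" using \<chi> by (subst bij_betw_cong[where g = \<chi>]) (auto simp: \<psi>'_def)
  ultimately have "bij_betw \<psi>' (U \<union> (V - U)) ({..<2 * m} \<union> {2 * m..<n})" by (intro bij_betw_combine) auto
  moreover have "U \<union> (V - U) = V" "{..<2 * m} \<union> {2 * m..<n} = {..<n}" using U assms(2) by auto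
  ultimately have "bij_betw \<psi>' V {..<n}" by simp
  moreover have "\<psi>' ` d \<in> F" if "d \<in> E" for d
  proof -
    have "\<psi>' ` d = \<psi> ` d" using that U(1) unfolding \<psi>'_def by (intro image_cong) auto
    thus ?thesis using \<psi>(2) that by simp
  qed
  ultimately show "\<exists>\<psi>. bij_betw \<psi> V {..<n} \<and> (\<forall>d\<in>E. \<psi> ` d \<in> F)" by blast
qed

lemma nat_ceiling_bounds:
  assumes "x \<ge> 0"
  shows "x \<le> real (nat \<lceil>x\<rceil>)" "real (nat \<lceil>x\<rceil>) \<le> x + 1"
  using assms by linarith+

text \<open>The size of \<open>b\<close> is forced by the requirement that degree bound times level
  stay below ln m / 10. The condition \<open>n \<le> 2 * m\<close> keeps the cost
  \<open>\<tau> * n\<close> of the fully joined spots within O(m^2 / ln^2 m).\<close>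

lemma universal_medium:
  fixes m n :: nat
  defines "x \<equiv> real m"
  defines "b \<equiv> nat \<lceil>20 * x / ln x\<rceil>"
  assumes adm: "admissible x"
    and n: "4 * b \<le> n" "n \<le> 2 * m"
  shows "\<exists>F. universal F n m \<and> real (card F) \<le> 8 * x ^ 2 / (ln x)^2 + 121 * real b ^ 2"
proof -
  have L1: "ln x \<ge> 1"
    and P1: "(x powr (4/5) + 1) * ((ln x)^2 + 2) + 2 * x / (ln x)^2 + 1 \<le> 20 * x / ln x"
    and P2: "(((ln x)^2 + 1) + ((ln x)^2 + 1) * ((ln x)^2 + 1) + 1) * (x powr (1/2) + x powr (1/4) + 2)
      + 2 * x powr (1/2) * (x powr (1/4) + 1) \<le> x powr (4/5)"
    and P3: "ln (4 * (x powr (1/2) + x powr (1/4) + 2)) + ln x / 10 * ln (2 * x + 1) \<le> x powr (1/4) / x powr (1/10)"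
    and P4: "x powr (1/4) + 1 \<le> x powr (1/2)"
    and P5: "2 * ((((ln x)^2 + 1) + ((ln x)^2 + 1) * ((ln x)^2 + 1) + 1) * (x powr (1/2) + 1)) \<le> 20 * x / ln x"
    and P6: "2 * x / (ln x)^2 + 1 + (x powr (4/5) + 1) * ((ln x)^2 + 1) \<le> 4 * x / (ln x)^2"
    using adm unfolding admissible_def by auto
  define L where "L = ln x"
  have x0: "x > 1"
  proof (rule ccontr)
    assume "\<not> x > 1"
    hence "m = 0 \<or> m = 1" unfolding x_def by linarith
    thus False using L1 unfolding x_def by auto
  qed
  have m0: "m > 0" using x0 unfolding x_def by simp
  \<comment> \<open>By the degree sum at most \<open>t\<close> vertices exceed degree
    \<open>l\<close>. The exponents are chosen with 1/10 < 1/4, so that \<open>\<sigma>\<close>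
    outweighs the rarity of suitable spots, and 1/2 + 1/4 < 4/5, so that \<open>i\<close> outweighs
    the slack lost in all parts.\<close>
  define t where "t = nat \<lceil>2 * x / L ^ 2\<rceil>"
  define l where "l = nat \<lceil>L ^ 2\<rceil>"
  define c where "c = nat \<lceil>x powr (1/2)\<rceil>"
  define \<sigma> where "\<sigma> = nat \<lceil>x powr (1/4)\<rceil>"
  define s where "s = c + \<sigma>"
  define i where "i = nat \<lceil>x powr (4/5)\<rceil>"
  define \<tau> where "\<tau> = t + i * l"
  define D where "D = l + l * l"
  define K where "K = (n - \<tau> - b) div s"
  define r where "r = n - \<tau> - i - b"
  define lev where "lev k = 1 + (k - D) * c div b" for k
  have L: "L \<ge> 1" using L1 unfolding L_def .
  have tB: "2 * x / L ^ 2 \<le> real t" "real t \<le> 2 * x / L ^ 2 + 1"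
    unfolding t_def using x0 by (auto intro!: nat_ceiling_bounds)
  have lB: "L ^ 2 \<le> real l" "real l \<le> L ^ 2 + 1" unfolding l_def by (auto intro!: nat_ceiling_bounds)
  have cB: "x powr (1/2) \<le> real c" "real c \<le> x powr (1/2) + 1" unfolding c_def by (auto intro!: nat_ceiling_bounds)
  have \<sigma>B: "x powr (1/4) \<le> real \<sigma>" "real \<sigma> \<le> x powr (1/4) + 1" unfolding \<sigma>_def by (auto intro!: nat_ceiling_bounds)
  have iB: "x powr (4/5) \<le> real i" "real i \<le> x powr (4/5) + 1" unfolding i_def by (auto intro!: nat_ceiling_bounds)
  have bB: "20 * x / L \<le> real b" unfolding b_def L_def[symmetric] using x0 L by (intro nat_ceiling_bounds) auto
  have c0: "c > 0" using cB(1) x0 by (smt (verit) of_nat_0_less_iff powr_gt_zero)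
  have \<sigma>c: "\<sigma> \<le> c" using \<sigma>B(2) cB(1) P4 by linarith
  have DB: "real D + 1 \<le> (L^2 + 1) + (L^2 + 1) * (L^2 + 1) + 1"
  proof -
    have "real l * real l \<le> (L^2 + 1) * (L^2 + 1)" using lB by (intro mult_mono) auto
    thus ?thesis using lB(2) unfolding D_def by simp
  qed
  have ilt: "i * (l + 1) + t \<le> b"
  proof -
    have "real (i * (l + 1) + t) \<le> (x powr (4/5) + 1) * (L^2 + 2) + (2 * x / L^2 + 1)"
    proof -
      have "real i * real (l + 1) \<le> (x powr (4/5) + 1) * (L^2 + 2)" using iB lB by (intro mult_mono) auto
      thus ?thesis using tB unfolding of_nat_add of_nat_mult by linarith
    qed
    also have "\<dots> \<le> real b" using P1 bB unfolding L_def by linarith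
    finally show ?thesis by linarith
  qed
  have \<tau>i: "\<tau> + i \<le> b" using ilt unfolding \<tau>_def by simp
  have b0: "b > 0" using \<tau>i iB(1) x0 by (smt (verit) of_nat_0_less_iff powr_gt_zero add_gr_0 gr_zeroI le_zero_eq)
  have nr: "n = \<tau> + i + b + r" unfolding r_def using \<tau>i n(1) by linarith
  have cDb: "2 * (D * c) + 2 * c \<le> b"
  proof -
    have "real ((D + 1) * c) \<le> ((L^2 + 1) + (L^2 + 1) * (L^2 + 1) + 1) * (x powr (1/2) + 1)"
    proof -
      have "real (D + 1) * real c \<le> ((L^2 + 1) + (L^2 + 1) * (L^2 + 1) + 1) * (x powr (1/2) + 1)"
        using DB cB(2) by (intro mult_mono) auto
      thus ?thesis by (simp only: of_nat_mult)
    qed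
    hence "real (2 * ((D + 1) * c)) \<le> real b" using P5 bB unfolding L_def by simp
    hence "2 * ((D + 1) * c) \<le> b" by (simp only: of_nat_le_iff)
    thus ?thesis by (simp add: algebra_simps)
  qed
  have t2: "2 * m < (l + 1) * (t + 1)"
  proof -
    have "2 * x = L ^ 2 * (2 * x / L ^ 2)" using L by simp
    also have "\<dots> \<le> real l * real t" using lB tB x0 by (intro mult_mono) auto
    finally have "real (2 * m) \<le> real (l * t)" unfolding x_def by simp
    thus ?thesis by (simp only: of_nat_le_iff) simp
  qed
  \<comment> \<open>Beyond the clique there are \<open>r + i\<close> spots, of which the
    \<open>r\<close> vertices take \<open>r\<close>. The remaining \<open>i\<close> must pay for
    \<open>\<sigma>\<close> idle spots per part and for the \<open>D + 1\<close> extra parts that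
    the colouring may call for.\<close>
  have KB: "D + r div c < K"
  proof -
    have "real (r div c) * x powr (1/2) \<le> real (r div c * c)" using cB(1) by (simp add: mult_left_mono)
    also have "\<dots> \<le> real r" by (rule of_nat_mono) (rule div_times_less_eq_dividend)
    also have "\<dots> \<le> 2 * x" using nr n(2) unfolding x_def by linarith
    also have "\<dots> = (2 * x powr (1/2)) * x powr (1/2)" using x0 by (simp add: powr_add[symmetric])
    finally have rc: "real (r div c) \<le> 2 * x powr (1/2)" using x0 by simp
    have "real ((D + 1) * s + r div c * \<sigma>) \<le>
        ((L^2 + 1) + (L^2 + 1) * (L^2 + 1) + 1) * (x powr (1/2) + x powr (1/4) + 2)
        + 2 * x powr (1/2) * (x powr (1/4) + 1)"
    proof -
      have "real s \<le> x powr (1/2) + x powr (1/4) + 2" unfolding s_def using cB \<sigma>B by simp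
      hence "real (D + 1) * real s \<le> ((L^2 + 1) + (L^2 + 1) * (L^2 + 1) + 1) * (x powr (1/2) + x powr (1/4) + 2)"
        using DB by (intro mult_mono) auto
      moreover have "real (r div c) * real \<sigma> \<le> (2 * x powr (1/2)) * (x powr (1/4) + 1)"
        using rc \<sigma>B by (intro mult_mono) auto
      ultimately show ?thesis unfolding of_nat_add of_nat_mult by linarith
    qed
    also have "\<dots> \<le> real i" using P2 iB(1) unfolding L_def by linarith
    finally have "(D + 1) * s + r div c * \<sigma> \<le> i" by linarith
    moreover have "r div c * c \<le> r" by (rule div_times_less_eq_dividend)
    moreover have "(D + 1 + r div c) * s = (D + 1) * s + r div c * \<sigma> + r div c * c"
      unfolding s_def by (simp add: algebra_simps)
    ultimately have "(D + 1 + r div c) * s \<le> r + i" by linarith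
    also have "\<dots> = n - \<tau> - b" using nr by linarith
    finally have "D + 1 + r div c \<le> K" unfolding K_def using c0
      by (subst less_eq_div_iff_mult_less_eq) (auto simp: s_def)
    thus ?thesis by simp
  qed
  have Ks: "\<tau> + b + K * s \<le> n"
  proof -
    have "K * s \<le> n - \<tau> - b" unfolding K_def by (rule div_times_less_eq_dividend)
    thus ?thesis using nr by linarith
  qed
  have "\<exists>A\<subseteq>part (\<tau> + b) s k \<times> {\<tau>..<\<tau> + b + k * s}.
      card A * 2 ^ lev k \<le> 2 * (card (part (\<tau> + b) s k) * card {\<tau>..<\<tau> + b + k * s}) \<and>
      expanding A (part (\<tau> + b) s k) {\<tau>..<\<tau> + b + k * s} (2 * m div (b * lev k)) c" if k: "k < K" for k
  proof (rule exists_expanding)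
    define \<Delta> where "\<Delta> = 2 * m div (b * lev k)"
    let ?y = "card {\<tau>..<\<tau> + b + k * s}"
    show "c + \<sigma> \<le> card (part (\<tau> + b) s k)" unfolding part_def s_def by simp
    have cp: "real (card (part (\<tau> + b) s k)) \<le> x powr (1/2) + x powr (1/4) + 2"
      unfolding part_def s_def using cB \<sigma>B by simp
    have cp0: "0 < real (card (part (\<tau> + b) s k))" unfolding part_def s_def using c0 by simp
    have "k * s \<le> K * s" using k by (intro mult_right_mono) auto
    moreover have "?y = b + k * s" by simp
    ultimately have "?y \<le> 2 * m" using Ks n(2) by linarith
    hence y: "real ?y \<le> 2 * x" unfolding x_def by linarith
    have "\<Delta> * (b * lev k) \<le> 2 * m" unfolding \<Delta>_def by (rule div_times_less_eq_dividend)
    hence "real (\<Delta> * (b * lev k)) \<le> real (2 * m)" by (rule of_nat_mono)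
    hence "(real \<Delta> * real (lev k)) * real b \<le> 2 * x" unfolding x_def by (simp add: ac_simps)
    moreover have "(real \<Delta> * real (lev k)) * (20 * x / L) \<le> (real \<Delta> * real (lev k)) * real b"
      using bB by (intro mult_left_mono) auto
    ultimately have "(real \<Delta> * real (lev k)) * (20 * x / L) \<le> 2 * x" by linarith
    hence \<Delta>lev: "real \<Delta> * real (lev k) \<le> L / 10" using L x0 by (simp add: field_simps)
    have "real \<Delta> * 1 \<le> real \<Delta> * real (lev k)" unfolding lev_def by (intro mult_left_mono) auto
    hence \<Delta>: "real \<Delta> \<le> L / 10" using \<Delta>lev by simp
    \<comment> \<open>Since 2 is below e, the inverse of the probability that a spot suits a
      prescribed neighbourhood is at most exp(L/10), the same bound for every part.\<close>
    have "real (2 ^ lev k) ^ \<Delta> = 2 ^ (\<Delta> * lev k)" by (simp add: power_mult[symmetric] mult.commute)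
    also have "\<dots> \<le> exp 1 ^ (\<Delta> * lev k)" using exp_ge_add_one_self[of 1] by (intro power_mono) auto
    also have "\<dots> = exp (real \<Delta> * real (lev k))" by (simp add: exp_of_nat_mult[symmetric])
    also have "\<dots> \<le> exp (L / 10)" using \<Delta>lev by simp
    also have "\<dots> = x powr (1/10)" unfolding L_def powr_def using x0 by simp
    finally have pow: "real (2 ^ lev k) ^ \<Delta> \<le> x powr (1/10)" .
    have "ln (4 * real (card (part (\<tau> + b) s k)) * (real ?y + 1) ^ \<Delta>)
        = ln (4 * real (card (part (\<tau> + b) s k))) + real \<Delta> * ln (real ?y + 1)"
    proof -
      have "ln (4 * p * z ^ \<Delta>) = ln (4 * p) + real \<Delta> * ln z" if "p > 0" "z > 0" for p z :: real
        using that by (simp add: ln_mult ln_realpow)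
      thus ?thesis using cp0 by (meson add_nonneg_pos of_nat_0_le_iff zero_less_one)
    qed
    also have "\<dots> \<le> ln (4 * (x powr (1/2) + x powr (1/4) + 2)) + L / 10 * ln (2 * x + 1)"
    proof (rule add_mono)
      have y0: "0 \<le> real ?y" by simp
      have lny: "ln (real ?y + 1) \<le> ln (2 * x + 1)"
        by (subst ln_le_cancel_iff) (use y y0 x0 in \<open>linarith+\<close>)
      show "real \<Delta> * ln (real ?y + 1) \<le> L / 10 * ln (2 * x + 1)"
        by (rule mult_mono[OF \<Delta> lny]) (use L in auto)
      have "4 * real (card (part (\<tau> + b) s k)) \<le> 4 * (x powr (1/2) + x powr (1/4) + 2)"
        using cp by (rule mult_left_mono) simp
      moreover have "0 < 4 * real (card (part (\<tau> + b) s k))" using cp0 by simp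
      ultimately show "ln (4 * real (card (part (\<tau> + b) s k))) \<le> ln (4 * (x powr (1/2) + x powr (1/4) + 2))"
        by (meson ln_le_cancel_iff less_le_trans)
    qed
    also have "\<dots> \<le> x powr (1/4) / x powr (1/10)" using P3 unfolding L_def .
    also have "\<dots> \<le> real \<sigma> / real (2 ^ lev k) ^ \<Delta>" using \<sigma>B(1) pow by (intro frac_le) auto
    finally show "ln (4 * real (card (part (\<tau> + b) s k)) * (real ?y + 1) ^ (2 * m div (b * lev k)))
        \<le> real \<sigma> / real (2 ^ lev k) ^ (2 * m div (b * lev k))" unfolding \<Delta>_def .
  qed (auto simp: part_def)
  then obtain A where A: "\<And>k. k < K \<Longrightarrow> A k \<subseteq> part (\<tau> + b) s k \<times> {\<tau>..<\<tau> + b + k * s}"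
      "\<And>k. k < K \<Longrightarrow> card (A k) * 2 ^ lev k \<le> 2 * (card (part (\<tau> + b) s k) * card {\<tau>..<\<tau> + b + k * s})"
      "\<And>k. k < K \<Longrightarrow> expanding (A k) (part (\<tau> + b) s k) {\<tau>..<\<tau> + b + k * s} (2 * m div (b * lev k)) c"
    by metis
  have "universal (host n \<tau> b K A) n m"
    unfolding universal_def
  proof (intro conjI allI impI host_subset)
    fix V :: "nat set" and E
    assume V: "finite V" "card V = n" "E \<subseteq> pairs V" "card E \<le> m"
    show "\<exists>\<psi>. bij_betw \<psi> V {..<n} \<and> (\<forall>d\<in>E. \<psi> ` d \<in> host n \<tau> b K A)"
    proof (rule host_universal[OF V t2, where i = i and r = r and c = c and s = s and D = D])
      show "i * (l + 1) + t \<le> n" using ilt n(1) by linarith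
      show "t + i * l \<le> \<tau>" unfolding \<tau>_def by simp
      show "n = \<tau> + i + b + r" by (rule nr)
      fix k assume "k < K"
      thus "A k \<subseteq> part (\<tau> + b) s k \<times> {\<tau>..<\<tau> + b + k * s} \<and>
        expanding (A k) (part (\<tau> + b) s k) {\<tau>..<\<tau> + b + k * s} (2 * m div (b * (1 + (k - D) * c div b))) c"
        using A unfolding lev_def by blast
    qed (use b0 c0 D_def KB Ks in auto)
  qed
  moreover have "real (card (host n \<tau> b K A)) \<le> 8 * x ^ 2 / (ln x)^2 + 121 * real b ^ 2"
  proof -
    have "card (host n \<tau> b K A) \<le> \<tau> * n + b * b + (\<Sum>k<K. card (A k))"
    proof (rule card_host_le)
      show "finite (A k)" if "k < K" for k
        using A(1)[OF that] by (rule finite_subset) (simp add: part_def)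
    qed
    hence "real (card (host n \<tau> b K A)) \<le> real (\<tau> * n + b * b + (\<Sum>k<K. card (A k)))" by (rule of_nat_mono)
    also have "\<dots> = real \<tau> * real n + real b ^ 2 + real (\<Sum>k<K. card (A k))" by (simp add: power2_eq_square)
    also have "real (\<Sum>k<K. card (A k)) \<le> 120 * real b ^ 2"
    proof (rule sum_part_edges_le)
      show "card (A k) * 2 ^ (1 + (k - D) * c div b) \<le> 2 * (s * (b + k * s))" if "k < K" for k
        using A(2)[OF that] unfolding lev_def part_def by (simp add: algebra_simps)
    qed (use c0 cDb \<sigma>c in \<open>auto simp: s_def\<close>)
    also have "real \<tau> * real n \<le> (4 * x / L^2) * (2 * x)"
    proof (rule mult_mono)
      have "real \<tau> \<le> (2 * x / L^2 + 1) + (x powr (4/5) + 1) * (L^2 + 1)"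
        unfolding \<tau>_def using tB iB lB by (auto intro!: add_mono mult_mono)
      thus "real \<tau> \<le> 4 * x / L^2" using P6 unfolding L_def by linarith
      show "real n \<le> 2 * x" using n(2) unfolding x_def by linarith
    qed (use x0 in auto)
    also have "(4 * x / L^2) * (2 * x) = 8 * x ^ 2 / (ln x)^2" unfolding L_def by (simp add: power2_eq_square)
    finally show ?thesis by simp
  qed
  ultimately show ?thesis by blast
qed

text \<open>Outside the range of \<open>universal_medium\<close>, the complete graph is already
  sparse enough when \<open>n < 4 * b\<close>, and isolated vertices are split off when
  \<open>n > 2 * m\<close>. The constant 60000 covers 8 + 121 * 441, where 441 is the square of the
  21 that comes from rounding \<open>b\<close>.\<close>

lemma sparse_universal:
  "\<exists>C m0. C > 0 \<and> (\<forall>m\<ge>m0. \<forall>n. \<exists>F. universal F n m \<and> real (card F) \<le> C * (real m ^ 2 / ln (real m) ^ 2))"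
proof -
  from eventually_compose_filterlim[OF eventually_admissible filterlim_real_sequentially]
  obtain m0 where m0: "\<And>m. m \<ge> m0 \<Longrightarrow> admissible (real m)"
    unfolding eventually_sequentially by blast
  have main: "\<exists>F. universal F n m \<and> real (card F) \<le> 60000 * (real m ^ 2 / ln (real m) ^ 2)"
    if m: "m \<ge> m0" and n: "n \<le> 2 * m" for m n
  proof -
    have p: "ln (real m) \<ge> 1" "20 * real m / ln (real m) + 1 \<le> 21 * real m / ln (real m)"
      using m0[OF m] unfolding admissible_def by auto
    define b where "b = nat \<lceil>20 * real m / ln (real m)\<rceil>"
    have "real b \<le> 20 * real m / ln (real m) + 1" unfolding b_def using p by (intro nat_ceiling_bounds) auto
    hence "real b \<le> 21 * real m / ln (real m)" using p by linarith
    hence "real b ^ 2 \<le> (21 * real m / ln (real m)) ^ 2" by (intro power_mono) auto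
    hence b2: "real b ^ 2 \<le> 441 * (real m ^ 2 / ln (real m) ^ 2)" by (simp add: power_divide power_mult_distrib)
    have nonneg: "0 \<le> real m ^ 2 / ln (real m) ^ 2" by simp
    show ?thesis
    proof (cases "4 * b \<le> n")
      case True
      have "\<exists>F. universal F n m \<and> real (card F) \<le> 8 * real m ^ 2 / (ln (real m))^2 + 121 * real b ^ 2"
        using universal_medium[OF m0[OF m], of n] True n unfolding b_def by simp
      then obtain F where "universal F n m" "real (card F) \<le> 8 * real m ^ 2 / (ln (real m))^2 + 121 * real b ^ 2"
        by blast
      moreover have "8 * real m ^ 2 / (ln (real m))^2 + 121 * real b ^ 2 \<le> 60000 * (real m ^ 2 / ln (real m) ^ 2)"
        using b2 nonneg by linarith
      ultimately show ?thesis by (meson order_trans)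
    next
      case False
      have "card (pairs {..<n}) \<le> n * n"
      proof -
        have "card (pairs {..<n}) = n * (n - 1) div 2" using n_subsets[of "{..<n}" 2] choose_two[of n] by simp
        also have "\<dots> \<le> n * (n - 1)" by (rule div_le_dividend)
        also have "\<dots> \<le> n * n" by (intro mult_left_mono) auto
        finally show ?thesis .
      qed
      also have "\<dots> \<le> (4 * b) * (4 * b)" using False by (intro mult_mono) auto
      finally have "real (card (pairs {..<n})) \<le> real ((4 * b) * (4 * b))" by (rule of_nat_mono)
      hence "real (card (pairs {..<n})) \<le> 16 * real b ^ 2" by (simp add: power2_eq_square)
      hence "real (card (pairs {..<n})) \<le> 60000 * (real m ^ 2 / ln (real m) ^ 2)" using b2 nonneg by linarith
      thus ?thesis using universal_complete by blast
    qed
  qed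
  have "\<exists>F. universal F n m \<and> real (card F) \<le> 60000 * (real m ^ 2 / ln (real m) ^ 2)" if m: "m \<ge> m0" for m n
  proof (cases "n \<le> 2 * m")
    case False
    obtain F where "universal F (2 * m) m" "real (card F) \<le> 60000 * (real m ^ 2 / ln (real m) ^ 2)"
      using main[OF m order_refl] by blast
    thus ?thesis using universal_extend[of F m n] False by auto
  qed (rule main[OF m])
  thus ?thesis by (intro exI[of _ 60000] exI[of _ m0]) auto
qed

section \<open>Upper bounds by counting\<close>

lemma card_pairs: "finite V \<Longrightarrow> card (pairs V) = card V choose 2"
  by (rule n_subsets)

lemma max_unavoidable_ge:
  assumes "unavoidable n e (H :: nat graph)" "e \<le> n choose 2"
  shows "card (edges H) \<le> max_unavoidable n e"
  unfolding max_unavoidable_def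
proof (rule Max_ge[OF max_unavoidable_well_defined(1)[OF assms(2)]])
  show "card (edges H) \<in> {card (edges H) | H :: nat graph. unavoidable n e H}" using assms(1) by blast
qed

lemma max_unavoidable_attained:
  assumes "e \<le> n choose 2"
  obtains H :: "nat graph" where "unavoidable n e H" "max_unavoidable n e = card (edges H)"
  using Max_in[OF max_unavoidable_well_defined[OF assms]] unfolding max_unavoidable_def by auto

lemma unavoidable_embeds:
  assumes "unavoidable n e (H :: nat graph)" "E \<subseteq> pairs {..<n}" "card E = e"
  shows "\<exists>\<phi>. inj_on \<phi> (verts H) \<and> \<phi> ` verts H \<subseteq> {..<n} \<and> (\<forall>d\<in>edges H. \<phi> ` d \<in> E)"
proof -
  have "contains_copy ({..<n} :: nat set, E) H"
    using assms unfolding unavoidable_def by (auto simp: simple_graph_def)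
  thus ?thesis unfolding contains_copy_def by simp
qed

lemma unavoidable_card_verts_le:
  assumes "unavoidable n e (H :: nat graph)" "e \<le> n choose 2"
  shows "card (verts H) \<le> n"
proof -
  obtain E where E: "E \<subseteq> pairs {..<n}" "card E = e"
    using obtain_subset_with_card_n[of e "pairs {..<n}"] assms(2) card_pairs[of "{..<n}"] by auto
  obtain \<phi> where "inj_on \<phi> (verts H)" "\<phi> ` verts H \<subseteq> {..<n}"
    using unavoidable_embeds[OF assms(1) E] by blast
  thus ?thesis using card_inj_on_le[of \<phi> "verts H" "{..<n}"] by simp
qed

section \<open>Counting embeddings of an unavoidable graph\<close>

text \<open>A random \<open>m\<close>-subset of \<open>K\<close> elements lies in a fixed
  \<open>q\<close>-subset with probability at most (q/K)^m, because after j successful draws the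
  next one succeeds with probability (q-j)/(K-j), at most q/K.\<close>

lemma binomial_ratio:
  assumes "q \<le> K"
  shows "(q choose m) * K ^ m \<le> (K choose m) * q ^ m"
proof (induction m)
  case (Suc m)
  have step: "Suc m * (a choose Suc m) = (a - m) * (a choose m)" for a
  proof (cases "m < a")
    case True
    then obtain a' where a: "a = Suc a'" by (cases a) auto
    show ?thesis using Suc_times_binomial_eq[of a' m] binomial_absorb_comp[of a m] a
      by (simp add: mult.commute)
  qed (simp add: binomial_eq_0)
  have "(q - m) * K \<le> (K - m) * q"
  proof (cases "m \<le> q")
    case True
    have "m * q \<le> m * K" using assms by simp
    hence "q * K - m * K \<le> K * q - m * q" by (simp add: mult.commute diff_le_mono2)
    thus ?thesis by (simp only: diff_mult_distrib)
  qed simp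
  hence "((q choose m) * K ^ m) * ((q - m) * K) \<le> ((K choose m) * q ^ m) * ((K - m) * q)"
    by (rule mult_le_mono[OF Suc])
  moreover have "((q choose m) * K ^ m) * ((q - m) * K) = Suc m * ((q choose Suc m) * K ^ Suc m)"
  proof -
    have "Suc m * ((q choose Suc m) * K ^ Suc m) = (Suc m * (q choose Suc m)) * K ^ Suc m" by (simp only: mult.assoc)
    thus ?thesis unfolding step by (simp only: power_Suc ac_simps)
  qed
  moreover have "((K choose m) * q ^ m) * ((K - m) * q) = Suc m * ((K choose Suc m) * q ^ Suc m)"
  proof -
    have "Suc m * ((K choose Suc m) * q ^ Suc m) = (Suc m * (K choose Suc m)) * q ^ Suc m" by (simp only: mult.assoc)
    thus ?thesis unfolding step by (simp only: power_Suc ac_simps)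
  qed
  ultimately show ?case by (metis Suc_mult_le_cancel1)
qed simp

text \<open>Every graph with \<open>e\<close> edges on \<open>n\<close> fixed vertices contains the
  image of \<open>H\<close> under one of at most \<open>n ^ n\<close> injections, and a given image
  of \<open>h\<close> edges extends to \<open>e\<close> edges in at most
  \<open>(N - h) choose (e - h)\<close> ways. Symmetry of binomials turns the lower index into the
  number of non-edges.\<close>

lemma binomial_le_embeddings:
  assumes un: "unavoidable n e (H :: nat graph)" and e: "e \<le> n choose 2" and n: "n > 0"
  defines "N \<equiv> n choose 2"
  shows "(N choose (N - e)) \<le> n ^ n * ((N - card (edges H)) choose (N - e))"
proof -
  let ?P = "pairs {..<n} :: nat set set"
  define h where "h = card (edges H)"
  have sg: "simple_graph H" using un unfolding unavoidable_def by simp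
  hence finV: "finite (verts H)" and edH: "edges H \<subseteq> pairs (verts H)" unfolding simple_graph_def by auto
  have finP: "finite ?P" by (rule finite_pairs) simp
  have cP: "card ?P = N" unfolding N_def using card_pairs[of "{..<n}"] by simp
  define Fs where "Fs = {f \<in> verts H \<rightarrow>\<^sub>E {..<n}. inj_on f (verts H)}"
  define T where "T f = {E. E \<subseteq> ?P \<and> card E = e \<and> (\<lambda>d. f ` d) ` edges H \<subseteq> E}" for f :: "nat \<Rightarrow> nat"
  have "{E. E \<subseteq> ?P \<and> card E = e} \<subseteq> (\<Union>f\<in>Fs. T f)"
  proof
    fix E assume "E \<in> {E. E \<subseteq> ?P \<and> card E = e}"
    hence E: "E \<subseteq> ?P" "card E = e" by auto
    obtain \<phi> where \<phi>: "inj_on \<phi> (verts H)" "\<phi> ` verts H \<subseteq> {..<n}" "\<forall>d\<in>edges H. \<phi> ` d \<in> E"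
      using unavoidable_embeds[OF un E] by blast
    define f where "f = restrict \<phi> (verts H)"
    have "f \<in> Fs" unfolding Fs_def f_def using \<phi>(1,2) by (auto simp: inj_on_def)
    moreover have "f ` d = \<phi> ` d" if "d \<in> edges H" for d
      unfolding f_def using that edH by (intro image_cong) auto
    hence "E \<in> T f" unfolding T_def using E \<phi>(3) by auto
    ultimately show "E \<in> (\<Union>f\<in>Fs. T f)" by blast
  qed
  moreover have finPi: "finite (verts H \<rightarrow>\<^sub>E {..<n})" by (rule finite_PiE) (use finV in auto)
  moreover have finFs: "finite Fs" unfolding Fs_def using finPi by (rule rev_finite_subset) blast
  moreover have finT: "finite (T f)" for f unfolding T_def using finP by simp
  ultimately have "card {E. E \<subseteq> ?P \<and> card E = e} \<le> card (\<Union>f\<in>Fs. T f)" by (intro card_mono) auto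
  also have "\<dots> \<le> (\<Sum>f\<in>Fs. card (T f))" using finFs by (rule card_UN_le)
  also have "\<dots> \<le> (\<Sum>f\<in>Fs. (N - h) choose (N - e))"
  proof (rule sum_mono)
    fix f assume f: "f \<in> Fs"
    define X where "X = (\<lambda>d. f ` d) ` edges H"
    have injf: "inj_on f (verts H)" "f ` verts H \<subseteq> {..<n}" using f unfolding Fs_def by auto
    have "edges H \<subseteq> Pow (verts H)" using edH by auto
    hence "inj_on (\<lambda>d. f ` d) (edges H)" by (rule inj_on_subset[OF inj_on_image_Pow[OF injf(1)]])
    hence cX: "card X = h" unfolding X_def h_def by (rule card_image)
    have XP: "X \<subseteq> ?P" unfolding X_def using image_pairs[OF injf] edH by blast
    have finX: "finite X" using XP finP finite_subset by blast
    show "card (T f) \<le> (N - h) choose (N - e)"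
    proof (cases "h \<le> e")
      case True
      have "inj_on (\<lambda>E. E - X) (T f)" unfolding T_def X_def[symmetric] by (auto simp: inj_on_def)
      moreover have "(\<lambda>E. E - X) ` T f \<subseteq> {E. E \<subseteq> ?P - X \<and> card E = e - h}"
        unfolding T_def X_def[symmetric] using cX finX by (auto simp: card_Diff_subset)
      moreover have "finite {E. E \<subseteq> ?P - X \<and> card E = e - h}" using finP by simp
      ultimately have "card (T f) \<le> card {E. E \<subseteq> ?P - X \<and> card E = e - h}" by (rule card_inj_on_le)
      also have "\<dots> = (N - h) choose (e - h)"
        using n_subsets[of "?P - X" "e - h"] finP XP finX cX cP by (simp add: card_Diff_subset)
      also have "\<dots> = (N - h) choose (N - e)"
        using binomial_symmetric[of "e - h" "N - h"] True e unfolding N_def by simp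
      finally show ?thesis .
    next
      case False
      have "T f = {}"
      proof (rule equals0I)
        fix E assume E: "E \<in> T f"
        hence "card X \<le> card E" unfolding T_def X_def[symmetric] using finP by (intro card_mono) (auto dest: finite_subset)
        thus False using cX False E unfolding T_def by simp
      qed
      thus ?thesis by simp
    qed
  qed
  also have "\<dots> = card Fs * ((N - h) choose (N - e))" by simp
  also have "\<dots> \<le> n ^ n * ((N - h) choose (N - e))"
  proof (rule mult_right_mono)
    have "card Fs \<le> card (verts H \<rightarrow>\<^sub>E {..<n})"
      unfolding Fs_def using finPi by (intro card_mono) auto
    also have "\<dots> = n ^ card (verts H)" using finV by (simp add: card_PiE)
    also have "\<dots> \<le> n ^ n" using unavoidable_card_verts_le[OF un e] n by (intro power_increasing) auto
    finally show "card Fs \<le> n ^ n" .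
  qed simp
  finally have "card {E. E \<subseteq> ?P \<and> card E = e} \<le> n ^ n * ((N - h) choose (N - e))" .
  moreover have "card {E. E \<subseteq> ?P \<and> card E = e} = N choose (N - e)"
    using n_subsets[OF finP, of e] cP binomial_symmetric[of e N] e unfolding N_def by simp
  ultimately show ?thesis unfolding h_def by simp
qed

text \<open>With \<open>binomial_ratio\<close> the count becomes n^n (1 - h/N)^m >= 1; taking
  logarithms and using ln(1 - h/N) <= -h/N gives the bound.\<close>

lemma unavoidable_edges_bound:
  assumes un: "unavoidable n e (H :: nat graph)" and e: "e \<le> n choose 2" and n: "n > 0"
  defines "m \<equiv> (n choose 2) - e"
  shows "real (card (edges H)) * real m \<le> real (n choose 2) * (real n * ln (real n))"
proof (cases "m = 0")
  case True
  thus ?thesis using n by simp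
next
  case False
  define N where "N = n choose 2"
  define h where "h = card (edges H)"
  have mN: "m \<le> N" unfolding m_def N_def by simp
  have N0: "N > 0" using mN False by simp
  have "(N choose m) * N ^ m \<le> n ^ n * ((N - h) choose m) * N ^ m"
    using binomial_le_embeddings[OF un e n] unfolding N_def m_def h_def by (rule mult_right_mono) simp
  also have "\<dots> = n ^ n * (((N - h) choose m) * N ^ m)" by (simp only: mult.assoc)
  also have "\<dots> \<le> n ^ n * ((N choose m) * (N - h) ^ m)" by (intro mult_left_mono binomial_ratio) auto
  finally have "(N choose m) * N ^ m \<le> (N choose m) * (n ^ n * (N - h) ^ m)" by (simp only: ac_simps)
  moreover have "N choose m > 0" using mN by simp
  ultimately have le: "N ^ m \<le> n ^ n * (N - h) ^ m" by simp
  have hN: "h < N"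
  proof (rule ccontr)
    assume "\<not> h < N"
    hence "N ^ m \<le> 0" using le False by (simp add: power_0_left)
    thus False using N0 by simp
  qed
  have "real (N ^ m) \<le> real (n ^ n * (N - h) ^ m)" using le by (rule of_nat_mono)
  hence "ln (real N ^ m) \<le> ln (real n ^ n * real (N - h) ^ m)" using N0 n hN by (subst ln_le_cancel_iff) auto
  hence "real m * ln (real N) \<le> real n * ln (real n) + real m * ln (real (N - h))"
    using N0 n hN by (simp add: ln_mult ln_realpow)
  moreover have "ln (real (N - h)) \<le> ln (real N) - real h / real N"
  proof -
    have "ln (real (N - h) / real N) \<le> real (N - h) / real N - 1"
      using hN N0 by (intro ln_le_minus_one) auto
    also have "\<dots> = - (real h / real N)" using hN N0 by (simp add: field_simps of_nat_diff)
    finally show ?thesis using hN N0 by (simp add: ln_div)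
  qed
  hence "real m * ln (real (N - h)) \<le> real m * (ln (real N) - real h / real N)" by (intro mult_left_mono) auto
  ultimately have "real m * (real h / real N) \<le> real n * ln (real n)" by (simp add: right_diff_distrib)
  hence "real m * real h \<le> real n * ln (real n) * real N" using N0 by (simp add: pos_divide_le_eq)
  thus ?thesis unfolding N_def h_def by (simp add: ac_simps)
qed

section \<open>Counting sparse graphs inside the complement of an unavoidable graph\<close>

lemma extend_to_bij:
  assumes "finite U" "finite W" "card U = card W" "X \<subseteq> U" "inj_on \<phi> X" "\<phi> ` X \<subseteq> W"
  obtains \<psi> where "bij_betw \<psi> U W" "\<And>x. x \<in> X \<Longrightarrow> \<psi> x = \<phi> x"
proof -
  have finX: "finite X" using assms finite_subset by blast
  have "card (U - X) = card (W - \<phi> ` X)"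
    using assms finX by (simp add: card_Diff_subset card_image)
  then obtain \<chi> where \<chi>: "bij_betw \<chi> (U - X) (W - \<phi> ` X)"
    using finite_same_card_bij[of "U - X" "W - \<phi> ` X"] assms(1,2) by auto
  define \<psi> where "\<psi> x = (if x \<in> X then \<phi> x else \<chi> x)" for x
  have "bij_betw \<psi> X (\<phi> ` X)"
    using inj_on_imp_bij_betw[OF assms(5)] by (subst bij_betw_cong[where g = \<phi>]) (auto simp: \<psi>_def)
  moreover have "bij_betw \<psi> (U - X) (W - \<phi> ` X)" using \<chi> by (subst bij_betw_cong[where g = \<chi>]) (auto simp: \<psi>_def)
  ultimately have "bij_betw \<psi> (X \<union> (U - X)) (\<phi> ` X \<union> (W - \<phi> ` X))" by (intro bij_betw_combine) auto
  moreover have "X \<union> (U - X) = U" "\<phi> ` X \<union> (W - \<phi> ` X) = W" using assms(4,6) by auto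
  ultimately have "bij_betw \<psi> U W" by simp
  thus ?thesis using that unfolding \<psi>_def by auto
qed

text \<open>A graph on \<open>{..<k}\<close> with \<open>N - e\<close> edges is determined by its image in the complement of \<open>H\<close> and by
  a map from the at most \<open>k\<close> vertices of that image to \<open>{..<k}\<close>.\<close>

lemma binomial_le_subgraphs:
  assumes un: "unavoidable n e (H :: nat graph)" and e: "e \<le> n choose 2" and k: "0 < k" "k \<le> n"
  defines "N \<equiv> n choose 2"
  shows "((k choose 2) choose (N - e)) \<le> ((N - card (edges H)) choose (N - e)) * k ^ k"
proof -
  define h m where "h = card (edges H)" and "m = N - e"
  have sg: "simple_graph H" using un unfolding unavoidable_def by simp
  hence finV: "finite (verts H)" and edH: "edges H \<subseteq> pairs (verts H)" unfolding simple_graph_def by auto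
  have cV: "card (verts H) \<le> n" by (rule unavoidable_card_verts_le[OF un e])
  \<comment> \<open>\<open>H\<close> may have fewer than \<open>n\<close> vertices; isolated ones
    are added so that its complement \<open>F\<close> is taken on exactly \<open>n\<close>.\<close>
  have "n \<le> card (verts H \<union> {..<n})" using card_mono[of "verts H \<union> {..<n}" "{..<n}"] finV by simp
  then obtain U where U: "verts H \<subseteq> U" "card U = n" "finite U"
    using exists_subset_between[of "verts H" n "verts H \<union> {..<n}"] cV finV
    by (metis Un_upper1 finite_Un finite_lessThan finite_subset)
  define F where "F = pairs U - edges H"
  have finF: "finite F" unfolding F_def using finite_pairs[OF U(3)] by simp
  have edU: "edges H \<subseteq> pairs U" using edH U(1) by auto
  have finE: "finite (edges H)" using edU finite_pairs[OF U(3)] finite_subset by blast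
  have cF: "card F = N - h"
    unfolding F_def N_def h_def using edU finE card_pairs[OF U(3)] U(2) by (simp add: card_Diff_subset)
  let ?Ms = "{M. M \<subseteq> pairs {..<k} \<and> card M = m}"
  have "\<forall>M\<in>?Ms. \<exists>\<chi>. bij_betw \<chi> {..<n} U \<and> (\<forall>d\<in>M. \<chi> ` d \<in> F)"
  proof
    fix M assume M: "M \<in> ?Ms"
    have "pairs {..<k} \<subseteq> pairs {..<n}" using k(2) by auto
    hence MP: "M \<subseteq> pairs {..<n}" using M by blast
    have finM: "finite M" using MP finite_pairs[of "{..<n}"] finite_subset by blast
    \<comment> \<open>The complement of \<open>M\<close> has \<open>e\<close> edges and so contains
      \<open>H\<close>; the inverse of the completed embedding carries \<open>M\<close> into
      \<open>F\<close>.\<close>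
    have "card (pairs {..<n} - M) = e"
      using MP M finM card_pairs[of "{..<n}"] e unfolding m_def N_def by (simp add: card_Diff_subset)
    then obtain \<phi> where \<phi>: "inj_on \<phi> (verts H)" "\<phi> ` verts H \<subseteq> {..<n}"
        "\<forall>d\<in>edges H. \<phi> ` d \<in> pairs {..<n} - M"
      using unavoidable_embeds[OF un, of "pairs {..<n} - M"] by blast
    obtain \<psi> where \<psi>: "bij_betw \<psi> U {..<n}" "\<And>x. x \<in> verts H \<Longrightarrow> \<psi> x = \<phi> x"
      using extend_to_bij[OF U(3), of "{..<n}" "verts H" \<phi>] U \<phi>(1,2) by auto
    define \<chi> where "\<chi> = inv_into U \<psi>"
    have \<chi>: "bij_betw \<chi> {..<n} U" unfolding \<chi>_def by (rule bij_betw_inv_into[OF \<psi>(1)])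
    have "\<chi> ` d \<in> F" if d: "d \<in> M" for d
    proof -
      have dn: "d \<in> pairs {..<n}" using d MP by blast
      have "\<chi> ` d \<in> pairs U" using image_pairs[of \<chi> "{..<n}" U d] \<chi> dn by (auto simp: bij_betw_def)
      moreover have "\<chi> ` d \<notin> edges H"
      proof
        assume *: "\<chi> ` d \<in> edges H"
        hence "\<chi> ` d \<subseteq> verts H" using edH by blast
        hence "\<phi> ` \<chi> ` d = \<psi> ` \<chi> ` d" by (intro image_cong refl \<psi>(2)[symmetric]) blast
        also have "\<dots> = d" using dn \<psi>(1) unfolding \<chi>_def
          by (intro image_inv_into_cancel) (auto simp: bij_betw_def)
        finally show False using \<phi>(3) * d by fastforce
      qed
      ultimately show ?thesis unfolding F_def by blast
    qed
    with \<chi> show "\<exists>\<chi>. bij_betw \<chi> {..<n} U \<and> (\<forall>d\<in>M. \<chi> ` d \<in> F)" by blast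
  qed
  from bchoice[OF this] obtain \<chi> where
    \<chi>': "\<forall>M\<in>?Ms. bij_betw (\<chi> M) {..<n} U \<and> (\<forall>d\<in>M. \<chi> M ` d \<in> F)" by blast
  have \<chi>: "bij_betw (\<chi> M) {..<n} U" "\<And>d. d \<in> M \<Longrightarrow> \<chi> M ` d \<in> F" if "M \<in> ?Ms" for M
    using bspec[OF \<chi>' that] by blast+
  define S where "S M = (\<lambda>d. \<chi> M ` d) ` M" for M
  define g where "g M = restrict (inv_into {..<n} (\<chi> M)) (\<Union>(S M))" for M
  have inj\<chi>: "inj_on (\<chi> M) {..<n}" if "M \<in> ?Ms" for M using \<chi>(1)[OF that] by (simp add: bij_betw_def)
  have Mk: "d \<subseteq> {..<k}" if "M \<in> ?Ms" "d \<in> M" for M d using that by blast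
  have recover: "(\<lambda>d. g M ` d) ` S M = M" if M: "M \<in> ?Ms" for M
  proof -
    have "g M ` \<chi> M ` d = d" if d: "d \<in> M" for d
    proof -
      have "g M ` \<chi> M ` d = inv_into {..<n} (\<chi> M) ` \<chi> M ` d"
        unfolding g_def S_def using d by (intro image_cong) auto
      also have "\<dots> = d" using inj\<chi>[OF M] Mk[OF M d] k(2)
        by (intro inv_into_image_cancel) auto
      finally show ?thesis .
    qed
    thus ?thesis unfolding S_def by (simp add: image_image)
  qed
  let ?Ss = "{S. S \<subseteq> F \<and> card S = m}"
  have finSs: "finite ?Ss" using finF by simp
  have finUS: "finite (\<Union>S)" if "S \<in> ?Ss" for S
  proof -
    have "\<Union>S \<subseteq> U" using that unfolding F_def by blast
    thus ?thesis using U(3) finite_subset by blast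
  qed
  have finSk: "finite {S \<in> ?Ss. card (\<Union>S) \<le> k}" using finSs by (rule rev_finite_subset) blast
  let ?Q = "SIGMA S:{S \<in> ?Ss. card (\<Union>S) \<le> k}. (\<Union>S) \<rightarrow>\<^sub>E {..<k}"
  have "inj_on (\<lambda>M. (S M, g M)) ?Ms"
    using recover by (intro inj_onI) (metis (no_types, lifting) prod.inject)
  moreover have "(\<lambda>M. (S M, g M)) ` ?Ms \<subseteq> ?Q"
  proof
    fix p assume "p \<in> (\<lambda>M. (S M, g M)) ` ?Ms"
    then obtain M where M: "M \<in> ?Ms" "p = (S M, g M)" by blast
    have "M \<subseteq> Pow {..<n}" using M(1) k(2) by fastforce
    hence "inj_on (\<lambda>d. \<chi> M ` d) M" by (rule inj_on_subset[OF inj_on_image_Pow[OF inj\<chi>[OF M(1)]]])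
    hence "card (S M) = m" unfolding S_def using M(1) by (simp add: card_image)
    moreover have "S M \<subseteq> F" unfolding S_def using \<chi>(2)[OF M(1)] by blast
    moreover have US: "\<Union>(S M) \<subseteq> \<chi> M ` {..<k}" unfolding S_def using Mk[OF M(1)] by blast
    hence "card (\<Union>(S M)) \<le> card (\<chi> M ` {..<k})" by (intro card_mono) auto
    hence "card (\<Union>(S M)) \<le> k" using card_image_le[of "{..<k}" "\<chi> M"] by simp
    moreover have "g M \<in> \<Union>(S M) \<rightarrow>\<^sub>E {..<k}"
    proof -
      have "inv_into {..<n} (\<chi> M) x < k" if xS: "x \<in> \<Union>(S M)" for x
      proof -
        obtain i where i: "i < k" "x = \<chi> M i" using US xS by blast
        have "inv_into {..<n} (\<chi> M) x = i" unfolding i(2) using inj\<chi>[OF M(1)] i(1) k(2) by (intro inv_into_f_f) auto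
        thus ?thesis using i(1) by simp
      qed
      thus ?thesis unfolding g_def by auto
    qed
    ultimately show "p \<in> ?Q" using M(2) by auto
  qed
  moreover have finQ: "finite ?Q" using finSk finUS by (intro finite_SigmaI finite_PiE) blast+
  ultimately have "card ?Ms \<le> card ?Q" by (rule card_inj_on_le)
  also have "\<dots> = (\<Sum>S\<in>{S \<in> ?Ss. card (\<Union>S) \<le> k}. card ((\<Union>S) \<rightarrow>\<^sub>E {..<k}))"
    using finSk finUS by (intro card_SigmaI ballI finite_PiE) blast+
  also have "\<dots> \<le> (\<Sum>S\<in>{S \<in> ?Ss. card (\<Union>S) \<le> k}. k ^ k)"
    using finUS k(1) by (intro sum_mono) (auto simp: card_PiE intro!: power_increasing)
  also have "\<dots> = card {S \<in> ?Ss. card (\<Union>S) \<le> k} * k ^ k" by simp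
  also have "\<dots> \<le> card ?Ss * k ^ k" using finSs by (intro mult_right_mono card_mono) auto
  also have "card ?Ss = (N - h) choose m" using n_subsets[OF finF, of m] cF by simp
  finally show ?thesis
    using n_subsets[OF finite_pairs[of "{..<k}"], of m] card_pairs[of "{..<k}"] unfolding m_def h_def by simp
qed

text \<open>For \<open>q \<le> K\<close> the count gives \<open>(K / q) ^ m \<le> k ^ k\<close>,
  with \<open>K\<close> and \<open>q\<close> as in the proof, and the assumption \<open>kln\<close>
  bounds \<open>k ^ k\<close> by e^m. Taking m-th roots loses the factor e.\<close>

lemma complement_edges_ge:
  assumes un: "unavoidable n e (H :: nat graph)" and e: "e \<le> n choose 2" and k: "0 < k" "k \<le> n"
  defines "m \<equiv> (n choose 2) - e"
  assumes m: "0 < m" "m \<le> k choose 2" and kln: "real k * ln (real k) \<le> real m"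
  shows "real (k choose 2) \<le> exp 1 * real ((n choose 2) - card (edges H))"
proof -
  define q where "q = (n choose 2) - card (edges H)"
  define K where "K = k choose 2"
  have K0: "K > 0" using m unfolding K_def by linarith
  show ?thesis
  proof (cases "q \<le> K")
    case True
    have "(K choose m) * K ^ m \<le> (q choose m) * k ^ k * K ^ m"
      using binomial_le_subgraphs[OF un e k] unfolding m_def q_def K_def by (rule mult_right_mono) simp
    also have "\<dots> = k ^ k * ((q choose m) * K ^ m)" by (simp only: ac_simps)
    also have "\<dots> \<le> k ^ k * ((K choose m) * q ^ m)" by (intro mult_left_mono binomial_ratio True) auto
    finally have "(K choose m) * K ^ m \<le> (K choose m) * (k ^ k * q ^ m)" by (simp only: ac_simps)
    moreover have "K choose m > 0" using m unfolding K_def by simp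
    ultimately have le: "K ^ m \<le> k ^ k * q ^ m" by simp
    have q0: "q > 0"
    proof (rule ccontr)
      assume "\<not> q > 0"
      hence "K ^ m \<le> 0" using le m(1) by (simp add: power_0_left)
      thus False using K0 by simp
    qed
    have "real (K ^ m) \<le> real (k ^ k * q ^ m)" using le by (rule of_nat_mono)
    hence "ln (real K ^ m) \<le> ln (real k ^ k * real q ^ m)" using K0 k q0 by (subst ln_le_cancel_iff) auto
    hence "real m * ln (real K) \<le> real k * ln (real k) + real m * ln (real q)"
      using K0 k q0 by (simp add: ln_mult ln_realpow)
    hence "real m * ln (real K) \<le> real m * (1 + ln (real q))" using kln by (simp add: distrib_left)
    hence "ln (real K) \<le> 1 + ln (real q)" using m(1) by simp
    also have "\<dots> = ln (exp 1 * real q)" using q0 by (simp add: ln_mult)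
    finally show ?thesis using K0 q0 unfolding K_def q_def by simp
  next
    case False
    have "real K \<le> 1 * real q" using False by simp
    also have "\<dots> \<le> exp 1 * real q" by (intro mult_right_mono) auto
    finally show ?thesis unfolding K_def q_def .
  qed
qed

lemma universal_embeds:
  assumes "universal F n m" "finite (V :: nat set)" "card V = n" "E \<subseteq> pairs V" "card E \<le> m"
  shows "\<exists>\<psi>. bij_betw \<psi> V {..<n} \<and> (\<forall>d\<in>E. \<psi> ` d \<in> F)"
  using assms unfolding universal_def by simp

section \<open>Unavoidable graphs from universal graphs\<close>

lemma pull_back_complement:
  assumes "bij_betw \<psi> V {..<n}" "\<forall>d\<in>M. \<psi> ` d \<in> F" "d \<in> pairs {..<n} - F"
  shows "inv_into V \<psi> ` d \<in> pairs V - M"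
proof
  have inv: "bij_betw (inv_into V \<psi>) {..<n} V" by (rule bij_betw_inv_into[OF assms(1)])
  thus "inv_into V \<psi> ` d \<in> pairs V"
    using image_pairs[of "inv_into V \<psi>" "{..<n}" V d] assms(3) by (auto simp: bij_betw_def)
  have "\<psi> ` inv_into V \<psi> ` d = d"
    using assms(1,3) by (intro image_inv_into_cancel) (auto simp: bij_betw_def)
  thus "inv_into V \<psi> ` d \<notin> M" using assms(2,3) by force
qed

lemma card_non_edges:
  assumes "simple_graph (G :: 'a graph)" "card (verts G) = n" "card (edges G) = e"
  shows "card (pairs (verts G) - edges G) = (n choose 2) - e"
proof -
  have "edges G \<subseteq> pairs (verts G)" "finite (verts G)" using assms(1) unfolding simple_graph_def by auto
  moreover have "finite (edges G)" by (rule simple_graph_finite_edges[OF assms(1)])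
  ultimately show ?thesis using card_pairs[of "verts G"] assms by (simp add: card_Diff_subset)
qed

lemma unavoidable_of_universal:
  assumes F: "universal F n m" and m: "m = (n choose 2) - e"
  shows "unavoidable n e ({..<n}, pairs {..<n} - F)"
  unfolding unavoidable_def
proof (intro conjI allI impI)
  show "simple_graph ({..<n}, pairs {..<n} - F)" unfolding simple_graph_def by auto
  fix G :: "nat graph"
  assume G: "simple_graph G \<and> card (verts G) = n \<and> card (edges G) = e"
  define V M where "V = verts G" and "M = pairs V - edges G"
  have V: "finite V" "card V = n" and EG: "edges G \<subseteq> pairs V" using G unfolding V_def simple_graph_def by auto
  have "card M = m" unfolding M_def V_def m using card_non_edges G by blast
  then obtain \<psi> where \<psi>: "bij_betw \<psi> V {..<n}" "\<forall>d\<in>M. \<psi> ` d \<in> F"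
    using universal_embeds[OF F V, of M] unfolding M_def by auto
  have inv: "bij_betw (inv_into V \<psi>) {..<n} V" by (rule bij_betw_inv_into[OF \<psi>(1)])
  have "inv_into V \<psi> ` d \<in> edges G" if "d \<in> pairs {..<n} - F" for d
    using pull_back_complement[OF \<psi> that] unfolding M_def by blast
  thus "contains_copy G ({..<n}, pairs {..<n} - F)"
    unfolding contains_copy_def using inv V_def by (intro exI[of _ "inv_into V \<psi>"]) (auto simp: bij_betw_def)
qed

lemma card_complement_universal:
  assumes "universal F n m"
  shows "card (pairs {..<n} - F) = (n choose 2) - card F" "card F \<le> n choose 2"
proof -
  have F: "F \<subseteq> pairs {..<n}" using assms unfolding universal_def by blast
  have fin: "finite (pairs {..<n})" by (rule finite_pairs) simp
  show "card (pairs {..<n} - F) = (n choose 2) - card F"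
    using F finite_subset[OF F fin] card_pairs[of "{..<n}"] by (simp add: card_Diff_subset)
  show "card F \<le> n choose 2" using card_mono[OF fin F] card_pairs[of "{..<n}"] by simp
qed

section \<open>Disjoint sparse blocks for the dense range\<close>

text \<open>Greedy selection: before each choice at least half of the vertices are free, and even if
  all edges lie among them, some free \<open>n0\<close>-set spans at most m (2 n0/n)^2 edges. This
  is the origin of the factor 4.\<close>

lemma disjoint_sparse_sets:
  assumes V: "finite V" "card V = n" and M: "M \<subseteq> pairs V" "card M \<le> m"
    and n: "n \<ge> 4" "2 * (k * n0) \<le> n" and m: "4 * m * (n0 * n0) \<le> m0 * (n * n)"
  shows "\<exists>S. disjoint_family_on S {..<k} \<and> (\<forall>j<k. S j \<subseteq> V \<and> card (S j) = n0 \<and> card (M \<inter> Pow (S j)) \<le> m0)"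
  using n(2)
proof (induction k)
  case 0
  show ?case by (simp add: disjoint_family_on_def)
next
  case (Suc k)
  then obtain S where S: "disjoint_family_on S {..<k}"
      "\<forall>j<k. S j \<subseteq> V \<and> card (S j) = n0 \<and> card (M \<inter> Pow (S j)) \<le> m0" by auto
  define W where "W = (\<Union>j<k. S j)"
  have WV: "W \<subseteq> V" unfolding W_def using S(2) by blast
  have finW: "finite W" using WV V(1) finite_subset by blast
  have "card W \<le> (\<Sum>j<k. card (S j))" unfolding W_def by (rule card_UN_le) simp
  also have "\<dots> = k * n0" using S(2) by simp
  finally have cW: "card W \<le> k * n0" .
  define a where "a = card (V - W)"
  have a: "a = n - card W" unfolding a_def using WV finW V by (simp add: card_Diff_subset)
  have "2 * (k * n0) + 2 * n0 \<le> n" using Suc.prems by simp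
  hence n0a: "n0 \<le> a" and an: "n \<le> 2 * a" and a2: "a \<ge> 2" using cW a n(1) by linarith+
  define M' where "M' = M \<inter> Pow (V - W)"
  have finM: "finite M" using M(1) finite_pairs[OF V(1)] finite_subset by blast
  have M'P: "M' \<subseteq> pairs (V - W)" unfolding M'_def using M(1) by blast
  have "card M' \<le> card M" unfolding M'_def using finM by (intro card_mono) auto
  hence cM': "card M' \<le> m" using M(2) by simp
  obtain T where T: "T \<subseteq> V - W" "card T = n0"
      "card (M' \<inter> Pow T) * (a * (a - 1)) \<le> card M' * (n0 * (n0 - 1))"
    using sparse_subset[OF _ M'P, of n0] n0a V(1) unfolding a_def by auto
  define t where "t = card (M' \<inter> Pow T)"
  \<comment> \<open>As \<open>n0 \<le> a\<close>, this replaces the ratio (n0-1)/(a-1) by n0/a and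
    turns the falling products into squares.\<close>
  have "(n0 - 1) * a \<le> n0 * (a - 1)" using n0a by (simp add: diff_mult_distrib diff_mult_distrib2)
  have "(a - 1) * (t * (a * a)) = t * (a * (a - 1)) * a" by (simp only: ac_simps)
  also have "\<dots> \<le> m * (n0 * (n0 - 1)) * a"
    using T(3) cM' unfolding t_def by (meson le_trans mult_le_mono1)
  also have "\<dots> = m * n0 * ((n0 - 1) * a)" by (simp only: ac_simps)
  also have "\<dots> \<le> m * n0 * (n0 * (a - 1))"
    using \<open>(n0 - 1) * a \<le> n0 * (a - 1)\<close> by (rule mult_left_mono) simp
  also have "\<dots> = (a - 1) * (m * (n0 * n0))" by (simp only: ac_simps)
  finally have "t * (a * a) \<le> m * (n0 * n0)" using a2 by simp
  hence "4 * (t * (a * a)) \<le> m0 * (n * n)" using m by simp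
  moreover have "n * n \<le> (2 * a) * (2 * a)" using an by (intro mult_mono) auto
  hence "t * (n * n) \<le> t * ((2 * a) * (2 * a))" by (rule mult_left_mono) simp
  moreover have "t * ((2 * a) * (2 * a)) = 4 * (t * (a * a))" by simp
  ultimately have "t * (n * n) \<le> m0 * (n * n)" by linarith
  hence t: "t \<le> m0" using n(1) by simp
  have eq: "M' \<inter> Pow T = M \<inter> Pow T" unfolding M'_def using T(1) by blast
  define S' where "S' = S(k := T)"
  have SW: "S i \<subseteq> W" if "i < k" for i unfolding W_def using that by blast
  have "disjoint_family_on S' {..<Suc k}"
    unfolding disjoint_family_on_def
  proof (intro ballI impI)
    fix i j assume ij: "i \<in> {..<Suc k}" "j \<in> {..<Suc k}" "i \<noteq> j"
    then consider "i < k" "j < k" | "i = k" "j < k" | "i < k" "j = k" by (auto simp: less_Suc_eq)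
    thus "S' i \<inter> S' j = {}"
    proof cases
      case 1
      thus ?thesis using S(1) ij(3) unfolding S'_def disjoint_family_on_def by simp
    next
      case 2
      thus ?thesis using SW[of j] T(1) unfolding S'_def by auto
    next
      case 3
      thus ?thesis using SW[of i] T(1) unfolding S'_def by auto
    qed
  qed
  moreover have "\<forall>j<Suc k. S' j \<subseteq> V \<and> card (S' j) = n0 \<and> card (M \<inter> Pow (S' j)) \<le> m0"
    using S(2) T(1,2) t unfolding S'_def t_def eq by (auto simp: less_Suc_eq)
  ultimately show ?case by blast
qed

text \<open>Each block of \<open>H\<close> is the complement of \<open>F\<close> and goes to its own
  sparse set, whose non-edges embed into \<open>F\<close>. \<open>H\<close> has no edges between
  blocks, so the sparse sets only have to be disjoint.\<close>

lemma unavoidable_disjoint_copies: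
  assumes F: "universal F n0 m0" and m: "m = (n choose 2) - e"
    and n: "n \<ge> 4" "2 * (k * n0) \<le> n" and m0: "4 * m * (n0 * n0) \<le> m0 * (n * n)" and n0: "n0 > 0"
  shows "\<exists>H :: nat graph. unavoidable n e H \<and> card (edges H) = k * ((n0 choose 2) - card F)"
proof -
  define sh where "sh j x = j * n0 + x" for j x
  define B where "B = pairs {..<n0} - F"
  define H :: "nat graph" where "H = ({..<k * n0}, \<Union>j<k. (\<lambda>d. sh j ` d) ` B)"
  have sh_inj: "inj_on (sh j) A" for j A unfolding sh_def by (auto simp: inj_on_def)
  have sh_div: "sh j x div n0 = j" "sh j x mod n0 = x" if "x < n0" for j x unfolding sh_def using that by auto
  have sh_lt: "sh j x < k * n0" if "j < k" "x < n0" for j x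
  proof -
    have "sh j x < Suc j * n0" unfolding sh_def using that(2) by simp
    also have "\<dots> \<le> k * n0" using that(1) by (intro mult_right_mono) auto
    finally show ?thesis .
  qed
  have finB: "finite B" unfolding B_def using finite_pairs[of "{..<n0}"] by simp
  have B2: "d \<subseteq> {..<n0}" "card d = 2" if "d \<in> B" for d using that unfolding B_def by auto
  have sg: "simple_graph H"
  proof -
    have "sh j ` d \<subseteq> {..<k * n0} \<and> card (sh j ` d) = 2" if "j < k" "d \<in> B" for j d
      using B2[OF that(2)] sh_lt[OF that(1)] card_image[OF sh_inj] by auto
    thus ?thesis unfolding simple_graph_def H_def by auto
  qed
  have cH: "card (edges H) = k * ((n0 choose 2) - card F)"
  proof -
    have "card (edges H) = (\<Sum>j<k. card ((\<lambda>d. sh j ` d) ` B))"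
      unfolding H_def snd_conv
    proof (rule card_UN_disjoint)
      show "\<forall>i\<in>{..<k}. \<forall>j\<in>{..<k}. i \<noteq> j \<longrightarrow> (\<lambda>d. sh i ` d) ` B \<inter> (\<lambda>d. sh j ` d) ` B = {}"
      proof (intro ballI impI equals0I)
        fix i j D assume ij: "i \<noteq> j" and "D \<in> (\<lambda>d. sh i ` d) ` B \<inter> (\<lambda>d. sh j ` d) ` B"
        then obtain d d' where D: "D = sh i ` d" "d \<in> B" "D = sh j ` d'" "d' \<in> B" by blast
        have "d \<noteq> {}" using B2(2)[OF D(2)] by auto
        then obtain x where x: "x \<in> d" by blast
        then obtain y where y: "y \<in> d'" "sh i x = sh j y" using D by blast
        have "x < n0" "y < n0" using x y B2(1) D by auto
        hence "i = j" using sh_div(1)[of x i] sh_div(1)[of y j] y(2) by simp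
        thus False using ij by simp
      qed
    qed (use finB in auto)
    also have "\<dots> = (\<Sum>j<k. card B)"
    proof (intro sum.cong refl card_image)
      fix j
      show "inj_on (\<lambda>d. sh j ` d) B"
        by (rule inj_on_subset[OF inj_on_image_Pow[OF sh_inj[of j UNIV]]]) simp
    qed
    finally show ?thesis using card_complement_universal(1)[OF F] unfolding B_def by simp
  qed
  have "unavoidable n e H"
    unfolding unavoidable_def
  proof (intro conjI allI impI sg)
    fix G :: "nat graph"
    assume G: "simple_graph G \<and> card (verts G) = n \<and> card (edges G) = e"
    define V M where "V = verts G" and "M = pairs V - edges G"
    have V: "finite V" "card V = n" using G unfolding V_def simple_graph_def by auto
    have "card M = m" unfolding M_def V_def m using card_non_edges G by blast
    hence cM: "card M \<le> m" by simp
    have MP: "M \<subseteq> pairs V" unfolding M_def by blast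
    obtain S where S: "disjoint_family_on S {..<k}"
        "\<forall>j<k. S j \<subseteq> V \<and> card (S j) = n0 \<and> card (M \<inter> Pow (S j)) \<le> m0"
      using disjoint_sparse_sets[OF V MP cM n m0] by blast
    have "\<forall>j\<in>{..<k}. \<exists>\<psi>. bij_betw \<psi> (S j) {..<n0} \<and> (\<forall>d\<in>M \<inter> Pow (S j). \<psi> ` d \<in> F)"
    proof
      fix j assume "j \<in> {..<k}"
      hence Sj: "S j \<subseteq> V" "card (S j) = n0" "card (M \<inter> Pow (S j)) \<le> m0" using S(2) by auto
      moreover have "finite (S j)" using Sj(1) V(1) finite_subset by blast
      moreover have "M \<inter> Pow (S j) \<subseteq> pairs (S j)" unfolding M_def by blast
      ultimately show "\<exists>\<psi>. bij_betw \<psi> (S j) {..<n0} \<and> (\<forall>d\<in>M \<inter> Pow (S j). \<psi> ` d \<in> F)"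
        using F unfolding universal_def by blast
    qed
    from bchoice[OF this] obtain \<psi> where
      \<psi>': "\<forall>j\<in>{..<k}. bij_betw (\<psi> j) (S j) {..<n0} \<and> (\<forall>d\<in>M \<inter> Pow (S j). \<psi> j ` d \<in> F)" by blast
    have \<psi>: "bij_betw (\<psi> j) (S j) {..<n0}" "\<forall>d\<in>M \<inter> Pow (S j). \<psi> j ` d \<in> F" if "j < k" for j
      using \<psi>' that by auto
    \<comment> \<open>Quotient and remainder by \<open>n0\<close> recover the block and the position
      within it that \<open>sh\<close> encodes.\<close>
    define \<phi> where "\<phi> z = inv_into (S (z div n0)) (\<psi> (z div n0)) (z mod n0)" for z
    have \<phi>sh: "\<phi> (sh j x) = inv_into (S j) (\<psi> j) x" if "x < n0" for j x
      unfolding \<phi>_def using sh_div[OF that] by simp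
    have inv: "bij_betw (inv_into (S j) (\<psi> j)) {..<n0} (S j)" if "j < k" for j
      by (rule bij_betw_inv_into[OF \<psi>(1)[OF that]])
    have blk: "z div n0 < k" "z mod n0 < n0" if "z < k * n0" for z
      using that n0 by (auto simp: less_mult_imp_div_less)
    have \<phi>S: "\<phi> z \<in> S (z div n0)" if "z < k * n0" for z
      unfolding \<phi>_def using inv[OF blk(1)[OF that]] blk(2)[OF that] by (auto simp: bij_betw_def)
    have "inj_on \<phi> (verts H)"
      unfolding H_def fst_conv
    proof (rule inj_onI)
      fix y z assume yz: "y \<in> {..<k * n0}" "z \<in> {..<k * n0}" "\<phi> y = \<phi> z"
      hence lt: "y < k * n0" "z < k * n0" by auto
      have eq: "y div n0 = z div n0"
      proof (rule ccontr)
        assume "y div n0 \<noteq> z div n0"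
        hence "S (y div n0) \<inter> S (z div n0) = {}"
          using S(1) blk(1)[OF lt(1)] blk(1)[OF lt(2)] unfolding disjoint_family_on_def by simp
        thus False using \<phi>S[OF lt(1)] \<phi>S[OF lt(2)] yz(3) by auto
      qed
      have inj: "inj_on (inv_into (S (z div n0)) (\<psi> (z div n0))) {..<n0}"
        using inv[OF blk(1)[OF lt(2)]] by (rule bij_betw_imp_inj_on)
      have "y mod n0 = z mod n0"
        by (rule inj_onD[OF inj]) (use yz(3) eq blk(2)[OF lt(1)] blk(2)[OF lt(2)] in \<open>auto simp: \<phi>_def\<close>)
      with eq show "y = z" by (metis div_mult_mod_eq)
    qed
    moreover have "\<phi> ` verts H \<subseteq> verts G"
      using \<phi>S S(2) blk(1) unfolding H_def V_def by fastforce
    moreover have "\<phi> ` D \<in> edges G" if DH: "D \<in> edges H" for D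
    proof -
      have "D \<in> (\<Union>j<k. (\<lambda>d. sh j ` d) ` B)" using DH unfolding H_def by simp
      then obtain j d where D: "j < k" "d \<in> B" "D = sh j ` d" by blast
      have "\<phi> ` D = inv_into (S j) (\<psi> j) ` d"
        unfolding D(3) image_image using \<phi>sh B2(1)[OF D(2)] by (intro image_cong) auto
      moreover have "inv_into (S j) (\<psi> j) ` d \<in> pairs (S j) - M \<inter> Pow (S j)"
        using D(2) unfolding B_def by (intro pull_back_complement[OF \<psi>[OF D(1)]])
      moreover have "S j \<subseteq> V" using S(2) D(1) by blast
      ultimately show ?thesis unfolding M_def by auto
    qed
    ultimately show "contains_copy G H" unfolding contains_copy_def by blast
  qed
  with cH show ?thesis by blast
qed

lemma unavoidable_card_edges_le:
  assumes un: "unavoidable n e (H :: nat graph)" and e: "e \<le> n choose 2"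
  shows "card (edges H) \<le> e"
proof -
  obtain E where E: "E \<subseteq> pairs {..<n}" "card E = e"
    using obtain_subset_with_card_n[of e "pairs {..<n}"] e card_pairs[of "{..<n}"] by auto
  have G: "simple_graph ({..<n}, E)" unfolding simple_graph_def using E(1) by simp
  moreover have "simple_graph H" "contains_copy ({..<n}, E) H"
    using un E G unfolding unavoidable_def by auto
  ultimately show ?thesis using contains_copy_card_edges_le E(2) by fastforce
qed

section \<open>Asymptotic bounds in the two ranges\<close>

lemma real_choose_two: "real (k choose 2) = real k * (real k - 1) / 2"
  by (induction k) (auto simp: numeral_2_eq_2 field_simps)

text \<open>The choice k = m/ln m ensures k ln k <= m, and \<open>complement_edges_ge\<close> then
  leaves about m^2/(2e ln^2 m) pairs outside \<open>H\<close>. Below the threshold \<open>m1\<close>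
  the trivial bound \<open>e\<close> on the edges of \<open>H\<close> suffices, at the price of a
  smaller constant.\<close>

lemma max_unavoidable_le_sparse:
  "\<exists>c>0. \<forall>n>1. \<forall>e m. e \<le> n choose 2 \<and> m = (n choose 2) - e \<and> 2 \<le> m \<and> real m \<le> real n * ln (real n) \<longrightarrow>
    real (max_unavoidable n e) \<le> real (n choose 2) - c * (real m ^ 2 / ln (real m) ^ 2)"
proof -
  have "eventually (\<lambda>x::real. ln x \<ge> 1 \<and> (x / ln x - 1) * (x / ln x - 2) / 2 \<ge> x \<and>
      (x / ln x - 1) * (x / ln x - 2) / 2 \<ge> x ^ 2 / ln x ^ 2 / 4 \<and> x / ln x \<ge> 2) at_top"
    by (intro eventually_conj; real_asymp)
  from eventually_compose_filterlim[OF this filterlim_real_sequentially]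
  obtain m1 where m1: "\<And>m. m \<ge> m1 \<Longrightarrow> ln (real m) \<ge> 1 \<and> (real m / ln (real m) - 1) * (real m / ln (real m) - 2) / 2 \<ge> real m \<and>
      (real m / ln (real m) - 1) * (real m / ln (real m) - 2) / 2 \<ge> real m ^ 2 / ln (real m) ^ 2 / 4 \<and> real m / ln (real m) \<ge> 2"
    unfolding eventually_sequentially by blast
  \<comment> \<open>With Q = m^2/ln^2 m, the value 1/12 combines the bound Q/4 for
    \<open>k choose 2\<close> with e <= 3. The other term gives \<open>c * Q \<le> m\<close> for m <
    m1, as Q is at most m^2/ln^2 2.\<close>
  define c where "c = min (1 / 12) (ln 2 ^ 2 / (real m1 + 1))"
  have c0: "c > 0" unfolding c_def by simp
  have "real (max_unavoidable n e) \<le> real (n choose 2) - c * (real m ^ 2 / ln (real m) ^ 2)"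
    if n: "n > 1" and e: "e \<le> n choose 2" "m = (n choose 2) - e" and m: "2 \<le> m" "real m \<le> real n * ln (real n)" for n e m
  proof -
    obtain H :: "nat graph" where H: "unavoidable n e H" "max_unavoidable n e = card (edges H)"
      using max_unavoidable_attained[OF e(1)] .
    have he: "card (edges H) \<le> e" by (rule unavoidable_card_edges_le[OF H(1) e(1)])
    define Q where "Q = real m ^ 2 / ln (real m) ^ 2"
    have Q0: "Q \<ge> 0" unfolding Q_def by simp
    have "c * Q \<le> real ((n choose 2) - card (edges H))"
    proof (cases "m \<ge> m1")
      case True
      note p = m1[OF True]
      define k where "k = nat \<lfloor>real m / ln (real m)\<rfloor>"
      have kB: "real m / ln (real m) - 1 \<le> real k" "real k \<le> real m / ln (real m)"
        unfolding k_def using p by linarith+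
      have k2: "k \<ge> 1" using kB p by linarith
      have "(real m / ln (real m) - 1) * (real m / ln (real m) - 2) / 2 \<le> real k * (real k - 1) / 2"
        using kB p k2 by (intro divide_right_mono mult_mono) auto
      also have "\<dots> = real (k choose 2)" by (simp add: real_choose_two)
      finally have kc: "(real m / ln (real m) - 1) * (real m / ln (real m) - 2) / 2 \<le> real (k choose 2)" .
      have km: "real k \<le> real m"
      proof -
        have "real m / ln (real m) \<le> real m / 1" using p by (intro divide_left_mono) auto
        thus ?thesis using kB(2) by simp
      qed
      \<comment> \<open>For m >= n the range condition m <= n ln n gives m/ln m <= n, since ln n <=
        ln m; for m < n already \<open>k \<le> m\<close> suffices.\<close>
      have kn: "k \<le> n"
      proof (cases "m \<ge> n")
        case True
        hence "ln (real n) \<le> ln (real m)" using n by simp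
        hence "real n * ln (real n) \<le> real n * ln (real m)" by (intro mult_left_mono) auto
        hence "real m \<le> real n * ln (real m)" using m(2) by linarith
        hence "real m / ln (real m) \<le> real n" using p by (simp add: pos_divide_le_eq)
        thus ?thesis using kB(2) by linarith
      qed (use km in linarith)
      have "real (k choose 2) \<le> exp 1 * real ((n choose 2) - card (edges H))"
      proof (rule complement_edges_ge[OF H(1) e(1) _ kn])
        show "(n choose 2) - e \<le> k choose 2" using kc p e(2) by linarith
        have "real k * ln (real k) \<le> real m / ln (real m) * ln (real m)"
          using kB(2) km k2 by (intro mult_mono) auto
        thus "real k * ln (real k) \<le> real ((n choose 2) - e)" using p e(2) by simp
      qed (use k2 m(1) e(2) in auto)
      also have "\<dots> \<le> 3 * real ((n choose 2) - card (edges H))" using exp_le by (intro mult_right_mono) auto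
      finally have "Q / 4 \<le> 3 * real ((n choose 2) - card (edges H))" using kc p unfolding Q_def by linarith
      moreover have "c \<le> 1 / 12" unfolding c_def by (rule min.cobounded1)
      hence "c * Q \<le> 1 / 12 * Q" using Q0 by (rule mult_right_mono)
      ultimately show ?thesis by linarith
    next
      case False
      have "ln 2 ^ 2 \<le> ln (real m) ^ 2" using m(1) by (intro power_mono) auto
      hence "Q \<le> real m ^ 2 / ln 2 ^ 2" unfolding Q_def using m(1) by (intro divide_left_mono) auto
      hence "c * Q \<le> (ln 2 ^ 2 / (real m1 + 1)) * (real m ^ 2 / ln 2 ^ 2)"
        using Q0 by (intro mult_mono) (auto simp: c_def)
      also have "\<dots> = real m * (real m / (real m1 + 1))" by (simp add: power2_eq_square)
      also have "\<dots> \<le> real m * 1" using False by (intro mult_left_mono) auto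
      also have "real m * 1 \<le> real ((n choose 2) - card (edges H))" using he e by simp
      finally show ?thesis .
    qed
    thus ?thesis unfolding H(2) Q_def using he e(1) by (simp add: of_nat_diff)
  qed
  with c0 show ?thesis by blast
qed

lemma max_unavoidable_ge_sparse:
  "\<exists>C>0. \<forall>\<^sub>F n in sequentially. \<forall>e m. e \<le> n choose 2 \<and> m = (n choose 2) - e \<and> 2 \<le> m \<longrightarrow>
    real (n choose 2) - C * (real m ^ 2 / ln (real m) ^ 2) \<le> real (max_unavoidable n e)"
proof -
  obtain C0 m0 where C0: "C0 > 0" "\<And>m n. m \<ge> m0 \<Longrightarrow> \<exists>F. universal F n m \<and> real (card F) \<le> C0 * (real m ^ 2 / ln (real m) ^ 2)"
    using sparse_universal by blast
  \<comment> \<open>The second term pays for m < m0, where the complete graph on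
    \<open>2 * m\<close> vertices serves as universal graph and has at most 4m^2 edges.\<close>
  define C where "C = max C0 (4 * ln (real m0 + 2) ^ 2)"
  have "real (n choose 2) - C * (real m ^ 2 / ln (real m) ^ 2) \<le> real (max_unavoidable n e)"
    if n: "n \<ge> 2 * m0" and e: "e \<le> n choose 2" "m = (n choose 2) - e" and m: "2 \<le> m" for n e m
  proof -
    define Q where "Q = real m ^ 2 / ln (real m) ^ 2"
    have Q0: "Q \<ge> 0" unfolding Q_def by simp
    have "\<exists>F. universal F n m \<and> real (card F) \<le> C * Q"
    proof (cases "m \<ge> m0")
      case True
      have "C0 * Q \<le> C * Q" unfolding C_def using Q0 by (intro mult_right_mono) auto
      thus ?thesis using C0(2)[OF True, of n] unfolding Q_def by (meson order_trans)
    next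
      case False
      define F :: "nat set set" where "F = pairs {..<2 * m}"
      have "universal F n m"
        unfolding F_def by (rule universal_extend[OF universal_complete]) (use False n in simp)
      moreover have "real (card F) \<le> C * Q"
      proof -
        have "card F = (2 * m) * (2 * m - 1) div 2" unfolding F_def using card_pairs[of "{..<2 * m}"] by (simp add: choose_two)
        also have "\<dots> \<le> (2 * m) * (2 * m - 1)" by (rule div_le_dividend)
        also have "\<dots> \<le> (2 * m) * (2 * m)" by (intro mult_left_mono) auto
        finally have "real (card F) \<le> real ((2 * m) * (2 * m))" by (rule of_nat_mono)
        hence "real (card F) \<le> 4 * real m ^ 2" by (simp add: power2_eq_square)
        also have "\<dots> = 4 * ln (real m) ^ 2 * Q" unfolding Q_def using m by simp
        also have "\<dots> \<le> C * Q"
        proof (rule mult_right_mono[OF _ Q0])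
          have "ln (real m) ^ 2 \<le> ln (real m0 + 2) ^ 2" using m False by (intro power_mono) auto
          thus "4 * ln (real m) ^ 2 \<le> C" unfolding C_def by simp
        qed
        finally show ?thesis .
      qed
      ultimately show ?thesis by blast
    qed
    then obtain F where F: "universal F n m" "real (card F) \<le> C * Q" by blast
    have "card (edges ({..<n}, pairs {..<n} - F)) \<le> max_unavoidable n e"
      by (rule max_unavoidable_ge[OF unavoidable_of_universal[OF F(1) e(2)] e(1)])
    hence "real (card (pairs {..<n} - F)) \<le> real (max_unavoidable n e)" by simp
    thus ?thesis using F(2) card_complement_universal[OF F(1)] unfolding Q_def by (simp add: of_nat_diff)
  qed
  moreover have "C > 0" unfolding C_def using C0(1) by simp
  ultimately show ?thesis unfolding eventually_sequentially by blast
qed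

text \<open>At block size n0 of order n^2 ln n / m a block spans O(n0 ln n0) non-edges, few enough
  for the complement of a universal graph to keep a constant fraction of its pairs. The bound m <
  n^(3/2) keeps \<open>n0\<close> above n^(1/4), so that ln n0 and ln n are comparable.\<close>

lemma max_unavoidable_ge_dense:
  "\<exists>c>0. \<forall>\<^sub>F n in sequentially. \<forall>e m. e \<le> n choose 2 \<and> m = (n choose 2) - e \<and>
      real n * ln (real n) < real m \<and> real m < real n powr (3 / 2) \<longrightarrow>
    c * (real n ^ 3 * ln (real n) / real m) \<le> real (max_unavoidable n e)"
proof -
  obtain C m1 where C: "C > 0" "\<And>m n. m \<ge> m1 \<Longrightarrow> \<exists>F. universal F n m \<and> real (card F) \<le> C * (real m ^ 2 / ln (real m) ^ 2)"
    using sparse_universal by blast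
  \<comment> \<open>With m0 close to \<delta> n0 ln n0 the universal graph has at most C \<delta>^2
    n0^2 = n0^2/8 edges, half of the lower bound n0^2/4 used for the number of pairs.\<close>
  define \<delta> where "\<delta> = 1 / sqrt (8 * C)"
  have \<delta>: "\<delta> > 0" "C * \<delta> ^ 2 = 1 / 8" unfolding \<delta>_def using C(1) by (auto simp: power_divide)
  \<comment> \<open>Large enough that 4m (n0/n)^2, which is at most (4/A) n0 ln n, does not exceed
    half of \<delta> n0 ln n0. The summand 4 ensures \<open>y \<le> x / 4\<close> below.\<close>
  define A where "A = 32 / \<delta> + 4"
  have A: "A > 4" "4 / A \<le> \<delta> / 8"
  proof -
    show "A > 4" unfolding A_def using \<delta>(1) by simp
    have "32 \<le> \<delta> * A" unfolding A_def using \<delta>(1) by (simp add: distrib_left)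
    thus "4 / A \<le> \<delta> / 8" using \<open>A > 4\<close> by (simp add: field_simps)
  qed
  \<comment> \<open>At least n/(4 n0) blocks with n0^2/8 edges each give n n0/32 edges, and n0 is at
    least half of n^2 ln n/(A m).\<close>
  define c where "c = 1 / (64 * A)"
  have c0: "c > 0" unfolding c_def using A(1) by simp
  have "eventually (\<lambda>x::real. x \<ge> 4 \<and> ln x \<ge> 1 \<and> x powr (1/2) * ln x / A \<ge> x powr (1/4) + 2 \<and>
      \<delta> * (ln x / 4) \<ge> 2 \<and> x powr (1/4) \<ge> real m1 + 2) at_top"
    using A(1) \<delta>(1) by (intro eventually_conj; real_asymp)
  from eventually_compose_filterlim[OF this filterlim_real_sequentially]
  have "\<forall>\<^sub>F n in sequentially. \<forall>e m. e \<le> n choose 2 \<and> m = (n choose 2) - e \<and>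
      real n * ln (real n) < real m \<and> real m < real n powr (3 / 2) \<longrightarrow>
    c * (real n ^ 3 * ln (real n) / real m) \<le> real (max_unavoidable n e)"
  proof (rule eventually_mono, intro allI impI)
    fix n e m
    assume p: "real n \<ge> 4 \<and> ln (real n) \<ge> 1 \<and> real n powr (1/2) * ln (real n) / A \<ge> real n powr (1/4) + 2 \<and>
      \<delta> * (ln (real n) / 4) \<ge> 2 \<and> real n powr (1/4) \<ge> real m1 + 2"
    assume em: "e \<le> n choose 2 \<and> m = (n choose 2) - e \<and> real n * ln (real n) < real m \<and> real m < real n powr (3 / 2)"
    define x where "x = real n"
    have x: "x \<ge> 4" "ln x \<ge> 1" using p unfolding x_def by auto
    have m0: "real m > 0" using em x unfolding x_def by (smt (verit) mult_pos_pos)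
    have xm: "x * ln x < real m" "real m < x powr (3/2)" using em unfolding x_def by auto
    define y where "y = x ^ 2 * ln x / (A * real m)"
    have yn: "y \<le> x / 4"
    proof -
      have "y \<le> x ^ 2 * ln x / (4 * (x * ln x))"
        unfolding y_def using A(1) xm(1) x m0 by (intro divide_left_mono mult_mono mult_pos_pos) auto
      also have "\<dots> = x / 4" using x by (simp add: power2_eq_square)
      finally show ?thesis .
    qed
    have ylow: "x powr (1/4) + 2 \<le> y"
    proof -
      have "x powr (1/2) * x powr (3/2) = x ^ 2"
        using x by (simp add: powr_add[symmetric] powr_numeral)
      hence "x powr (1/2) * ln x / A = x ^ 2 * ln x / (A * x powr (3/2))"
        using x A(1) by (simp add: field_simps)
      also have "\<dots> \<le> y" unfolding y_def using A(1) xm(2) x m0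
        by (intro divide_left_mono mult_left_mono mult_pos_pos) auto
      finally show ?thesis using p unfolding x_def by linarith
    qed
    define n0 where "n0 = nat \<lfloor>y\<rfloor>"
    have y2: "y \<ge> 2" using ylow powr_ge_zero[of x "1/4"] by linarith
    have n0y: "real n0 \<le> y" "y - 1 \<le> real n0" unfolding n0_def using y2 by linarith+
    hence n0h: "y / 2 \<le> real n0" using y2 by linarith
    have n0q: "x powr (1/4) \<le> real n0" using ylow n0y(2) by linarith
    have n0m1: "real m1 + 2 \<le> real n0" using n0q p unfolding x_def by linarith
    have lnn0: "ln x / 4 \<le> ln (real n0)"
    proof -
      have "0 < x powr (1/4)" using x by simp
      hence "ln (x powr (1/4)) \<le> ln (real n0)" using n0q by (meson ln_le_cancel_iff less_le_trans)
      thus ?thesis using x by (simp add: ln_powr)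
    qed
    have "2 \<le> \<delta> * (ln x / 4)" using p unfolding x_def by simp
    also have "\<dots> \<le> \<delta> * ln (real n0)" using lnn0 \<delta>(1) by (intro mult_left_mono) auto
    finally have \<delta>n0: "2 \<le> \<delta> * ln (real n0)" .
    define m0 where "m0 = nat \<lfloor>\<delta> * real n0 * ln (real n0)\<rfloor>"
    define w where "w = \<delta> * real n0 * ln (real n0)"
    have "real n0 * 2 \<le> real n0 * (\<delta> * ln (real n0))" using \<delta>n0 by (rule mult_left_mono) simp
    hence w2: "2 * real n0 \<le> w" unfolding w_def by (simp add: ac_simps)
    have m0w: "real m0 \<le> w" "w - 1 \<le> real m0"
      unfolding m0_def w_def[symmetric] using w2 by linarith+
    have m0h: "w / 2 \<le> real m0" using m0w(2) w2 n0m1 by linarith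
    have m0n0: "real n0 \<le> real m0" using m0h w2 by linarith
    have "m0 \<ge> m1" using m0n0 n0m1 by linarith
    then obtain F where F: "universal F n0 m0" "real (card F) \<le> C * (real m0 ^ 2 / ln (real m0) ^ 2)"
      using C(2)[of m0 n0] by blast
    have lnpos: "0 < ln (real n0)" using lnn0 x by linarith
    have "real m0 ^ 2 / ln (real m0) ^ 2 \<le> w ^ 2 / ln (real n0) ^ 2"
    proof (rule frac_le)
      show "real m0 ^ 2 \<le> w ^ 2" using m0w(1) by (intro power_mono) auto
      have "ln (real n0) \<le> ln (real m0)" using m0n0 n0m1 by (subst ln_le_cancel_iff) auto
      thus "ln (real n0) ^ 2 \<le> ln (real m0) ^ 2" using lnpos by (intro power_mono) auto
    qed (use lnpos in auto)
    also have "\<dots> = \<delta> ^ 2 * real n0 ^ 2" unfolding w_def using lnpos by (simp add: power_mult_distrib)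
    finally have "C * (real m0 ^ 2 / ln (real m0) ^ 2) \<le> C * (\<delta> ^ 2 * real n0 ^ 2)"
      using C(1) by (intro mult_left_mono) auto
    also have "\<dots> = real n0 ^ 2 / 8" using \<delta>(2) by (simp add: mult.assoc[symmetric])
    finally have cF: "real (card F) \<le> real n0 ^ 2 / 8" using F(2) by linarith
    have n02: "real n0 \<ge> 2" using n0m1 by linarith
    have "real (n0 choose 2) \<ge> real n0 ^ 2 / 4"
    proof -
      have "real (n0 choose 2) = real n0 * (real n0 - 1) / 2" by (simp add: real_choose_two)
      moreover have "real n0 * (real n0 / 2) \<le> real n0 * (real n0 - 1)" using n02 by (intro mult_left_mono) auto
      ultimately show ?thesis by (simp add: power2_eq_square)
    qed
    hence edge0: "real ((n0 choose 2) - card F) \<ge> real n0 ^ 2 / 8"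
      using cF card_complement_universal(2)[OF F(1)] by (simp add: of_nat_diff)
    define k where "k = n div (2 * n0)"
    have n0n: "4 * real n0 \<le> x" using n0y(1) yn by linarith
    have kB: "real k \<ge> x / (4 * real n0)"
    proof -
      have "n < (k + 1) * (2 * n0)"
        unfolding k_def using dividend_less_div_times[of "2 * n0" n] n02 by simp
      hence "real n < real ((k + 1) * (2 * n0))" by (rule of_nat_less_iff[THEN iffD2])
      hence "x < (real k + 1) * (2 * real n0)" unfolding x_def by (simp add: distrib_right)
      hence "x \<le> real k * (4 * real n0)" using n0n by (simp add: algebra_simps)
      thus ?thesis using n02 by (simp add: pos_divide_le_eq)
    qed
    have "\<exists>H :: nat graph. unavoidable n e H \<and> card (edges H) = k * ((n0 choose 2) - card F)"
    proof (rule unavoidable_disjoint_copies[OF F(1)])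
      show "m = (n choose 2) - e" using em by blast
      show "n \<ge> 4" using p by linarith
      show "2 * (k * n0) \<le> n" unfolding k_def using div_times_less_eq_dividend[of n "2 * n0"] by (simp add: ac_simps)
      have "4 * real m * (real n0 * real n0) \<le> 4 * real m * (real n0 * y)"
        using n0y(1) by (intro mult_left_mono) auto
      also have "\<dots> = (4 / A) * (real n0 * ln x) * x ^ 2"
        unfolding y_def using A(1) \<open>real m > 0\<close> by (simp add: field_simps)
      also have "\<dots> \<le> (\<delta> / 8) * (real n0 * (4 * ln (real n0))) * x ^ 2"
        using A \<delta>(1) lnn0 x by (intro mult_right_mono mult_mono) auto
      also have "\<dots> = w / 2 * x ^ 2" unfolding w_def by simp
      also have "\<dots> \<le> real m0 * x ^ 2" using m0h by (intro mult_right_mono) auto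
      finally have "real (4 * m * (n0 * n0)) \<le> real (m0 * (n * n))" unfolding x_def by (simp add: power2_eq_square)
      thus "4 * m * (n0 * n0) \<le> m0 * (n * n)" by (simp only: of_nat_le_iff)
    qed (use n02 in auto)
    then obtain H :: "nat graph" where H: "unavoidable n e H" "card (edges H) = k * ((n0 choose 2) - card F)" by blast
    have "c * (x ^ 3 * ln x / real m) = x * (y / 2) / 32"
      unfolding c_def y_def by (simp add: power2_eq_square power3_eq_cube)
    also have "\<dots> \<le> x * real n0 / 32" using n0h x by (intro divide_right_mono mult_left_mono) auto
    also have "\<dots> = x / (4 * real n0) * (real n0 ^ 2 / 8)" using n02 by (simp add: power2_eq_square)
    also have "\<dots> \<le> real k * real ((n0 choose 2) - card F)"
      using kB edge0 x by (intro mult_mono) auto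
    also have "\<dots> = real (card (edges H))" unfolding H(2) by simp
    also have "\<dots> \<le> real (max_unavoidable n e)"
      using max_unavoidable_ge[OF H(1)] em by simp
    finally show "c * (real n ^ 3 * ln (real n) / real m) \<le> real (max_unavoidable n e)" unfolding x_def .
  qed
  with c0 show ?thesis by blast
qed

lemma max_unavoidable_le_dense:
  assumes "n > 1" "e \<le> n choose 2" "m = (n choose 2) - e" "0 < m"
  shows "real (max_unavoidable n e) \<le> real n ^ 3 * ln (real n) / real m"
proof -
  obtain H :: "nat graph" where H: "unavoidable n e H" "max_unavoidable n e = card (edges H)"
    using max_unavoidable_attained[OF assms(2)] .
  have "real (card (edges H)) * real m \<le> real (n choose 2) * (real n * ln (real n))"
    using unavoidable_edges_bound[OF H(1) assms(2)] assms by simp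
  also have "\<dots> \<le> real n ^ 2 * (real n * ln (real n))"
  proof (rule mult_right_mono)
    have "n choose 2 \<le> n * (n - 1)" unfolding choose_two by (rule div_le_dividend)
    also have "\<dots> \<le> n ^ 2" by (simp add: power2_eq_square)
    finally show "real (n choose 2) \<le> real n ^ 2" by (metis of_nat_mono of_nat_power)
  qed (use assms(1) in simp)
  also have "\<dots> = real n ^ 3 * ln (real n)" by (simp add: power2_eq_square power3_eq_cube)
  finally show ?thesis unfolding H(2) using assms(4) by (simp add: pos_le_divide_eq)
qed

text \<open>The constants are fixed before \<open>n\<close> and serve all \<open>e\<close> at once,
  so both estimates are uniform in m. The first range starts at m = 2 because m^2/ln^2 m has no
  meaning where ln m is 0.\<close>

theorem theorem1p1:
  fixes \<epsilon> :: real
  assumes "\<epsilon> > 0"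
  shows "\<exists>c C :: real. c > 0 \<and> C > 0 \<and>
    (\<forall>\<^sub>F n :: nat in sequentially. \<forall>e m :: nat.
       1 \<le> e \<and> e \<le> n choose 2 \<and> m = (n choose 2) - e \<longrightarrow>
       (2 \<le> m \<and> real m \<le> real n * ln (real n) \<longrightarrow>
          real (n choose 2) - C * (real m ^ 2 / ln (real m) ^ 2) \<le> real (max_unavoidable n e) \<and>
          real (max_unavoidable n e) \<le> real (n choose 2) - c * (real m ^ 2 / ln (real m) ^ 2)) \<and>
       (real n * ln (real n) < real m \<and> real m < real n powr (3 / 2 - \<epsilon>) \<longrightarrow>
          c * (real n ^ 3 * ln (real n) / real m) \<le> real (max_unavoidable n e) \<and>
          real (max_unavoidable n e) \<le> C * (real n ^ 3 * ln (real n) / real m)))"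
proof -
  obtain c1 where c1: "c1 > 0" "\<forall>n>1. \<forall>e m. e \<le> n choose 2 \<and> m = (n choose 2) - e \<and> 2 \<le> m \<and> real m \<le> real n * ln (real n) \<longrightarrow>
    real (max_unavoidable n e) \<le> real (n choose 2) - c1 * (real m ^ 2 / ln (real m) ^ 2)"
    using max_unavoidable_le_sparse by blast
  obtain c2 where c2: "c2 > 0" "\<forall>\<^sub>F n in sequentially. \<forall>e m. e \<le> n choose 2 \<and> m = (n choose 2) - e \<and>
      real n * ln (real n) < real m \<and> real m < real n powr (3 / 2) \<longrightarrow>
    c2 * (real n ^ 3 * ln (real n) / real m) \<le> real (max_unavoidable n e)"
    using max_unavoidable_ge_dense by blast
  obtain C1 where C1: "C1 > 0" "\<forall>\<^sub>F n in sequentially. \<forall>e m. e \<le> n choose 2 \<and> m = (n choose 2) - e \<and> 2 \<le> m \<longrightarrow>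
    real (n choose 2) - C1 * (real m ^ 2 / ln (real m) ^ 2) \<le> real (max_unavoidable n e)"
    using max_unavoidable_ge_sparse by blast
  define c C where "c = min c1 c2" and "C = max C1 1"
  have cC: "c > 0" "C > 0" "c \<le> c1" "c \<le> c2" "C1 \<le> C" "1 \<le> C" unfolding c_def C_def using c1 c2 by auto
  from c2(2) C1(2) eventually_gt_at_top[of 1]
  have "\<forall>\<^sub>F n :: nat in sequentially. \<forall>e m :: nat.
       1 \<le> e \<and> e \<le> n choose 2 \<and> m = (n choose 2) - e \<longrightarrow>
       (2 \<le> m \<and> real m \<le> real n * ln (real n) \<longrightarrow>
          real (n choose 2) - C * (real m ^ 2 / ln (real m) ^ 2) \<le> real (max_unavoidable n e) \<and>
          real (max_unavoidable n e) \<le> real (n choose 2) - c * (real m ^ 2 / ln (real m) ^ 2)) \<and>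
       (real n * ln (real n) < real m \<and> real m < real n powr (3 / 2 - \<epsilon>) \<longrightarrow>
          c * (real n ^ 3 * ln (real n) / real m) \<le> real (max_unavoidable n e) \<and>
          real (max_unavoidable n e) \<le> C * (real n ^ 3 * ln (real n) / real m))"
  proof eventually_elim
    case (elim n)
    note n = elim(3)
    show ?case
    proof (intro allI impI, intro conjI impI)
      fix e m assume em: "1 \<le> e \<and> e \<le> n choose 2 \<and> m = (n choose 2) - e"
      define Q where "Q = real m ^ 2 / ln (real m) ^ 2"
      have Q0: "Q \<ge> 0" unfolding Q_def by simp
      assume m: "2 \<le> m \<and> real m \<le> real n * ln (real n)"
      have "real (n choose 2) - C1 * Q \<le> real (max_unavoidable n e)"
        unfolding Q_def using elim(2) em m by blast
      moreover have "C1 * Q \<le> C * Q" using cC(5) Q0 by (rule mult_right_mono)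
      ultimately show "real (n choose 2) - C * (real m ^ 2 / ln (real m) ^ 2) \<le> real (max_unavoidable n e)"
        unfolding Q_def by linarith
      have "real (max_unavoidable n e) \<le> real (n choose 2) - c1 * Q"
        unfolding Q_def using c1(2) n em m by blast
      moreover have "c * Q \<le> c1 * Q" using cC(3) Q0 by (rule mult_right_mono)
      ultimately show "real (max_unavoidable n e) \<le> real (n choose 2) - c * (real m ^ 2 / ln (real m) ^ 2)"
        unfolding Q_def by linarith
    next
      fix e m assume em: "1 \<le> e \<and> e \<le> n choose 2 \<and> m = (n choose 2) - e"
      define Q where "Q = real n ^ 3 * ln (real n) / real m"
      have Q0: "Q \<ge> 0" unfolding Q_def using n by simp
      assume m: "real n * ln (real n) < real m \<and> real m < real n powr (3 / 2 - \<epsilon>)"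
      have "real n powr (3 / 2 - \<epsilon>) \<le> real n powr (3 / 2)" using assms n by (intro powr_mono) auto
      hence "real m < real n powr (3 / 2)" using m by linarith
      hence "c2 * Q \<le> real (max_unavoidable n e)" unfolding Q_def using elim(1) em m by blast
      moreover have "c * Q \<le> c2 * Q" using cC(4) Q0 by (rule mult_right_mono)
      ultimately show "c * (real n ^ 3 * ln (real n) / real m) \<le> real (max_unavoidable n e)"
        unfolding Q_def by linarith
      have "0 \<le> real n * ln (real n)" using n by simp
      hence "0 < m" using m by linarith
      hence "real (max_unavoidable n e) \<le> Q"
        unfolding Q_def using max_unavoidable_le_dense[of n e m] n em by blast
      also have "Q \<le> C * Q" using mult_right_mono[OF cC(6) Q0] by simp
      finally show "real (max_unavoidable n e) \<le> C * (real n ^ 3 * ln (real n) / real m)" unfolding Q_def .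
    qed
  qed
  with cC(1,2) show ?thesis by blast
qed

end
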